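(* Let $N\ge3$, $\bar\mu:=\left(\frac{N-2}{2}\right)^2$, $\mu\in(0,\bar\mu)$, $\nu:=\sqrt{\bar\mu}-\sqrt{\bar\mu-\mu}$, $p\ge 2^*-1$ with $2^*=\frac{2N}{N-2}$, and $q>\max\left\{p,\frac{2+\nu}{\nu}\right\}$. Let $\Omega\subseteq\mathbb{R}^N$ be a smooth domain (bounded or unbounded) with $0\in\Omega$. Then for any solution $u$ of $$-\Delta u-\mu\frac{u}{|x|^2}=u^p-u^q\ \text{ in }\Omega,\qquad u>0\ \text{ in }\Omega,\qquad u\in H_0^1(\Omega)\cap L^{q+1}(\Omega),$$ there exist $C>0$ and a sufficiently small $R>0$ such that $$u(x)\ge C|x|^{-\frac{2}{q-1}}\qquad\forall\,x\in B_R(0)\setminus\{0\}.$$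
   Context: $B_r(0)$ is the open ball of radius $r$ centred at $0$. Solutions are understood in the weak sense. *)

theory Defs
  imports "HOL-Analysis.Analysis"
begin

primrec Ck :: "nat \<Rightarrow> ('a::euclidean_space \<Rightarrow> real) \<Rightarrow> bool" where
  "Ck 0 f = continuous_on UNIV f"
| "Ck (Suc k) f = ((\<forall>x. f differentiable (at x)) \<and>
      (\<forall>b\<in>Basis. Ck k (\<lambda>x. frechet_derivative f (at x) b)))"

definition smooth :: "('a::euclidean_space \<Rightarrow> real) \<Rightarrow> bool" where
  "smooth f \<longleftrightarrow> (\<forall>k. Ck k f)"

definition grad :: "('a::euclidean_space \<Rightarrow> real) \<Rightarrow> 'a \<Rightarrow> 'a" where
  "grad f x = (\<Sum>b\<in>Basis. frechet_derivative f (at x) b *\<^sub>R b)"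

text \<open>Smoothness of the boundary: near each boundary point the domain is the region above the
  graph of a smooth function, with respect to some direction \<open>e\<close>. The graph function lives on
  the hyperplane orthogonal to \<open>e\<close>; it is represented by a smooth function on the whole space
  that is only evaluated on that hyperplane.\<close>

definition smooth_domain :: "'a::euclidean_space set \<Rightarrow> bool" where
  "smooth_domain \<Omega> \<longleftrightarrow> open \<Omega> \<and> connected \<Omega> \<and> \<Omega> \<noteq> {} \<and>
     (\<forall>z\<in>frontier \<Omega>. \<exists>r>0. \<exists>e \<gamma>. norm e = 1 \<and> smooth \<gamma> \<and>
        \<Omega> \<inter> ball z r = {x \<in> ball z r. \<gamma> (x - (x \<bullet> e) *\<^sub>R e) < x \<bullet> e})"

definition test_functions :: "'a::euclidean_space set \<Rightarrow> ('a \<Rightarrow> real) set" where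
  "test_functions \<Omega> = {\<phi>. smooth \<phi> \<and> compact (closure {x. \<phi> x \<noteq> 0}) \<and> closure {x. \<phi> x \<noteq> 0} \<subseteq> \<Omega>}"

definition Lp :: "real \<Rightarrow> 'a::euclidean_space set \<Rightarrow> ('a \<Rightarrow> 'b::euclidean_space) set" where
  "Lp r \<Omega> = {f. f \<in> borel_measurable (lebesgue_on \<Omega>) \<and>
                 integrable (lebesgue_on \<Omega>) (\<lambda>x. norm (f x) powr r)}"

definition L1_loc :: "'a::euclidean_space set \<Rightarrow> ('a \<Rightarrow> 'b::euclidean_space) set" where
  "L1_loc \<Omega> = {f. \<forall>K. compact K \<and> K \<subseteq> \<Omega> \<longrightarrow> integrable (lebesgue_on K) f}"

definition has_weak_gradient ::
    "'a::euclidean_space set \<Rightarrow> ('a \<Rightarrow> real) \<Rightarrow> ('a \<Rightarrow> 'a) \<Rightarrow> bool" where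
  "has_weak_gradient \<Omega> u g \<longleftrightarrow> u \<in> L1_loc \<Omega> \<and> g \<in> L1_loc \<Omega> \<and>
     (\<forall>\<phi>\<in>test_functions \<Omega>.
        integral\<^sup>L (lebesgue_on \<Omega>) (\<lambda>x. u x *\<^sub>R grad \<phi> x) =
        - integral\<^sup>L (lebesgue_on \<Omega>) (\<lambda>x. \<phi> x *\<^sub>R g x))"

text \<open>Sobolev functions are represented by ordinary functions; only their values on \<open>\<Omega>\<close>, up to
  null sets, matter. The space \<open>H01 \<Omega>\<close> is the closure of the test functions in the
  \<open>H\<^sup>1\<close>-norm.\<close>

definition H01 :: "'a::euclidean_space set \<Rightarrow> ('a \<Rightarrow> real) set" where
  "H01 \<Omega> = {u. u \<in> Lp 2 \<Omega> \<and> (\<exists>g. has_weak_gradient \<Omega> u g \<and> g \<in> Lp 2 \<Omega> \<and>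
     (\<exists>\<phi>. (\<forall>n::nat. \<phi> n \<in> test_functions \<Omega>) \<and>
        (\<lambda>n. integral\<^sup>L (lebesgue_on \<Omega>)
                (\<lambda>x. (\<phi> n x - u x)\<^sup>2 + (norm (grad (\<phi> n) x - g x))\<^sup>2)) \<longlonglongrightarrow> 0))}"

text \<open>Weak solutions of \<open>-\<Delta>u - \<mu> u/|x|\<^sup>2 = u\<^sup>p - u\<^sup>q\<close> in \<open>\<Omega>\<close>. In dimension at least 3, for positive
  \<open>u \<in> H01 \<Omega> \<inter> Lp (q + 1) \<Omega>\<close> and \<open>1 \<le> p \<le> q\<close>, each term below is integrable
  (the singular one by Hardy's inequality).\<close>

definition weak_solution ::
    "'a::euclidean_space set \<Rightarrow> real \<Rightarrow> real \<Rightarrow> real \<Rightarrow> ('a \<Rightarrow> real) \<Rightarrow> bool" where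
  "weak_solution \<Omega> \<mu> p q u \<longleftrightarrow> (\<exists>g. has_weak_gradient \<Omega> u g \<and>
     (\<forall>\<phi>\<in>test_functions \<Omega>.
        integral\<^sup>L (lebesgue_on \<Omega>) (\<lambda>x. g x \<bullet> grad \<phi> x)
        - \<mu> * integral\<^sup>L (lebesgue_on \<Omega>) (\<lambda>x. u x * \<phi> x / (norm x)\<^sup>2)
        = integral\<^sup>L (lebesgue_on \<Omega>) (\<lambda>x. (u x powr p - u x powr q) * \<phi> x)))"

end

theory Submission
  imports Defs
begin

text \<open>
  Everything takes place in the sense of distributions on \<open>\<Omega> - {0}\<close>; neither Hardy's inequality nor
  Sobolev theory is needed. Kato's inequality, obtained by mollifying \<open>u\<close>, shows that \<open>(w - u)\<^sup>+\<close> is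
  a subsolution whenever \<open>w\<close> is one. With \<open>w = 1\<close> and \<open>|x|\<^sup>2 \<le> \<mu>\<close>, the Hardy term absorbs \<open>u\<^sup>q\<close>, so
  \<open>min 1 u\<close> is superharmonic near \<open>0\<close> and, by the mean value inequality, bounded below on an annulus.
  With \<open>w = c * |x| powr (- \<alpha>)\<close>, where \<open>\<alpha> = 2 / (q - 1) < \<nu>\<close> and \<open>c\<close> is small, \<open>w\<close> is a subsolution that lies
  below \<open>u\<close> on that annulus. Testing with \<open>|x| powr (- (N - 2) / 2)\<close>, a strict supersolution of the linear
  equation because \<open>\<mu> < ((N - 2) / 2)\<^sup>2\<close>, and cutting off at \<open>|x| = \<epsilon>\<close>, gives \<open>(w - u)\<^sup>+ = 0\<close> inside: the
  cut-off error is at most of order \<open>\<epsilon>\<close> to the power \<open>(N - 2) / 2 - \<alpha> > 0\<close>, since \<open>0 \<le> (w - u)\<^sup>+ \<le> w\<close>.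
\<close>

subsection \<open>Second differences and Laplacians\<close>

text \<open>The obstacle is that u is only an equivalence class: it has no boundary values, no upper
  bound and no known behaviour at 0. Maximum principles are therefore replaced by integral
  inequalities for the positive part of w - u. The constants come from homogeneity. Since \<alpha>
  (q - 1) = 2, the functions w^q and w / |x|^2 have the same degree, and \<Delta>w = - \<alpha> (N -
  2 - \<alpha>) w / |x|^2. Hence w is a subsolution as soon as c^(q - 1) \<le> \<mu> - \<alpha> (N -
  2 - \<alpha>); the term u^p enters only through its sign. As \<nu> is the smaller root of t (N - 2
  - t) = \<mu>, the right side is positive for \<alpha> < \<nu>, which is what q > (2 + \<nu>) /
  \<nu> says. The exponent (N - 2) / 2 of the test function maximises t (N - 2 - t), which leaves
  the gap mubar - \<mu> in the linear inequality. Half of this gap absorbs the cut-off error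
  wherever |x| \<ge> B \<epsilon> for a fixed B, so that only a thin shell has to be estimated by
  hand.\<close>

text \<open>Summation by parts and Kato's inequality hold exactly for second differences of arbitrary
  functions, so that neither \<open>u\<close> nor its mollifications ever have to be differentiated.\<close>

definition diff_lap :: "real \<Rightarrow> ('a::euclidean_space \<Rightarrow> real) \<Rightarrow> 'a \<Rightarrow> real" where
  "diff_lap t f x = (\<Sum>b\<in>Basis. f (x + t *\<^sub>R b) + f (x - t *\<^sub>R b) - 2 * f x) / t\<^sup>2"

text \<open>The uniform bound for steps in (0, 1] is the domination under which the step size tends
  to 0 inside integrals. No derivative of \<open>f\<close> occurs, so smooth functions and functions
  glued from C2 pieces are treated alike.\<close>

definition has_lap :: "('a::euclidean_space \<Rightarrow> real) \<Rightarrow> ('a \<Rightarrow> real) \<Rightarrow> bool" where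
  "has_lap f L \<longleftrightarrow> continuous_on UNIV f \<and> continuous_on UNIV L \<and>
     (\<forall>x. ((\<lambda>t. diff_lap t f x) \<longlongrightarrow> L x) (at_right 0)) \<and>
     (\<forall>R. \<exists>C. \<forall>x\<in>cball 0 R. \<forall>t. 0 < t \<and> t \<le> 1 \<longrightarrow> \<bar>diff_lap t f x\<bar> \<le> C)"

lemma continuous_bounded_cball:
  fixes f :: "'a::euclidean_space \<Rightarrow> real"
  assumes "continuous_on UNIV f"
  obtains C where "0 \<le> C" "\<And>x. x \<in> cball 0 R \<Longrightarrow> \<bar>f x\<bar> \<le> C"
proof -
  have "bounded (f ` cball 0 R)"
    by (intro compact_imp_bounded compact_continuous_image continuous_on_subset[OF assms]) auto
  then have "\<exists>C. \<forall>x\<in>cball 0 R. \<bar>f x\<bar> \<le> C"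
    unfolding bounded_iff by auto
  then obtain C where C: "\<And>x. x \<in> cball 0 R \<Longrightarrow> \<bar>f x\<bar> \<le> C"
    by blast
  show thesis
    by (rule that[of "max 0 C"]) (use C in \<open>auto simp: le_max_iff_disj\<close>)
qed

text \<open>The even function \<open>f (x + \<tau> *\<^sub>R b) + f (x - \<tau> *\<^sub>R b)\<close>
  has a second order Maclaurin formula that expresses the second difference exactly as t^2 times a
  mean of two values of \<open>D2 b\<close> at distance less than t from x. Continuity of
  \<open>D2 b\<close> then yields the limit and the local bound together.\<close>

lemma has_lap_I:
  fixes f :: "'a::euclidean_space \<Rightarrow> real"
  assumes f: "continuous_on UNIV f"
    and D1: "\<And>b x. b \<in> Basis \<Longrightarrow> ((\<lambda>\<tau>. f (x + \<tau> *\<^sub>R b)) has_real_derivative D1 b x) (at 0)"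
    and D2: "\<And>b x. b \<in> Basis \<Longrightarrow> ((\<lambda>\<tau>. D1 b (x + \<tau> *\<^sub>R b)) has_real_derivative D2 b x) (at 0)"
    and cont: "\<And>b. b \<in> Basis \<Longrightarrow> continuous_on UNIV (D2 b)"
  shows "has_lap f (\<lambda>x. \<Sum>b\<in>Basis. D2 b x)"
proof -
  have line: "((\<lambda>\<tau>. h (x + \<tau> *\<^sub>R b)) has_real_derivative h' (x + s *\<^sub>R b)) (at s)"
    if "\<And>x. ((\<lambda>\<tau>. h (x + \<tau> *\<^sub>R b)) has_real_derivative h' x) (at 0)" for h h' x s and b :: 'a
  proof -
    have "((\<lambda>\<tau>. h ((x + s *\<^sub>R b) + \<tau> *\<^sub>R b)) has_real_derivative h' (x + s *\<^sub>R b)) (at 0)"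
      by (rule that)
    then show ?thesis
      using DERIV_shift[of "\<lambda>\<tau>. h (x + \<tau> *\<^sub>R b)" "h' (x + s *\<^sub>R b)" 0 s] by (simp add: algebra_simps)
  qed
  have taylor: "\<exists>\<xi>. 0 < \<xi> \<and> \<xi> < t \<and>
      f (x + t *\<^sub>R b) + f (x - t *\<^sub>R b) - 2 * f x = t\<^sup>2 * ((D2 b (x + \<xi> *\<^sub>R b) + D2 b (x - \<xi> *\<^sub>R b)) / 2)"
    if b: "b \<in> Basis" and t: "0 < t" for b x t
  proof -
    \<comment> \<open>The entry for 1 vanishes at \<tau> = 0, so the formula has no linear
      term.\<close>
    define d where "d = (\<lambda>n::nat. if n = 0 then (\<lambda>\<tau>. f (x + \<tau> *\<^sub>R b) + f (x - \<tau> *\<^sub>R b))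
      else if n = 1 then (\<lambda>\<tau>. D1 b (x + \<tau> *\<^sub>R b) - D1 b (x - \<tau> *\<^sub>R b))
      else (\<lambda>\<tau>. D2 b (x + \<tau> *\<^sub>R b) + D2 b (x - \<tau> *\<^sub>R b)))"
    have mirror: "((\<lambda>\<tau>. h (x - \<tau> *\<^sub>R b)) has_real_derivative - h' (x - s *\<^sub>R b)) (at s)"
      if "\<And>x. ((\<lambda>\<tau>. h (x + \<tau> *\<^sub>R b)) has_real_derivative h' x) (at 0)" for h h' s
      using DERIV_chain2[where f="\<lambda>\<tau>. h (x + \<tau> *\<^sub>R b)" and g=uminus and x=s and s=UNIV,
          OF line[of h b h' x "-s", OF that] DERIV_minus[OF DERIV_ident]] by simp
    have "DERIV (d m) s :> d (Suc m) s" if "m < 2" for m s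
    proof (cases "m = 0")
      case True
      show ?thesis unfolding d_def using True
        by (auto intro!: DERIV_add[OF line[OF D1[OF b]] mirror[OF D1[OF b]], simplified] )
    next
      case False
      then have "m = 1" using that by auto
      then show ?thesis unfolding d_def
        by (auto intro!: DERIV_diff[OF line[OF D2[OF b]] mirror[OF D2[OF b]], simplified] )
    qed
    then obtain \<xi> where "0 < \<xi>" "\<xi> < t" "d 0 t = (\<Sum>m<2. d m 0 / fact m * t ^ m) + d 2 \<xi> / fact 2 * t ^ 2"
      using Maclaurin[of t 2 d "d 0"] t by auto
    then show ?thesis
      by (intro exI[of _ \<xi>]) (auto simp: d_def eval_nat_numeral field_simps)
  qed
  \<comment> \<open>The intermediate point is chosen once for all x and t, since the limit t
    \<rightarrow> 0 is taken along it.\<close>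
  define \<xi> where "\<xi> = (\<lambda>b x t. SOME \<xi>. 0 < \<xi> \<and> \<xi> < t \<and>
      f (x + t *\<^sub>R b) + f (x - t *\<^sub>R b) - 2 * f x = t\<^sup>2 * ((D2 b (x + \<xi> *\<^sub>R b) + D2 b (x - \<xi> *\<^sub>R b)) / 2))"
  have \<xi>: "0 < \<xi> b x t \<and> \<xi> b x t < t \<and>
      f (x + t *\<^sub>R b) + f (x - t *\<^sub>R b) - 2 * f x =
        t\<^sup>2 * ((D2 b (x + \<xi> b x t *\<^sub>R b) + D2 b (x - \<xi> b x t *\<^sub>R b)) / 2)"
    if "b \<in> Basis" "0 < t" for b x t
    unfolding \<xi>_def by (rule someI_ex, rule taylor[OF that])
  have eq: "diff_lap t f x = (\<Sum>b\<in>Basis. (D2 b (x + \<xi> b x t *\<^sub>R b) + D2 b (x - \<xi> b x t *\<^sub>R b)) / 2)"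
    if "0 < t" for t x
    unfolding diff_lap_def sum_divide_distrib
    by (rule sum.cong) (use \<xi> that in auto)
  have "((\<lambda>t. diff_lap t f x) \<longlongrightarrow> (\<Sum>b\<in>Basis. D2 b x)) (at_right 0)" for x
  proof -
    have "((\<lambda>t. \<Sum>b\<in>Basis. (D2 b (x + \<xi> b x t *\<^sub>R b) + D2 b (x - \<xi> b x t *\<^sub>R b)) / 2)
        \<longlongrightarrow> (\<Sum>b\<in>Basis. (D2 b x + D2 b x) / 2)) (at_right 0)"
    proof (intro tendsto_intros)
      fix b :: 'a assume b: "b \<in> Basis"
      have ev: "\<forall>\<^sub>F t in at_right 0. 0 < (t::real)"
        by (simp add: eventually_at_right_less)
      have \<xi>0: "((\<lambda>t. \<xi> b x t) \<longlongrightarrow> 0) (at_right 0)"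
        by (rule tendsto_sandwich[where f="\<lambda>_. 0" and h="\<lambda>t. t"])
           (auto intro!: tendsto_eq_intros eventually_mono[OF ev] less_imp_le \<xi>[OF b, THEN conjunct1]
              \<xi>[OF b, THEN conjunct2, THEN conjunct1])
      have "((\<lambda>t. x + \<xi> b x t *\<^sub>R b) \<longlongrightarrow> x) (at_right 0)" "((\<lambda>t. x - \<xi> b x t *\<^sub>R b) \<longlongrightarrow> x) (at_right 0)"
        by (auto intro!: tendsto_eq_intros \<xi>0)
      then show "((\<lambda>t. D2 b (x + \<xi> b x t *\<^sub>R b)) \<longlongrightarrow> D2 b x) (at_right 0)"
        "((\<lambda>t. D2 b (x - \<xi> b x t *\<^sub>R b)) \<longlongrightarrow> D2 b x) (at_right 0)"
        using cont[OF b] by (auto intro!: continuous_on_tendsto_compose[of UNIV "D2 b"])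
    qed auto
    moreover have "\<forall>\<^sub>F t in at_right 0. (\<Sum>b\<in>Basis. (D2 b (x + \<xi> b x t *\<^sub>R b) + D2 b (x - \<xi> b x t *\<^sub>R b)) / 2)
        = diff_lap t f x"
      using eventually_at_right_less[of 0] by eventually_elim (simp add: eq)
    ultimately show ?thesis
      by (rule_tac Lim_transform_eventually) auto
  qed
  moreover have "\<exists>C. \<forall>x\<in>cball 0 R. \<forall>t. 0 < t \<and> t \<le> 1 \<longrightarrow> \<bar>diff_lap t f x\<bar> \<le> C" for R
  proof -
    have "\<forall>b\<in>Basis. \<exists>C. \<forall>x\<in>cball 0 (R + 1). \<bar>D2 b x\<bar> \<le> C"
      using continuous_bounded_cball[OF cont] by meson
    then obtain C where C: "\<And>b x. b \<in> Basis \<Longrightarrow> x \<in> cball 0 (R + 1) \<Longrightarrow> \<bar>D2 b x\<bar> \<le> C b"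
      by metis
    show ?thesis
    proof (intro exI ballI allI impI)
      fix x :: 'a and t :: real assume x: "x \<in> cball 0 R" and t: "0 < t \<and> t \<le> 1"
      have "\<bar>(D2 b (x + \<xi> b x t *\<^sub>R b) + D2 b (x - \<xi> b x t *\<^sub>R b)) / 2\<bar> \<le> C b" if b: "b \<in> Basis" for b
      proof -
        have "\<xi> b x t \<le> 1" "0 < \<xi> b x t" using \<xi>[OF b, of t x] t by auto
        then have "x + \<xi> b x t *\<^sub>R b \<in> cball 0 (R + 1)" "x - \<xi> b x t *\<^sub>R b \<in> cball 0 (R + 1)"
          using x b norm_triangle_ineq[of x "\<xi> b x t *\<^sub>R b"] norm_triangle_ineq4[of x "\<xi> b x t *\<^sub>R b"]
          by auto
        from C[OF b this(1)] C[OF b this(2)] show ?thesis by (simp add: abs_le_iff field_simps)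
      qed
      then show "\<bar>diff_lap t f x\<bar> \<le> (\<Sum>b\<in>Basis. C b)"
        using t by (subst eq) (auto intro!: order.trans[OF sum_abs] sum_mono)
    qed
  qed
  moreover have "continuous_on UNIV (\<lambda>x. \<Sum>b\<in>Basis. D2 b x)"
    by (intro continuous_on_sum cont)
  ultimately show ?thesis using f by (simp add: has_lap_def)
qed

text \<open>Both derivatives are carried as explicit functions, so that Laplacians of radial
  functions come out in closed form.\<close>

definition C2_with :: "(real \<Rightarrow> real) \<Rightarrow> (real \<Rightarrow> real) \<Rightarrow> (real \<Rightarrow> real) \<Rightarrow> bool" where
  "C2_with f f' f'' \<longleftrightarrow> (\<forall>s. (f has_real_derivative f' s) (at s)) \<and>
     (\<forall>s. (f' has_real_derivative f'' s) (at s)) \<and> continuous_on UNIV f''"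

lemma sum_Basis_inner_sq: "(\<Sum>b\<in>Basis. (x \<bullet> b)\<^sup>2) = (norm x)\<^sup>2"
  for x :: "'a::euclidean_space"
  by (simp add: norm_eq_sqrt_inner euclidean_inner[of x x] power2_eq_square sum_nonneg)

text \<open>The profile is a function of the squared norm: along a coordinate line this is a
  quadratic polynomial, so the chain rule holds at the centre as well, where the norm is not
  differentiable.\<close>

lemma has_lap_radial:
  fixes x0 :: "'a::euclidean_space" and \<Phi> \<Phi>' \<Phi>'' :: "real \<Rightarrow> real"
  assumes "C2_with \<Phi> \<Phi>' \<Phi>''"
  shows "has_lap (\<lambda>x. \<Phi> ((norm (x - x0))\<^sup>2))
    (\<lambda>x. 4 * (norm (x - x0))\<^sup>2 * \<Phi>'' ((norm (x - x0))\<^sup>2) + 2 * real DIM('a) * \<Phi>' ((norm (x - x0))\<^sup>2))"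
proof -
  have d: "\<And>s. (\<Phi> has_real_derivative \<Phi>' s) (at s)" "\<And>s. (\<Phi>' has_real_derivative \<Phi>'' s) (at s)"
    and c'': "continuous_on UNIV \<Phi>''"
    using assms by (auto simp: C2_with_def)
  have c: "continuous_on UNIV \<Phi>" "continuous_on UNIV \<Phi>'"
    using d by (auto intro!: DERIV_continuous_on)
  have sq: "((\<lambda>\<tau>. (norm (x + \<tau> *\<^sub>R b - x0))\<^sup>2) has_real_derivative 2 * ((x - x0) \<bullet> b)) (at 0)"
    if "b \<in> Basis" for b x
  proof -
    have "(norm (x + \<tau> *\<^sub>R b - x0))\<^sup>2 = (norm (x - x0))\<^sup>2 + 2 * \<tau> * ((x - x0) \<bullet> b) + \<tau>\<^sup>2" for \<tau>
      using that unfolding power2_norm_eq_inner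
      by (simp add: algebra_simps inner_commute power2_eq_square)
    moreover have "((\<lambda>\<tau>. (norm (x - x0))\<^sup>2 + 2 * \<tau> * ((x - x0) \<bullet> b) + \<tau>\<^sup>2) has_real_derivative
        2 * ((x - x0) \<bullet> b)) (at 0)"
      by (auto intro!: derivative_eq_intros)
    ultimately show ?thesis by simp
  qed
  have ch: "((\<lambda>\<tau>. h ((norm (x + \<tau> *\<^sub>R b - x0))\<^sup>2)) has_real_derivative
      h' ((norm (x - x0))\<^sup>2) * (2 * ((x - x0) \<bullet> b))) (at 0)"
    if "\<And>s. (h has_real_derivative h' s) (at s)" "b \<in> Basis" for h h' x b
    using DERIV_chain2[of h _ "\<lambda>\<tau>. (norm (x + \<tau> *\<^sub>R b - x0))\<^sup>2", OF _ sq[OF that(2)]] that(1)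
    by fastforce
  have "has_lap (\<lambda>x. \<Phi> ((norm (x - x0))\<^sup>2)) (\<lambda>x. \<Sum>b\<in>Basis.
      \<Phi>'' ((norm (x - x0))\<^sup>2) * (2 * ((x - x0) \<bullet> b)) * (2 * ((x - x0) \<bullet> b)) + \<Phi>' ((norm (x - x0))\<^sup>2) * 2)"
  proof (rule has_lap_I[where ?D1.0="\<lambda>b x. \<Phi>' ((norm (x - x0))\<^sup>2) * (2 * ((x - x0) \<bullet> b))"])
    show "continuous_on UNIV (\<lambda>x. \<Phi> ((norm (x - x0))\<^sup>2))"
      by (auto intro!: continuous_intros continuous_on_compose2[OF c(1)])
    show "continuous_on UNIV (\<lambda>x. \<Phi>'' ((norm (x - x0))\<^sup>2) * (2 * ((x - x0) \<bullet> b)) * (2 * ((x - x0) \<bullet> b)) + \<Phi>' ((norm (x - x0))\<^sup>2) * 2)"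
      for b by (auto intro!: continuous_intros continuous_on_compose2[OF c(2)] continuous_on_compose2[OF c''])
    fix b x :: 'a assume b: "b \<in> Basis"
    show "((\<lambda>\<tau>. \<Phi> ((norm (x + \<tau> *\<^sub>R b - x0))\<^sup>2)) has_real_derivative
       \<Phi>' ((norm (x - x0))\<^sup>2) * (2 * ((x - x0) \<bullet> b))) (at 0)"
      by (rule ch[OF d(1) b])
    have "((\<lambda>\<tau>. 2 * ((x + \<tau> *\<^sub>R b - x0) \<bullet> b)) has_real_derivative 2) (at 0)"
      using b by (auto intro!: derivative_eq_intros simp: inner_simps)
    from DERIV_mult[OF ch[of \<Phi>' \<Phi>'' b x, OF d(2) b] this]
    show "((\<lambda>\<tau>. \<Phi>' ((norm (x + \<tau> *\<^sub>R b - x0))\<^sup>2) * (2 * ((x + \<tau> *\<^sub>R b - x0) \<bullet> b))) has_real_derivative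
        \<Phi>'' ((norm (x - x0))\<^sup>2) * (2 * ((x - x0) \<bullet> b)) * (2 * ((x - x0) \<bullet> b)) + \<Phi>' ((norm (x - x0))\<^sup>2) * 2) (at 0)"
      by (rule DERIV_cong) (use b in simp)
  qed
  moreover have "(\<Sum>b\<in>Basis. \<Phi>'' ((norm (x - x0))\<^sup>2) * (2 * ((x - x0) \<bullet> b)) * (2 * ((x - x0) \<bullet> b)) + \<Phi>' ((norm (x - x0))\<^sup>2) * 2)
    = 4 * (norm (x - x0))\<^sup>2 * \<Phi>'' ((norm (x - x0))\<^sup>2) + 2 * real DIM('a) * \<Phi>' ((norm (x - x0))\<^sup>2)" for x
    unfolding sum.distrib sum_Basis_inner_sq[symmetric, of "x - x0"]
    by (simp add: sum_distrib_left sum_distrib_right power2_eq_square algebra_simps)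
  ultimately show ?thesis by simp
qed

definition smooth_lap :: "('a::euclidean_space \<Rightarrow> real) \<Rightarrow> 'a \<Rightarrow> real" where
  "smooth_lap f x = (\<Sum>b\<in>Basis. frechet_derivative (\<lambda>y. frechet_derivative f (at y) b) (at x) b)"

lemma frechet_derivative_line:
  fixes f :: "'a::euclidean_space \<Rightarrow> real"
  assumes "f differentiable (at x)"
  shows "((\<lambda>\<tau>. f (x + \<tau> *\<^sub>R b)) has_real_derivative frechet_derivative f (at x) b) (at 0)"
proof -
  have f: "(f has_derivative frechet_derivative f (at x)) (at (x + 0 *\<^sub>R b))"
    using assms frechet_derivative_works by auto
  have "((\<lambda>\<tau>. x + \<tau> *\<^sub>R b) has_derivative (\<lambda>\<tau>. \<tau> *\<^sub>R b)) (at 0)"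
    by (auto intro!: derivative_eq_intros)
  from has_derivative_compose[OF this f]
  have "((\<lambda>\<tau>. f (x + \<tau> *\<^sub>R b)) has_derivative (\<lambda>\<tau>. frechet_derivative f (at x) (\<tau> *\<^sub>R b))) (at 0)" .
  moreover have "(\<lambda>\<tau>. frechet_derivative f (at x) (\<tau> *\<^sub>R b)) = (*) (frechet_derivative f (at x) b)"
    using linear_frechet_derivative[OF assms] by (auto simp: linear_scale)
  ultimately show ?thesis by (simp add: has_field_derivative_def)
qed

lemma Ck_continuous: "Ck k f \<Longrightarrow> continuous_on UNIV f"
  by (cases k) (auto intro!: continuous_at_imp_continuous_on differentiable_imp_continuous_within)

lemma smooth_partial: "smooth f \<Longrightarrow> b \<in> Basis \<Longrightarrow> smooth (\<lambda>x. frechet_derivative f (at x) b)"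
  unfolding smooth_def by (metis Ck.simps(2))

lemma smooth_differentiable: "smooth f \<Longrightarrow> f differentiable (at x)"
  unfolding smooth_def by (metis Ck.simps(2))

lemma smooth_continuous: "smooth f \<Longrightarrow> continuous_on UNIV f"
  unfolding smooth_def using Ck_continuous by blast

lemma smooth_has_lap:
  assumes "smooth f"
  shows "has_lap f (smooth_lap f)"
  unfolding smooth_lap_def
  by (rule has_lap_I[where ?D1.0="\<lambda>b x. frechet_derivative f (at x) b"])
     (auto intro!: frechet_derivative_line smooth_differentiable smooth_partial smooth_continuous assms)

section \<open>Translation, domination and bounded supports for integrals over the whole
  space\<close>

lemma integrable_lborel_translate:
  fixes f :: "'a::euclidean_space \<Rightarrow> real"
  assumes "integrable lborel f"
  shows "integrable lborel (\<lambda>x. f (x + c))"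
proof -
  have "integrable (distr lborel borel ((+) c)) f"
    using assms by (simp add: lborel_distr_plus)
  then show ?thesis
    by (subst (asm) integrable_distr_eq) (use assms in \<open>auto simp: add.commute\<close>)
qed

lemma integral_lborel_translate:
  fixes f :: "'a::euclidean_space \<Rightarrow> real"
  assumes [measurable]: "f \<in> borel_measurable borel"
  shows "(LBINT x. f (x + c)) = (LBINT x. f x)"
  by (subst (2) lborel_distr_plus[of c, symmetric], subst integral_distr) (auto simp: add.commute)

lemma integrable_dominated:
  fixes f g :: "'a::euclidean_space \<Rightarrow> real"
  assumes "integrable lborel g" "f \<in> borel_measurable borel" "\<And>x. \<bar>f x\<bar> \<le> g x"
  shows "integrable lborel f"
  by (rule Bochner_Integration.integrable_bound[OF assms(1)])
     (use assms(2) order_trans[OF assms(3) abs_ge_self] in auto)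

lemma integrable_indicator_cball:
  "integrable lborel (\<lambda>x::'a::euclidean_space. indicator (cball 0 R) x * C :: real)"
  by (intro integrable_mult_left integrable_real_indicator) (auto simp: emeasure_lborel_cball_finite[simplified])

lemma dominated_limit:
  fixes f :: "nat \<Rightarrow> 'a::euclidean_space \<Rightarrow> real"
  assumes f: "\<And>n. f n \<in> borel_measurable borel" and w: "integrable lborel w"
    and lim: "\<And>x. (\<lambda>n. f n x) \<longlonglongrightarrow> g x" and bound: "\<And>n x. \<bar>f n x\<bar> \<le> w x"
  shows "(\<lambda>n. LBINT x. f n x) \<longlonglongrightarrow> (LBINT x. g x)"
proof (rule integral_dominated_convergence[OF _ _ w])
  show "g \<in> borel_measurable lborel"
    using borel_measurable_LIMSEQ_real[of borel f g] lim f by simp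
qed (use f lim bound in auto)

lemma integrable_bounded_support:
  fixes h :: "'a::euclidean_space \<Rightarrow> real"
  assumes [measurable]: "h \<in> borel_measurable borel"
    and "\<And>x. x \<in> cball 0 R \<Longrightarrow> \<bar>h x\<bar> \<le> C" and "\<And>x. x \<notin> cball 0 R \<Longrightarrow> h x = 0"
  shows "integrable lborel h"
proof (rule integrable_dominated[OF _ assms(1)])
  show "integrable lborel (\<lambda>x. indicator (cball 0 R) x * C :: real)"
    by (rule integrable_indicator_cball)
  show "\<bar>h x\<bar> \<le> indicator (cball 0 R) x * C" for x
    using assms(2)[of x] assms(3)[of x] by (cases "x \<in> cball 0 R") auto
qed

lemma diff_lap_measurable [measurable]:
  fixes f :: "'a::euclidean_space \<Rightarrow> real"
  assumes [measurable]: "f \<in> borel_measurable borel"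
  shows "diff_lap t f \<in> borel_measurable borel"
  unfolding diff_lap_def[abs_def] by measurable

lemma diff_lap_eq_0:
  assumes "\<And>y. norm (y - x) \<le> \<bar>t\<bar> \<Longrightarrow> f y = 0"
  shows "diff_lap t f x = 0"
proof -
  have "f (x + t *\<^sub>R b) = 0" "f (x - t *\<^sub>R b) = 0" "f x = 0" if "b \<in> Basis" for b
    using that by (auto intro!: assms)
  then show ?thesis by (simp add: diff_lap_def)
qed

text \<open>Together with measurability, this is all that summation by parts asks of the two
  factors, one of which has bounded support.\<close>

definition loc_bounded :: "('a::euclidean_space \<Rightarrow> real) \<Rightarrow> bool" where
  "loc_bounded g \<longleftrightarrow> (\<forall>R. \<exists>C. \<forall>x\<in>cball 0 R. \<bar>g x\<bar> \<le> C)"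

lemma loc_boundedE:
  assumes "loc_bounded g"
  obtains C where "0 \<le> C" "\<And>x. norm x \<le> R \<Longrightarrow> \<bar>g x\<bar> \<le> C"
proof -
  obtain C where "\<forall>x\<in>cball 0 R. \<bar>g x\<bar> \<le> C"
    using assms by (auto simp: loc_bounded_def)
  then show thesis by (intro that[of "max 0 C"]) (auto simp: le_max_iff_disj)
qed

lemma loc_bounded_support:
  assumes "loc_bounded f" "\<And>x. R < norm x \<Longrightarrow> f x = 0"
  obtains C where "0 \<le> C" "\<And>x. \<bar>f x\<bar> \<le> C"
proof -
  obtain C where C: "0 \<le> C" "\<And>x. norm x \<le> R \<Longrightarrow> \<bar>f x\<bar> \<le> C"
    using loc_boundedE[OF assms(1), where R=R] by blast
  then have "\<bar>f x\<bar> \<le> C" for x using assms(2)[of x] by (cases "norm x \<le> R") auto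
  with C(1) show thesis by (rule that)
qed

lemma loc_bounded_mono: "loc_bounded f \<Longrightarrow> (\<And>x. \<bar>g x\<bar> \<le> \<bar>f x\<bar>) \<Longrightarrow> loc_bounded g"
  unfolding loc_bounded_def by (meson order_trans)

lemma loc_bounded_translate:
  assumes "loc_bounded h"
  shows "loc_bounded (\<lambda>x. h (x + c))"
  unfolding loc_bounded_def
proof
  fix r
  obtain C where "\<And>x. norm x \<le> r + norm c \<Longrightarrow> \<bar>h x\<bar> \<le> C"
    using loc_boundedE[where R="r + norm c", OF assms] by blast
  then show "\<exists>C. \<forall>x\<in>cball 0 r. \<bar>h (x + c)\<bar> \<le> C"
    by (intro exI[of _ C] ballI) (smt (verit) mem_cball_0 norm_triangle_ineq)
qed

lemma diff_lap_loc_bounded: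
  fixes f :: "'a::euclidean_space \<Rightarrow> real"
  assumes "loc_bounded f"
  shows "loc_bounded (diff_lap t f)"
  unfolding loc_bounded_def
proof
  fix r
  obtain M where M: "\<And>x. norm x \<le> r + \<bar>t\<bar> \<Longrightarrow> \<bar>f x\<bar> \<le> M"
    using loc_boundedE[OF assms, where R="r + \<bar>t\<bar>"] by blast
  have "\<bar>diff_lap t f x\<bar> \<le> (\<Sum>b\<in>(Basis::'a set). 4 * M) / t\<^sup>2" if x: "x \<in> cball 0 r" for x
  proof -
    have "\<bar>f (x + t *\<^sub>R b) + f (x - t *\<^sub>R b) - 2 * f x\<bar> \<le> 4 * M" if b: "b \<in> Basis" for b
    proof -
      have "norm (x + t *\<^sub>R b) \<le> r + \<bar>t\<bar>" "norm (x - t *\<^sub>R b) \<le> r + \<bar>t\<bar>" "norm x \<le> r + \<bar>t\<bar>"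
        using x b norm_triangle_ineq[of x "t *\<^sub>R b"] norm_triangle_ineq4[of x "t *\<^sub>R b"] by auto
      from this[THEN M] show ?thesis by linarith
    qed
    then show ?thesis
      unfolding diff_lap_def abs_divide
      by (auto intro!: divide_right_mono order_trans[OF sum_abs] sum_mono simp del: sum_constant)
  qed
  then show "\<exists>C. \<forall>x\<in>cball 0 r. \<bar>diff_lap t f x\<bar> \<le> C" by blast
qed

lemma continuous_loc_bounded: "continuous_on UNIV g \<Longrightarrow> loc_bounded g"
  unfolding loc_bounded_def using continuous_bounded_cball by metis

lemma integrable_loc_bounded:
  fixes g \<phi> :: "'a::euclidean_space \<Rightarrow> real"
  assumes [measurable]: "g \<in> borel_measurable borel" "\<phi> \<in> borel_measurable borel"
    and "loc_bounded g" "loc_bounded \<phi>" "\<And>x. R < norm x \<Longrightarrow> \<phi> x = 0"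
  shows "integrable lborel (\<lambda>x. g x * \<phi> x)"
proof -
  obtain C where C: "0 \<le> C" "\<And>x. norm x \<le> R \<Longrightarrow> \<bar>g x\<bar> \<le> C" using loc_boundedE[where R=R, OF assms(3)] by blast
  obtain D where D: "0 \<le> D" "\<And>x. norm x \<le> R \<Longrightarrow> \<bar>\<phi> x\<bar> \<le> D" using loc_boundedE[where R=R, OF assms(4)] by blast
  show ?thesis
    by (rule integrable_bounded_support[where R=R and C="C * D"])
       (use C D assms(5) in \<open>auto simp: abs_mult intro!: mult_mono\<close>)
qed

text \<open>Translation invariance turns a shift of \<phi> into the opposite shift of g. The sum
  over both signs is unchanged by this, so the discrete Laplacian is symmetric.\<close>

lemma diff_lap_parts:
  fixes g \<phi> :: "'a::euclidean_space \<Rightarrow> real"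
  assumes [measurable]: "g \<in> borel_measurable borel" "\<phi> \<in> borel_measurable borel"
    and g: "loc_bounded g" and \<phi>: "loc_bounded \<phi>" and supp: "\<And>x. R < norm x \<Longrightarrow> \<phi> x = 0"
  shows "(LBINT x. g x * diff_lap t \<phi> x) = (LBINT x. diff_lap t g x * \<phi> x)"
proof -
  note sh = loc_bounded_translate
  have i1: "integrable lborel (\<lambda>x. g x * \<phi> (x + c))" for c
  proof (rule integrable_loc_bounded[where R="R + norm c", OF _ _ g sh[OF \<phi>]])
    show "\<phi> (x + c) = 0" if "R + norm c < norm x" for x
      using that norm_triangle_ineq4[of "x + c" c] by (intro supp) auto
  qed auto
  have i2: "integrable lborel (\<lambda>x. g (x + c) * \<phi> x)" for c
    by (rule integrable_loc_bounded[where R=R, OF _ _ sh[OF g] \<phi> supp]) auto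
  have eq: "(LBINT x. g x * \<phi> (x + c)) = (LBINT x. g (x + (- c)) * \<phi> x)" for c
    using integral_lborel_translate[of "\<lambda>x. g (x + (- c)) * \<phi> x" c] by simp
  note i1' = i1[of "- c" for c, simplified] and i10 = i1[of 0, simplified]
  note i2' = i2[of "- c" for c, simplified] and i20 = i2[of 0, simplified]
  note eq' = eq[of "- c" for c, simplified]
  have "(LBINT x. g x * diff_lap t \<phi> x) =
      (LBINT x. (\<Sum>b\<in>Basis. g x * \<phi> (x + t *\<^sub>R b) + g x * \<phi> (x - t *\<^sub>R b) - 2 * (g x * \<phi> x)) / t\<^sup>2)"
    by (simp add: diff_lap_def sum_distrib_left algebra_simps)
  also have "\<dots> = (\<Sum>b\<in>Basis. (LBINT x. g x * \<phi> (x + t *\<^sub>R b)) + (LBINT x. g x * \<phi> (x - t *\<^sub>R b))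
      - 2 * (LBINT x. g x * \<phi> x)) / t\<^sup>2"
    by (simp add: i1 i1' i10 Bochner_Integration.integral_sum)
  also have "\<dots> = (\<Sum>b\<in>Basis. (LBINT x. g (x - t *\<^sub>R b) * \<phi> x) + (LBINT x. g (x + t *\<^sub>R b) * \<phi> x)
      - 2 * (LBINT x. g x * \<phi> x)) / t\<^sup>2"
    by (simp add: eq eq')
  also have "\<dots> = (LBINT x. (\<Sum>b\<in>Basis. g (x - t *\<^sub>R b) * \<phi> x + g (x + t *\<^sub>R b) * \<phi> x - 2 * (g x * \<phi> x)) / t\<^sup>2)"
    by (simp add: i2 i2' i20 Bochner_Integration.integral_sum)
  also have "\<dots> = (LBINT x. diff_lap t g x * \<phi> x)"
    by (simp add: diff_lap_def sum_distrib_right sum_distrib_left algebra_simps)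
  finally show ?thesis .
qed

section \<open>From second differences to the Laplacian under the integral sign\<close>

lemma has_lapD:
  assumes "has_lap f L"
  shows "continuous_on UNIV f" "continuous_on UNIV L" "((\<lambda>t. diff_lap t f x) \<longlongrightarrow> L x) (at_right 0)"
    "f \<in> borel_measurable borel" "L \<in> borel_measurable borel" "loc_bounded f" "loc_bounded L"
  using assms by (auto simp: has_lap_def intro: borel_measurable_continuous_onI continuous_loc_bounded)

lemma has_lap_seq:
  assumes "has_lap f L"
  shows "(\<lambda>n. diff_lap (1 / real (Suc n)) f x) \<longlonglongrightarrow> L x"
proof (rule filterlim_compose[OF has_lapD(3)[OF assms]])
  show "filterlim (\<lambda>n. 1 / real (Suc n)) (at_right 0) sequentially"
    using LIMSEQ_inverse_real_of_nat
    by (auto simp: filterlim_at inverse_eq_divide)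
qed

lemma has_lap_loc_bounded:
  assumes "has_lap f L"
  obtains C where "0 \<le> C" "\<And>x n. norm x \<le> R \<Longrightarrow> \<bar>diff_lap (1 / real (Suc n)) f x\<bar> \<le> C"
proof -
  obtain C where "\<forall>x\<in>cball 0 R. \<forall>t. 0 < t \<and> t \<le> 1 \<longrightarrow> \<bar>diff_lap t f x\<bar> \<le> C"
    using assms unfolding has_lap_def by blast
  then show thesis by (intro that[of "max 0 C"]) (auto simp: le_max_iff_disj)
qed

lemma has_lap_bounded:
  assumes "has_lap f L" "\<And>x. R < norm x \<Longrightarrow> f x = 0"
  obtains C where "0 \<le> C" "\<And>x n. \<bar>diff_lap (1 / real (Suc n)) f x\<bar> \<le> C"
    "\<And>x n. R + 1 < norm x \<Longrightarrow> diff_lap (1 / real (Suc n)) f x = 0"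
proof -
  obtain C where C: "0 \<le> C" "\<And>x n. norm x \<le> R + 1 \<Longrightarrow> \<bar>diff_lap (1 / real (Suc n)) f x\<bar> \<le> C"
    using has_lap_loc_bounded[where R="R + 1", OF assms(1)] by blast
  \<comment> \<open>Steps of length at most 1 enlarge the support by at most 1.\<close>
  have z: "diff_lap (1 / real (Suc n)) f x = 0" if "R + 1 < norm x" for x n
  proof (rule diff_lap_eq_0)
    fix y assume y: "norm (y - x) \<le> \<bar>1 / real (Suc n)\<bar>"
    have "\<bar>1 / real (Suc n)\<bar> \<le> 1" by simp
    with y have "norm (y - x) \<le> 1" by linarith
    then have "R < norm y" using that norm_triangle_ineq3[of y x] by linarith
    then show "f y = 0" by (rule assms(2))
  qed
  show thesis
    by (rule that[of C]) (use C z in \<open>auto, metis abs_zero linorder_not_less\<close>)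
qed

text \<open>Locality: for small steps, the second difference at x reads only values of
  \<open>f\<close> inside \<open>U\<close>.\<close>

lemma has_lap_eq_0:
  assumes "has_lap f L" "open U" "x \<in> U" "\<And>y. y \<in> U \<Longrightarrow> f y = 0"
  shows "L x = 0"
proof (rule LIMSEQ_unique[OF has_lap_seq[OF assms(1)]])
  obtain e where e: "e > 0" "cball x e \<subseteq> U" using open_contains_cball assms by blast
  have "\<forall>\<^sub>F n in sequentially. 1 / real (Suc n) < e"
    using LIMSEQ_inverse_real_of_nat[THEN order_tendstoD(2), OF e(1)] by (simp add: inverse_eq_divide)
  then have "\<forall>\<^sub>F n in sequentially. diff_lap (1 / real (Suc n)) f x = 0"
  proof eventually_elim
    case (elim n)
    show ?case
      by (rule diff_lap_eq_0) (use elim e assms(4) in \<open>auto simp: subset_iff dist_norm norm_minus_commute\<close>)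
  qed
  then show "(\<lambda>n. diff_lap (1 / real (Suc n)) f x) \<longlonglongrightarrow> 0"
    by (rule tendsto_eventually)
qed

lemma integral_has_lap_limit:
  assumes [measurable]: "g \<in> borel_measurable borel" and g: "loc_bounded g"
    and \<phi>: "has_lap \<phi> L" and supp: "\<And>x. R < norm x \<Longrightarrow> \<phi> x = 0"
  shows "(\<lambda>n. LBINT x. g x * diff_lap (1 / real (Suc n)) \<phi> x) \<longlonglongrightarrow> (LBINT x. g x * L x)"
proof -
  note [measurable] = has_lapD(4,5)[OF \<phi>]
  obtain C where C: "0 \<le> C" "\<And>x n. \<bar>diff_lap (1 / real (Suc n)) \<phi> x\<bar> \<le> C"
    "\<And>x n. R + 1 < norm x \<Longrightarrow> diff_lap (1 / real (Suc n)) \<phi> x = 0"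
    using has_lap_bounded[OF \<phi> supp] by blast
  obtain D where D: "0 \<le> D" "\<And>x. norm x \<le> R + 1 \<Longrightarrow> \<bar>g x\<bar> \<le> D" using loc_boundedE[where R="R + 1", OF g] by blast
  show ?thesis
  proof (rule dominated_limit)
    show "integrable lborel (\<lambda>x. indicator (cball 0 (R + 1)) x * (D * C) :: real)"
      by (rule integrable_indicator_cball)
    show "(\<lambda>n. g x * diff_lap (1 / real (Suc n)) \<phi> x) \<longlonglongrightarrow> g x * L x" for x
      by (intro tendsto_mult tendsto_const has_lap_seq \<phi>)
    show "\<bar>g x * diff_lap (1 / real (Suc n)) \<phi> x\<bar> \<le> indicator (cball 0 (R + 1)) x * (D * C)" for n x
      using C D(1) D(2)[of x]
      by (cases "norm x \<le> R + 1") (auto simp: abs_mult simp del: of_nat_Suc intro!: mult_mono)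
  qed measurable
qed

text \<open>Pair with the constant 1, whose second differences all vanish, and sum by parts.\<close>

lemma integral_lap_eq_0:
  assumes "has_lap \<phi> L" "\<And>x. R < norm x \<Longrightarrow> \<phi> x = 0"
  shows "(LBINT x. L x) = 0"
proof -
  have "(\<lambda>n. LBINT x. 1 * diff_lap (1 / real (Suc n)) \<phi> x) \<longlonglongrightarrow> (LBINT x. 1 * L x)"
    by (rule integral_has_lap_limit[OF _ _ assms]) (auto simp: loc_bounded_def)
  moreover have "(LBINT x. 1 * diff_lap t \<phi> x) = 0" for t
    by (subst diff_lap_parts[where R=R])
       (use has_lapD[OF assms(1)] assms(2) in \<open>auto simp: loc_bounded_def diff_lap_def\<close>)
  ultimately have "(\<lambda>n::nat. 0) \<longlonglongrightarrow> (LBINT x. L x)" by simp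
  then show ?thesis by (simp add: LIMSEQ_const_iff)
qed

subsection \<open>Mollification in \<open>L\<^sup>1\<close>\<close>

text \<open>Stated with sequences because dominated convergence is sequential;
  \<open>L1_translation\<close> turns it into an epsilon-delta statement.\<close>

definition L1_continuous :: "('a::euclidean_space \<Rightarrow> real) \<Rightarrow> bool" where
  "L1_continuous f \<longleftrightarrow> (\<forall>h. h \<longlonglongrightarrow> 0 \<longrightarrow> (\<lambda>n. LBINT x. \<bar>f (x + h n) - f x\<bar>) \<longlonglongrightarrow> 0)"

text \<open>The usual three-term estimate: the error between f and g occurs twice, and its
  translated copy has the same integral.\<close>

lemma L1_continuous_approx:
  fixes f :: "'a::euclidean_space \<Rightarrow> real"
  assumes f: "integrable lborel f"
    and approx: "\<And>e. 0 < e \<Longrightarrow> \<exists>g. integrable lborel g \<and> (LBINT x. \<bar>g x - f x\<bar>) < e \<and> L1_continuous g"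
  shows "L1_continuous f"
  unfolding L1_continuous_def
proof (intro allI impI LIMSEQ_I)
  fix h :: "nat \<Rightarrow> 'a" and e :: real assume h: "h \<longlonglongrightarrow> 0" and e: "0 < e"
  obtain g where g: "integrable lborel g" "(LBINT x. \<bar>g x - f x\<bar>) < e / 3" "L1_continuous g"
    using approx[of "e / 3"] e by auto
  have "(\<lambda>n. LBINT x. \<bar>g (x + h n) - g x\<bar>) \<longlonglongrightarrow> 0" using g(3) h by (auto simp: L1_continuous_def)
  from order_tendstoD(2)[OF this, of "e / 3"] e
  obtain n0 where n0: "\<And>n. n \<ge> n0 \<Longrightarrow> (LBINT x. \<bar>g (x + h n) - g x\<bar>) < e / 3"
    by (auto simp: eventually_sequentially)
  note tr = integrable_lborel_translate[OF f] integrable_lborel_translate[OF g(1)]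
  have "(LBINT x. \<bar>f (x + h n) - f x\<bar>) < e" if "n \<ge> n0" for n
  proof -
    have "(LBINT x. \<bar>f (x + h n) - f x\<bar>) \<le>
      (LBINT x. \<bar>g (x + h n) - f (x + h n)\<bar> + (\<bar>g (x + h n) - g x\<bar> + \<bar>g x - f x\<bar>))"
      using f g(1) tr by (intro integral_mono) auto
    also have "\<dots> = (LBINT x. \<bar>g (x + h n) - f (x + h n)\<bar>) +
      ((LBINT x. \<bar>g (x + h n) - g x\<bar>) + (LBINT x. \<bar>g x - f x\<bar>))"
      using f g(1) tr by (subst Bochner_Integration.integral_add, simp_all)+
    also have "\<dots> < e / 3 + (e / 3 + e / 3)"
      using g(2) n0[OF that] borel_measurable_integrable[OF f] borel_measurable_integrable[OF g(1)]
      by (subst integral_lborel_translate[of "\<lambda>x. \<bar>g x - f x\<bar>"]) auto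
    finally show ?thesis by simp
  qed
  then show "\<exists>no. \<forall>n\<ge>no. norm ((LBINT x. \<bar>f (x + h n) - f x\<bar>) - 0) < e" by auto
qed

text \<open>Since \<open>T\<close> and its translates have the same measure, only the part of \<open>T\<close> outside the translate
  has to be estimated, and its indicator tends to \<open>0\<close> pointwise because \<open>T\<close> is open.\<close>

lemma L1_continuous_open:
  fixes T :: "'a::euclidean_space set"
  assumes T: "open T" "emeasure lborel T < \<infinity>"
  shows "L1_continuous (\<lambda>x. indicator T x *\<^sub>R c)"
  unfolding L1_continuous_def
proof (intro allI impI)
  fix h :: "nat \<Rightarrow> 'a" assume h: "h \<longlonglongrightarrow> 0"
  define I where "I = (indicator T :: 'a \<Rightarrow> real)"
  have [measurable]: "T \<in> sets borel" "I \<in> borel_measurable borel" using T by (auto simp: I_def)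
  have i: "integrable lborel I" using T unfolding I_def by (intro integrable_real_indicator) auto
  note i' = integrable_lborel_translate[OF i]
  have I01: "I x = 0 \<or> I x = 1" for x by (auto simp: I_def indicator_def)
  have "(\<lambda>n. LBINT x. max 0 (I x - I (x + h n))) \<longlonglongrightarrow> (LBINT x::'a. 0)"
  proof (rule dominated_limit[OF _ i])
    show "(\<lambda>n. max 0 (I x - I (x + h n))) \<longlonglongrightarrow> 0" for x
    proof (cases "x \<in> T")
      case True
      have "(\<lambda>n. x + h n) \<longlonglongrightarrow> x" by (auto intro!: tendsto_eq_intros h)
      then have "\<forall>\<^sub>F n in sequentially. x + h n \<in> T" using T True topological_tendstoD by blast
      then have "\<forall>\<^sub>F n in sequentially. max 0 (I x - I (x + h n)) = 0"
        by eventually_elim (use True in \<open>auto simp: I_def\<close>)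
      then show ?thesis by (rule tendsto_eventually)
    qed (auto simp: I_def indicator_def)
  qed (auto simp: I_def indicator_def)
  then have lim: "(\<lambda>n. 2 * \<bar>c\<bar> * (LBINT x. max 0 (I x - I (x + h n)))) \<longlonglongrightarrow> 0"
    using tendsto_mult_left[of _ 0 sequentially "2 * \<bar>c\<bar>"] by fastforce
  have "(LBINT x. \<bar>I (x + h n) *\<^sub>R c - I x *\<^sub>R c\<bar>) = 2 * \<bar>c\<bar> * (LBINT x. max 0 (I x - I (x + h n)))" for n
  proof -
    have "\<bar>I (x + h n) *\<^sub>R c - I x *\<^sub>R c\<bar> = \<bar>c\<bar> * (2 * max 0 (I x - I (x + h n)) + (I (x + h n) - I x))" for x
      using I01[of x] I01[of "x + h n"] by auto
    then have "(LBINT x. \<bar>I (x + h n) *\<^sub>R c - I x *\<^sub>R c\<bar>) =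
        \<bar>c\<bar> * (LBINT x. 2 * max 0 (I x - I (x + h n)) + (I (x + h n) - I x))" by simp
    also have "(LBINT x. 2 * max 0 (I x - I (x + h n)) + (I (x + h n) - I x)) =
        2 * (LBINT x. max 0 (I x - I (x + h n))) + ((LBINT x. I (x + h n)) - (LBINT x. I x))"
      using i i' by (subst Bochner_Integration.integral_add) (auto intro!: integrable_max)
    finally show ?thesis by (simp add: integral_lborel_translate[of I])
  qed
  then show "(\<lambda>n. LBINT x. \<bar>indicator T (x + h n) *\<^sub>R c - indicator T x *\<^sub>R c\<bar>) \<longlonglongrightarrow> 0"
    using lim unfolding I_def by (simp only:)
qed

text \<open>Induction over integrable functions. Outer regularity reduces an indicator of a Borel
  set to that of an open set, the triangle inequality handles sums, and limits are L1 approximations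
  by dominated convergence.\<close>

lemma L1_continuous_integrable:
  assumes "integrable lborel f"
  shows "L1_continuous f"
  using assms
proof (induction rule: integrable_induct)
  case (base A c)
  have A: "A \<in> sets borel" "integrable lborel (\<lambda>x. indicator A x *\<^sub>R c)"
    using base by (auto intro!: integrable_real_indicator integrable_mult_left)
  show ?case
  proof (rule L1_continuous_approx[OF A(2)])
    fix e :: real assume e: "0 < e"
    \<comment> \<open>The added 1 covers c = 0.\<close>
    define e' where "e' = e / (\<bar>c\<bar> + 1)"
    have e': "0 < e'" "e' * \<bar>c\<bar> < e" using e by (auto simp: e'_def field_simps)
    obtain T where T: "open T" "A \<subseteq> T" "emeasure lborel (T - A) < ennreal e'"
      using outer_regular_lborel[OF A(1) e'(1)] by auto
    have [measurable]: "T \<in> sets borel" "A \<in> sets borel" using T A by auto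
    have "emeasure lborel T = emeasure lborel A + emeasure lborel (T - A)"
      using T by (subst plus_emeasure) (auto simp: Un_absorb1)
    then have Tf: "emeasure lborel T < \<infinity>"
      using base(2) T(3) by (simp add: ennreal_add_less_top order_less_trans[OF T(3)])
    have "(LBINT x. \<bar>indicator T x *\<^sub>R c - indicator A x *\<^sub>R c\<bar>) = (LBINT x. indicator (T - A) x * \<bar>c\<bar>)"
      by (rule Bochner_Integration.integral_cong) (use T(2) in \<open>auto simp: indicator_def\<close>)
    also have "\<dots> = measure lborel (T - A) * \<bar>c\<bar>" by simp
    also have "\<dots> \<le> e' * \<bar>c\<bar>"
      using T(3) e' by (intro mult_right_mono) (auto simp: measure_def enn2real_leI less_imp_le)
    also note e'(2)
    finally show "\<exists>g. integrable lborel g \<and> (LBINT x. \<bar>g x - indicator A x *\<^sub>R c\<bar>) < e \<and> L1_continuous g"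
      using Tf L1_continuous_open[OF T(1) Tf, of c]
      by (intro exI[of _ "\<lambda>x. indicator T x *\<^sub>R c"]) (auto intro!: integrable_real_indicator integrable_mult_left)
  qed
next
  case (add f g)
  show ?case
    unfolding L1_continuous_def
  proof (intro allI impI)
    fix h :: "nat \<Rightarrow> 'a" assume h: "h \<longlonglongrightarrow> 0"
    note tr = integrable_lborel_translate[OF add(1)] integrable_lborel_translate[OF add(2)]
    have lim: "(\<lambda>n. (LBINT x. \<bar>f (x + h n) - f x\<bar>) + (LBINT x. \<bar>g (x + h n) - g x\<bar>)) \<longlonglongrightarrow> 0 + 0"
      using add h by (intro tendsto_add) (auto simp: L1_continuous_def)
    have le: "(LBINT x. \<bar>f (x + h n) + g (x + h n) - (f x + g x)\<bar>)
        \<le> (LBINT x. \<bar>f (x + h n) - f x\<bar>) + (LBINT x. \<bar>g (x + h n) - g x\<bar>)" for n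
    proof -
      have "(LBINT x. \<bar>f (x + h n) + g (x + h n) - (f x + g x)\<bar>)
          \<le> (LBINT x. \<bar>f (x + h n) - f x\<bar> + \<bar>g (x + h n) - g x\<bar>)"
        using add(1,2) tr by (intro integral_mono) auto
      also have "\<dots> = (LBINT x. \<bar>f (x + h n) - f x\<bar>) + (LBINT x. \<bar>g (x + h n) - g x\<bar>)"
        using add(1,2) tr by (intro Bochner_Integration.integral_add) auto
      finally show ?thesis .
    qed
    show "(\<lambda>n. LBINT x. \<bar>f (x + h n) + g (x + h n) - (f x + g x)\<bar>) \<longlonglongrightarrow> 0"
    proof (rule Lim_null_comparison)
      show "(\<lambda>n. (LBINT x. \<bar>f (x + h n) - f x\<bar>) + (LBINT x. \<bar>g (x + h n) - g x\<bar>)) \<longlonglongrightarrow> 0"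
        using lim by simp
    qed (use le in simp)
  qed
next
  case (lim f s)
  have f: "integrable lborel f" using lim by simp
  have s0: "(\<lambda>i. LBINT x. \<bar>s i x - f x\<bar>) \<longlonglongrightarrow> (LBINT x::'a. 0)"
  proof (rule dominated_limit)
    show "(\<lambda>i. \<bar>s i x - f x\<bar>) \<longlonglongrightarrow> 0" for x
      using lim(2) by (intro tendsto_rabs_zero LIM_zero) auto
    show "\<bar>\<bar>s i x - f x\<bar>\<bar> \<le> 3 * \<bar>f x\<bar>" for i x
    proof -
      have "\<bar>s i x\<bar> \<le> 2 * \<bar>f x\<bar>" using lim(3) by simp
      then show ?thesis by simp
    qed
    show "(\<lambda>x. \<bar>s i x - f x\<bar>) \<in> borel_measurable borel" for i
      using borel_measurable_integrable[OF f] borel_measurable_integrable[OF lim(1)] by simp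
  qed (use f in simp_all)
  show ?case
  proof (rule L1_continuous_approx[OF f])
    fix e :: real assume "0 < e"
    then obtain i where "(LBINT x. \<bar>s i x - f x\<bar>) < e"
      using order_tendstoD(2)[OF s0, of e] by (auto simp: eventually_sequentially)
    then show "\<exists>g. integrable lborel g \<and> (LBINT x. \<bar>g x - f x\<bar>) < e \<and> L1_continuous g"
      using lim(1) lim.IH by blast
  qed
qed

lemma L1_translation:
  fixes f :: "'a::euclidean_space \<Rightarrow> real"
  assumes "integrable lborel f" "0 < e"
  obtains d where "0 < d" "\<And>z. norm z < d \<Longrightarrow> (LBINT x. \<bar>f (x + z) - f x\<bar>) < e"
proof -
  have "continuous (at 0) (\<lambda>z. LBINT x. \<bar>f (x + z) - f x\<bar>)"
    unfolding continuous_at_sequentially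
    using L1_continuous_integrable[OF assms(1)] by (auto simp: comp_def L1_continuous_def)
  with assms(2) show thesis
    using that by (auto simp: continuous_at_eps_delta dist_norm)
qed

text \<open>With the argument y - x, the value at x is the pairing of f with the kernel moved to x.
  The distributional equation can thus be inserted directly, without reflecting the kernel.\<close>

definition moll :: "('a::euclidean_space \<Rightarrow> real) \<Rightarrow> ('a \<Rightarrow> real) \<Rightarrow> 'a \<Rightarrow> real" where
  "moll f k x = (LBINT y. f y * k (y - x))"

lemma moll_measurable [measurable]:
  assumes [measurable]: "f \<in> borel_measurable borel" "k \<in> borel_measurable borel"
  shows "moll f k \<in> borel_measurable borel"
  unfolding moll_def[abs_def] by measurable

lemma moll_eq:
  assumes [measurable]: "f \<in> borel_measurable borel" "k \<in> borel_measurable borel"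
  shows "moll f k x = (LBINT z. f (x + z) * k z)"
  using integral_lborel_translate[of "\<lambda>y. f y * k (y - x)" x] by (simp add: moll_def add.commute)

lemma integrable_mult_bounded:
  fixes f g :: "'a::euclidean_space \<Rightarrow> real"
  assumes "integrable lborel f" "g \<in> borel_measurable borel" "\<And>x. \<bar>g x\<bar> \<le> C"
  shows "integrable lborel (\<lambda>x. f x * g x)"
proof (rule integrable_dominated)
  show "integrable lborel (\<lambda>x. \<bar>f x\<bar> * C)" using assms(1) by auto
  show "\<bar>f x * g x\<bar> \<le> \<bar>f x\<bar> * C" for x using assms(3) by (simp add: abs_mult mult_left_mono)
qed (use assms in auto)

lemma integrable_moll_integrand:
  fixes f k :: "'a::euclidean_space \<Rightarrow> real"
  assumes f: "integrable lborel f" and [measurable]: "k \<in> borel_measurable borel"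
    and k: "\<And>x. \<bar>k x\<bar> \<le> C"
  shows "integrable lborel (\<lambda>y. f y * k (y - x))"
  by (rule integrable_mult_bounded[OF f _ k]) measurable

lemma moll_bound:
  fixes f k :: "'a::euclidean_space \<Rightarrow> real"
  assumes f: "integrable lborel f" and [measurable]: "k \<in> borel_measurable borel"
    and k: "\<And>x. \<bar>k x\<bar> \<le> C"
  shows "\<bar>moll f k x\<bar> \<le> C * (LBINT y. \<bar>f y\<bar>)"
proof -
  have "\<bar>moll f k x\<bar> \<le> (LBINT y. \<bar>f y * k (y - x)\<bar>)"
    unfolding moll_def by (rule integral_abs_bound)
  also have "\<dots> \<le> (LBINT y. C * \<bar>f y\<bar>)"
    using f integrable_moll_integrand[where k=k and x=x, OF f _ k, THEN integrable_abs] k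
    by (intro integral_mono) (auto simp: abs_mult mult.commute[of C] intro!: mult_left_mono)
  finally show ?thesis by simp
qed

text \<open>As k has mass 1, the error at x is an average over |z| \<le> e of the increments f (x +
  z) - f x. Tonelli then bounds its L1 norm by the largest L1 increment. The estimate is made for
  nonnegative integrals first and yields integrability on the way.\<close>

lemma moll_L1:
  fixes f k :: "'a::euclidean_space \<Rightarrow> real"
  assumes f: "integrable lborel f" and k: "continuous_on UNIV k" "\<And>x. 0 \<le> k x"
    "\<And>x. e < norm x \<Longrightarrow> k x = 0" "(LBINT x. k x) = 1"
    and \<eta>: "0 \<le> \<eta>" "\<And>z. norm z \<le> e \<Longrightarrow> (LBINT x. \<bar>f (x + z) - f x\<bar>) \<le> \<eta>"
  shows "integrable lborel (moll f k)" "(LBINT x. \<bar>moll f k x - f x\<bar>) \<le> \<eta>"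
proof -
  have [measurable]: "f \<in> borel_measurable borel" "k \<in> borel_measurable borel"
    using f k by (auto intro: borel_measurable_continuous_onI)
  obtain C where C0: "0 \<le> C" "\<And>x. norm x \<le> e \<Longrightarrow> \<bar>k x\<bar> \<le> C"
    using continuous_bounded_cball[OF k(1), of e] by auto
  have C: "\<bar>k x\<bar> \<le> C" for x using C0 k(3)[of x] by (cases "norm x \<le> e") auto
  \<comment> \<open>The integral of a function that is not integrable is 0 by convention, which mass
    1 excludes.\<close>
  have ki: "integrable lborel k"
    using k(4) by (rule_tac ccontr) (simp add: not_integrable_integral_eq)
  have d: "ennreal \<bar>moll f k x - f x\<bar> \<le> (\<integral>\<^sup>+z. ennreal (\<bar>f (x + z) - f x\<bar> * k z) \<partial>lborel)" for x
  proof -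
    have i: "integrable lborel (\<lambda>z. f (x + z) * k z)"
      using integrable_lborel_translate[OF integrable_moll_integrand[where k=k and x=x, OF f _ C], of x]
      by (simp add: add.commute)
    have "moll f k x - f x = (LBINT z. (f (x + z) - f x) * k z)"
      unfolding moll_eq[OF \<open>f \<in> _\<close> \<open>k \<in> _\<close>] using i ki k(4)
      by (simp add: algebra_simps)
    moreover have "integrable lborel (\<lambda>z. (f (x + z) - f x) * k z)"
      using i ki by (simp add: left_diff_distrib)
    ultimately show ?thesis
      using integral_norm_bound_ennreal[of lborel "\<lambda>z. (f (x + z) - f x) * k z"] k(2)
      by (simp add: abs_mult)
  qed
  have bd: "(\<integral>\<^sup>+x. ennreal \<bar>moll f k x - f x\<bar> \<partial>lborel) \<le> ennreal \<eta>"
  proof -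
    have "(\<integral>\<^sup>+x. ennreal \<bar>moll f k x - f x\<bar> \<partial>lborel) \<le>
        (\<integral>\<^sup>+x. (\<integral>\<^sup>+z. ennreal (\<bar>f (x + z) - f x\<bar> * k z) \<partial>lborel) \<partial>lborel)"
      by (intro nn_integral_mono d)
    also have "\<dots> = (\<integral>\<^sup>+z. (\<integral>\<^sup>+x. ennreal (\<bar>f (x + z) - f x\<bar> * k z) \<partial>lborel) \<partial>lborel)"
      by (rule lborel_pair.Fubini') measurable
    also have "\<dots> \<le> (\<integral>\<^sup>+z. ennreal (\<eta> * k z) \<partial>lborel)"
    proof (rule nn_integral_mono)
      fix z
      have "(\<integral>\<^sup>+x. ennreal (\<bar>f (x + z) - f x\<bar> * k z) \<partial>lborel) = (\<integral>\<^sup>+x. ennreal \<bar>f (x + z) - f x\<bar> \<partial>lborel) * ennreal (k z)"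
        using k(2) by (simp add: ennreal_mult nn_integral_multc)
      also have "(\<integral>\<^sup>+x. ennreal \<bar>f (x + z) - f x\<bar> \<partial>lborel) = ennreal (LBINT x. \<bar>f (x + z) - f x\<bar>)"
        using f integrable_lborel_translate[OF f, of z] by (intro nn_integral_eq_integral) auto
      also have "\<dots> * ennreal (k z) \<le> ennreal \<eta> * ennreal (k z)"
        using \<eta>(2)[of z] k(3)[of z] by (cases "norm z \<le> e") (auto intro!: mult_right_mono ennreal_leI)
      finally show "(\<integral>\<^sup>+x. ennreal (\<bar>f (x + z) - f x\<bar> * k z) \<partial>lborel) \<le> ennreal (\<eta> * k z)"
        using k(2) \<eta>(1) by (simp add: ennreal_mult)
    qed
    also have "\<dots> = ennreal (LBINT z. \<eta> * k z)"
      using k(2) ki \<eta>(1) by (intro nn_integral_eq_integral) auto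
    finally show ?thesis using k(4) by simp
  qed
  have di: "integrable lborel (\<lambda>x. moll f k x - f x)"
    by (rule integrableI_bounded) (use bd in \<open>auto intro: le_less_trans\<close>)
  then show "integrable lborel (moll f k)"
    using Bochner_Integration.integrable_add[OF di f] by simp
  have "ennreal (LBINT x. \<bar>moll f k x - f x\<bar>) \<le> ennreal \<eta>"
    using bd di by (subst nn_integral_eq_integral[symmetric]) auto
  then show "(LBINT x. \<bar>moll f k x - f x\<bar>) \<le> \<eta>"
    using \<eta>(1) by (simp add: ennreal_le_iff)
qed

text \<open>The kernels are only required to be continuous: the notion has to cover both the smooth
  bumps used in Kato's inequality and the kernels \<open>cone_kernel\<close> of the mean value
  inequality.\<close>

definition mollifier :: "(nat \<Rightarrow> 'a::euclidean_space \<Rightarrow> real) \<Rightarrow> (nat \<Rightarrow> real) \<Rightarrow> bool" where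
  "mollifier k e \<longleftrightarrow> e \<longlonglongrightarrow> 0 \<and> (\<forall>n. continuous_on UNIV (k n) \<and> (\<forall>x. 0 \<le> k n x) \<and>
     (\<forall>x. e n < norm x \<longrightarrow> k n x = 0) \<and> (LBINT x. k n x) = 1)"

lemma mollifierD:
  assumes "mollifier k e"
  shows "e \<longlonglongrightarrow> 0" "continuous_on UNIV (k n)" "0 \<le> k n x" "e n < norm x \<Longrightarrow> k n x = 0"
    "(LBINT x. k n x) = 1"
  using assms by (auto simp: mollifier_def)

lemma mollifier_L1:
  assumes k: "mollifier k e" and f: "integrable lborel f"
  shows "integrable lborel (moll f (k n))" "(\<lambda>n. LBINT x. \<bar>moll f (k n) x - f x\<bar>) \<longlonglongrightarrow> 0"
proof -
  \<comment> \<open>This crude bound holds for every shift and is used only to see that the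
    mollification is integrable.\<close>
  have "(LBINT x. \<bar>f (x + z) - f x\<bar>) \<le> 2 * (LBINT x. \<bar>f x\<bar>)" for z
  proof -
    have "(LBINT x. \<bar>f (x + z) - f x\<bar>) \<le> (LBINT x. \<bar>f (x + z)\<bar> + \<bar>f x\<bar>)"
      using f integrable_lborel_translate[OF f, of z] by (intro integral_mono) auto
    also have "\<dots> = (LBINT x. \<bar>f (x + z)\<bar>) + (LBINT x. \<bar>f x\<bar>)"
      using f integrable_lborel_translate[OF f, of z] by simp
    finally show ?thesis
      using integral_lborel_translate[of "\<lambda>x. \<bar>f x\<bar>" z] borel_measurable_integrable[OF f] by simp
  qed
  then show "integrable lborel (moll f (k n))"
    by (intro moll_L1(1)[OF f, of "k n" "e n" "2 * (LBINT x. \<bar>f x\<bar>)"] mollifierD[OF k]) auto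
  show "(\<lambda>n. LBINT x. \<bar>moll f (k n) x - f x\<bar>) \<longlonglongrightarrow> 0"
  proof (rule LIMSEQ_I)
    fix r :: real assume r: "0 < r"
    obtain d where d: "0 < d" "\<And>z. norm z < d \<Longrightarrow> (LBINT x. \<bar>f (x + z) - f x\<bar>) < r / 2"
      using L1_translation[OF f, of "r / 2"] r by auto
    obtain n0 where n0: "\<And>n. n \<ge> n0 \<Longrightarrow> e n < d"
      using order_tendstoD(2)[OF mollifierD(1)[OF k] d(1)] by (auto simp: eventually_sequentially)
    have "(LBINT x. \<bar>moll f (k n) x - f x\<bar>) \<le> r / 2" if "n \<ge> n0" for n
      by (rule moll_L1(2)[OF f, of "k n" "e n"])
         (use mollifierD[OF k] r d(2) n0[OF that] in \<open>auto intro!: less_imp_le\<close>)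
    then show "\<exists>no. \<forall>n\<ge>no. norm ((LBINT x. \<bar>moll f (k n) x - f x\<bar>) - 0) < r"
      using r by (intro exI[of _ n0]) fastforce
  qed
qed

lemma mollifier_AE_subseq:
  assumes k: "mollifier k e" and f: "integrable lborel f"
  obtains r :: "nat \<Rightarrow> nat" where "strict_mono r"
    "AE x in lborel. (\<lambda>n. moll f (k (r n)) x) \<longlonglongrightarrow> f x"
proof -
  have "\<exists>r::nat\<Rightarrow>nat. strict_mono r \<and> (AE x in lborel. (\<lambda>n. moll f (k (r n)) x - f x) \<longlonglongrightarrow> 0)"
    using mollifier_L1[OF k f] f by (intro tendsto_L1_AE_subseq) auto
  then show thesis using that by (auto simp: LIM_zero_iff)
qed

subsection \<open>Kato's inequality\<close>

definition kato_slope :: "real \<Rightarrow> real \<Rightarrow> real" where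
  "kato_slope \<delta> s = max 0 (min 1 (s / \<delta>))"

text \<open>The primitive of the slope that vanishes at 0: it is 0 for s \<le> 0, s^2 / (2 \<delta>)
  up to \<delta>, and s - \<delta> / 2 beyond. It is a convex C1 approximation of the positive part.
  Writing it through the slope spares case distinctions later.\<close>

definition kato_fun :: "real \<Rightarrow> real \<Rightarrow> real" where
  "kato_fun \<delta> s = kato_slope \<delta> s * s - \<delta> * (kato_slope \<delta> s)\<^sup>2 / 2"

lemma kato_slope_bounds: "0 \<le> kato_slope \<delta> s" "kato_slope \<delta> s \<le> 1"
  by (auto simp: kato_slope_def)

lemma kato_slope_continuous: "continuous_on UNIV (kato_slope \<delta>)"
  unfolding kato_slope_def[abs_def] divide_inverse by (intro continuous_intros)

lemma kato_fun_continuous: "continuous_on UNIV (kato_fun \<delta>)"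
  unfolding kato_fun_def[abs_def] by (intro continuous_intros kato_slope_continuous) auto

lemma kato_measurable [measurable]:
  "kato_slope \<delta> \<in> borel_measurable borel" "kato_fun \<delta> \<in> borel_measurable borel"
  by (auto intro: borel_measurable_continuous_onI kato_slope_continuous kato_fun_continuous)

text \<open>The function is the Legendre transform of \<open>\<delta> m\<^sup>2 / 2\<close> on \<open>[0, 1]\<close>, with maximiser the slope.\<close>

lemma kato_fun_ge:
  assumes "0 < \<delta>" "0 \<le> m" "m \<le> 1"
  shows "m * s - \<delta> * m\<^sup>2 / 2 \<le> kato_fun \<delta> s"
proof -
  consider "s \<le> 0" | "0 < s" "s < \<delta>" | "\<delta> \<le> s" by linarith
  then show ?thesis
  proof cases
    case 1
    then have "kato_slope \<delta> s = 0"
      using assms divide_nonpos_pos[of s \<delta>] by (auto simp: kato_slope_def)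
    moreover have "m * s \<le> 0" "0 \<le> \<delta> * m\<^sup>2" using 1 assms by (simp_all add: mult_nonneg_nonpos)
    ultimately show ?thesis by (simp add: kato_fun_def)
  next
    case 2
    then have eq: "kato_slope \<delta> s = s / \<delta>" using assms by (simp add: kato_slope_def max_def min_def)
    have "kato_fun \<delta> s = s\<^sup>2 / \<delta> / 2" unfolding kato_fun_def eq using assms by (simp add: power2_eq_square field_simps)
    moreover have "s\<^sup>2 / \<delta> / 2 - (m * s - \<delta> * m\<^sup>2 / 2) = (s - \<delta> * m)\<^sup>2 / (2 * \<delta>)"
      using assms by (simp add: power2_eq_square field_simps)
    ultimately show ?thesis using assms
      by (smt (verit) divide_nonneg_pos zero_le_power2)
  next
    case 3
    then have "kato_slope \<delta> s = 1" using assms by (simp add: kato_slope_def max_def min_def)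
    then have "kato_fun \<delta> s - (m * s - \<delta> * m\<^sup>2 / 2) = (1 - m) * (s - \<delta>) + \<delta> * (1 - m)\<^sup>2 / 2"
      by (simp add: kato_fun_def power2_eq_square field_simps)
    moreover have "0 \<le> (1 - m) * (s - \<delta>) + \<delta> * (1 - m)\<^sup>2 / 2" using assms 3 by auto
    ultimately show ?thesis by linarith
  qed
qed

text \<open>The slope at a is an admissible competitor in the maximum at b, and it attains the
  maximum at a.\<close>

lemma kato_fun_convex:
  "0 < \<delta> \<Longrightarrow> kato_fun \<delta> a + kato_slope \<delta> a * (b - a) \<le> kato_fun \<delta> b"
  using kato_fun_ge[of \<delta> "kato_slope \<delta> a" b] kato_slope_bounds[of \<delta> a]
  by (simp add: kato_fun_def algebra_simps)

lemma kato_fun_Lipschitz: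
  assumes "0 < \<delta>"
  shows "\<bar>kato_fun \<delta> a - kato_fun \<delta> b\<bar> \<le> \<bar>a - b\<bar>"
proof -
  have "\<bar>kato_slope \<delta> a * (b - a)\<bar> \<le> \<bar>a - b\<bar>" "\<bar>kato_slope \<delta> b * (a - b)\<bar> \<le> \<bar>a - b\<bar>"
    using kato_slope_bounds by (auto simp: abs_mult abs_minus_commute mult_left_le_one_le)
  then show ?thesis
    using kato_fun_convex[OF assms, of a b] kato_fun_convex[OF assms, of b a] by linarith
qed

lemma kato_fun_0: "kato_fun \<delta> 0 = 0"
  by (simp add: kato_fun_def kato_slope_def)

lemma kato_fun_abs_le: "0 < \<delta> \<Longrightarrow> \<bar>kato_fun \<delta> a\<bar> \<le> \<bar>a\<bar>"
  using kato_fun_Lipschitz[of \<delta> a 0] by (simp add: kato_fun_0)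

text \<open>All slopes vanish at s = 0, so the limit is the indicator of a strict inequality. This
  is the source of the condition \<open>u x < w x\<close> in Kato's inequality.\<close>

lemma kato_slope_limit: "(\<lambda>n. kato_slope (1 / real (Suc n)) s) \<longlonglongrightarrow> (if 0 < s then 1 else 0)"
proof (cases "0 < s")
  case True
  have "\<forall>\<^sub>F n in sequentially. 1 / real (Suc n) < s"
    using LIMSEQ_inverse_real_of_nat[THEN order_tendstoD(2), OF True] by (simp add: inverse_eq_divide)
  then have "\<forall>\<^sub>F n in sequentially. kato_slope (1 / real (Suc n)) s = 1"
    by eventually_elim (use True in \<open>auto simp: kato_slope_def min_def max_def field_simps\<close>)
  then show ?thesis using True by (auto intro: tendsto_eventually)
next
  case False
  then have "kato_slope (1 / real (Suc n)) s = 0" for n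
    using divide_nonpos_pos[of s "1 / real (Suc n)"] unfolding kato_slope_def by (simp del: of_nat_Suc)
  then show ?thesis using False by simp
qed

lemma kato_fun_limit: "(\<lambda>n. kato_fun (1 / real (Suc n)) s) \<longlonglongrightarrow> max 0 s"
proof -
  have "(\<lambda>n. kato_slope (1 / real (Suc n)) s * s - (1 / real (Suc n)) * (kato_slope (1 / real (Suc n)) s)\<^sup>2 / 2)
    \<longlonglongrightarrow> (if 0 < s then 1 else 0) * s - 0 * (if 0 < s then 1 else 0)\<^sup>2 / 2"
    using LIMSEQ_inverse_real_of_nat
    by (intro tendsto_intros kato_slope_limit) (simp_all add: inverse_eq_divide)
  then show ?thesis by (auto simp: kato_fun_def max_def split: if_splits)
qed

text \<open>Apply the supporting line at \<open>h x\<close> to both neighbours on each axis and add.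
  Convexity alone is used, hence h is arbitrary.\<close>

lemma diff_lap_kato:
  assumes "0 < \<delta>"
  shows "kato_slope \<delta> (h x) * diff_lap t h x \<le> diff_lap t (\<lambda>x. kato_fun \<delta> (h x)) x"
proof -
  have "kato_slope \<delta> (h x) * (h (x + t *\<^sub>R b) + h (x - t *\<^sub>R b) - 2 * h x) \<le>
      kato_fun \<delta> (h (x + t *\<^sub>R b)) + kato_fun \<delta> (h (x - t *\<^sub>R b)) - 2 * kato_fun \<delta> (h x)" for b
    using kato_fun_convex[OF assms, of "h x" "h (x + t *\<^sub>R b)"] kato_fun_convex[OF assms, of "h x" "h (x - t *\<^sub>R b)"]
    by (simp add: algebra_simps)
  then show ?thesis
    by (auto simp: diff_lap_def sum_distrib_left intro!: divide_right_mono sum_mono)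
qed

lemma diff_lap_diff: "diff_lap t (\<lambda>x. f x - g x) x = diff_lap t f x - diff_lap t g x"
  by (simp add: diff_lap_def sum_subtractf[symmetric] diff_divide_distrib[symmetric] algebra_simps sum.distrib sum_distrib_left)

text \<open>Shifting x shifts the kernel in the opposite direction, and the second difference is
  even in the step. The regularity of a mollification is thereby that of its kernel.\<close>

lemma diff_lap_moll:
  fixes f k :: "'a::euclidean_space \<Rightarrow> real"
  assumes f: "integrable lborel f" and [measurable]: "k \<in> borel_measurable borel"
    and k: "\<And>x. \<bar>k x\<bar> \<le> C"
  shows "diff_lap t (moll f k) x = moll f (diff_lap t k) x"
proof -
  note i = integrable_moll_integrand[where k=k, OF f _ k]
  have i1: "integrable lborel (\<lambda>y. f y * k (y - x - t *\<^sub>R b))" for b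
    using i[where x="x + t *\<^sub>R b" for b] by (simp add: algebra_simps)
  have i2: "integrable lborel (\<lambda>y. f y * k (y - x + t *\<^sub>R b))" for b
    using i[where x="x - t *\<^sub>R b" for b] by (simp add: algebra_simps)
  have "moll f (diff_lap t k) x = (LBINT y. (\<Sum>b\<in>Basis. f y * k (y - x + t *\<^sub>R b) + f y * k (y - x - t *\<^sub>R b)
      - 2 * (f y * k (y - x))) / t\<^sup>2)"
    by (simp add: moll_def diff_lap_def sum_distrib_left algebra_simps)
  also have "\<dots> = (\<Sum>b\<in>Basis. (LBINT y. f y * k (y - x + t *\<^sub>R b)) + (LBINT y. f y * k (y - x - t *\<^sub>R b))
      - 2 * (LBINT y. f y * k (y - x))) / t\<^sup>2"
    by (simp add: i1 i2 i Bochner_Integration.integral_sum)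
  also have "\<dots> = diff_lap t (moll f k) x"
    by (simp add: diff_lap_def moll_def algebra_simps)
  finally show ?thesis by simp
qed

text \<open>Discrete Kato for w minus the mollified u is multiplied by \<phi>, summed by parts, and
  only then the step size tends to 0, with \<delta> and the kernel fixed. In the application
  \<open>F\<close> is the mollified right-hand side, and \<open>eq\<close> is the equation tested
  with the translated kernel.\<close>

lemma kato_mollified:
  fixes u w F \<phi> k :: "'a::euclidean_space \<Rightarrow> real"
  assumes u: "integrable lborel u" and \<delta>: "0 < \<delta>"
    and \<phi>: "has_lap \<phi> L\<phi>" "\<And>x. 0 \<le> \<phi> x" "\<And>x. R < norm x \<Longrightarrow> \<phi> x = 0"
    and w: "has_lap w Lw" and k: "has_lap k Lk" "\<And>x. Rk < norm x \<Longrightarrow> k x = 0"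
    and [measurable]: "F \<in> borel_measurable borel"
    and eq: "\<And>x. \<phi> x \<noteq> 0 \<Longrightarrow> moll u Lk x = - F x"
  shows "(LBINT x. kato_slope \<delta> (w x - moll u k x) * ((Lw x + F x) * \<phi> x))
    \<le> (LBINT x. kato_fun \<delta> (w x - moll u k x) * L\<phi> x)"
proof -
  have [measurable]: "u \<in> borel_measurable borel" using u by auto
  note [measurable] = has_lapD(4,5)[OF \<phi>(1)] has_lapD(4,5)[OF w] has_lapD(4,5)[OF k(1)]
  define \<tau> where "\<tau> n = 1 / real (Suc n)" for n
  obtain C where C: "0 \<le> C" "\<And>x n. \<bar>diff_lap (\<tau> n) k x\<bar> \<le> C"
  proof (rule has_lap_bounded[OF k])
    fix C assume "0 \<le> C" "\<And>x n. \<bar>diff_lap (1 / real (Suc n)) k x\<bar> \<le> C"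
    then show thesis using that[of C] by (simp add: \<tau>_def)
  qed
  obtain B where B: "\<And>x. \<bar>k x\<bar> \<le> B" using loc_bounded_support[OF has_lapD(6)[OF k(1)] k(2)] by blast
  define I where "I = (LBINT y. \<bar>u y\<bar>)"
  define h where "h x = w x - moll u k x" for x
  have [measurable]: "h \<in> borel_measurable borel" unfolding h_def[abs_def] by measurable
  have hb: "loc_bounded h"
    unfolding loc_bounded_def
  proof
    fix r
    obtain D where D: "\<And>x. norm x \<le> r \<Longrightarrow> \<bar>w x\<bar> \<le> D"
      using loc_boundedE[OF has_lapD(6)[OF w], where R=r] by blast
    have "\<bar>h x\<bar> \<le> D + B * I" if "x \<in> cball 0 r" for x
      using D[of x] that moll_bound[where k=k and x=x, OF u _ B] unfolding h_def I_def by auto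
    then show "\<exists>C. \<forall>x\<in>cball 0 r. \<bar>h x\<bar> \<le> C" by blast
  qed
  have gb: "loc_bounded (\<lambda>x. kato_fun \<delta> (h x))"
    by (rule loc_bounded_mono[OF hb kato_fun_abs_le[OF \<delta>]])
  have dh: "diff_lap (\<tau> n) h x = diff_lap (\<tau> n) w x - moll u (diff_lap (\<tau> n) k) x" for n x
    unfolding h_def[abs_def] diff_lap_diff using diff_lap_moll[where k=k, OF u _ B] by simp
  have dhb: "\<bar>moll u (diff_lap (\<tau> n) k) x\<bar> \<le> C * I" for n x
    unfolding I_def by (rule moll_bound[OF u _ C(2)]) measurable
  obtain D where D: "0 \<le> D" "\<And>x n. norm x \<le> R \<Longrightarrow> \<bar>diff_lap (\<tau> n) w x\<bar> \<le> D"
    using has_lap_loc_bounded[OF w, where R=R] unfolding \<tau>_def by blast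
  obtain E where E: "0 \<le> E" "\<And>x. norm x \<le> R \<Longrightarrow> \<bar>\<phi> x\<bar> \<le> E"
    using loc_boundedE[OF has_lapD(6)[OF \<phi>(1)], where R=R] by blast
  have I: "0 \<le> I" unfolding I_def by simp
  define Q where "Q n x = kato_slope \<delta> (h x) * (diff_lap (\<tau> n) h x * \<phi> x)" for n x
  have [measurable]: "Q n \<in> borel_measurable borel" for n unfolding Q_def[abs_def] by measurable
  have dom: "\<bar>Q n x\<bar> \<le> indicator (cball 0 R) x * ((D + C * I) * E)" for n x
  proof (cases "norm x \<le> R")
    case True
    have "\<bar>diff_lap (\<tau> n) h x\<bar> \<le> D + C * I"
      unfolding dh using D(2)[OF True, of n] dhb[of n x] by linarith
    then have "\<bar>diff_lap (\<tau> n) h x * \<phi> x\<bar> \<le> (D + C * I) * E"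
      unfolding abs_mult using E(2)[OF True] by (intro mult_mono) auto
    then have "\<bar>kato_slope \<delta> (h x)\<bar> * \<bar>diff_lap (\<tau> n) h x * \<phi> x\<bar> \<le> 1 * ((D + C * I) * E)"
      using kato_slope_bounds[of \<delta> "h x"] by (intro mult_mono) auto
    then show ?thesis using True by (simp add: Q_def abs_mult)
  next
    case False
    then show ?thesis using \<phi>(3)[of x] by (simp add: Q_def)
  qed
  have ind: "integrable lborel (\<lambda>x. indicator (cball 0 R) x * ((D + C * I) * E) :: real)"
    by (rule integrable_indicator_cball)
  have le: "(LBINT x. Q n x)
      \<le> (LBINT x. kato_fun \<delta> (h x) * diff_lap (\<tau> n) \<phi> x)" for n
  proof -
    have "(LBINT x. Q n x) \<le>
        (LBINT x. diff_lap (\<tau> n) (\<lambda>x. kato_fun \<delta> (h x)) x * \<phi> x)"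
    proof (rule integral_mono)
      show "integrable lborel (Q n)"
        by (rule integrable_dominated[OF ind _ dom]) measurable
      show "integrable lborel (\<lambda>x. diff_lap (\<tau> n) (\<lambda>x. kato_fun \<delta> (h x)) x * \<phi> x)"
        by (rule integrable_loc_bounded[OF _ _ diff_lap_loc_bounded[OF gb] has_lapD(6)[OF \<phi>(1)] \<phi>(3)]) auto
      fix x
      show "Q n x \<le> diff_lap (\<tau> n) (\<lambda>x. kato_fun \<delta> (h x)) x * \<phi> x"
        using mult_right_mono[OF diff_lap_kato[OF \<delta>, of h x "\<tau> n"] \<phi>(2)[of x]] by (simp add: Q_def mult.assoc)
    qed
    also have "\<dots> = (LBINT x. kato_fun \<delta> (h x) * diff_lap (\<tau> n) \<phi> x)"
      by (rule diff_lap_parts[OF _ _ gb has_lapD(6)[OF \<phi>(1)] \<phi>(3), symmetric]) auto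
    finally show ?thesis .
  qed
  have "(\<lambda>n. LBINT x. Q n x) \<longlonglongrightarrow>
      (LBINT x. kato_slope \<delta> (h x) * ((Lw x + F x) * \<phi> x))"
  proof (rule dominated_limit[OF _ ind _ dom])
    show "(\<lambda>n. Q n x) \<longlonglongrightarrow> kato_slope \<delta> (h x) * ((Lw x + F x) * \<phi> x)" for x
    proof (cases "\<phi> x = 0")
      case False
      have "(\<lambda>n. moll u (diff_lap (\<tau> n) k) x) \<longlonglongrightarrow> moll u Lk x"
        unfolding moll_def
      proof (rule dominated_limit)
        show "(\<lambda>n. u y * diff_lap (\<tau> n) k (y - x)) \<longlonglongrightarrow> u y * Lk (y - x)" for y
          unfolding \<tau>_def by (intro tendsto_mult tendsto_const has_lap_seq k)
        show "\<bar>u y * diff_lap (\<tau> n) k (y - x)\<bar> \<le> \<bar>u y\<bar> * C" for n y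
          using C by (auto simp: abs_mult intro!: mult_left_mono)
      qed (use u in auto)
      then have "(\<lambda>n. diff_lap (\<tau> n) w x - moll u (diff_lap (\<tau> n) k) x) \<longlonglongrightarrow> Lw x - (- F x)"
        using eq[OF False] unfolding \<tau>_def by (intro tendsto_diff has_lap_seq w) auto
      then have "(\<lambda>n. diff_lap (\<tau> n) h x) \<longlonglongrightarrow> Lw x + F x" by (simp add: dh)
      then show ?thesis unfolding Q_def by (intro tendsto_mult tendsto_const)
    qed (simp add: Q_def)
  qed measurable
  moreover have "(\<lambda>n. LBINT x. kato_fun \<delta> (h x) * diff_lap (\<tau> n) \<phi> x) \<longlonglongrightarrow> (LBINT x. kato_fun \<delta> (h x) * L\<phi> x)"
    unfolding \<tau>_def by (rule integral_has_lap_limit[OF _ gb \<phi>(1,3)]) measurable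
  ultimately show ?thesis
    unfolding h_def[symmetric] by (rule LIMSEQ_le) (use le in blast)
qed

lemma L1_dominated_limit:
  fixes f a :: "nat \<Rightarrow> 'a::euclidean_space \<Rightarrow> real"
  assumes a: "(\<lambda>n. LBINT x. \<bar>a n x\<bar>) \<longlonglongrightarrow> 0" "\<And>n. integrable lborel (a n)"
    and f: "\<And>n. f n \<in> borel_measurable borel" "\<And>n x. \<bar>f n x\<bar> \<le> C * \<bar>a n x\<bar>"
  shows "(\<lambda>n. LBINT x. f n x) \<longlonglongrightarrow> 0"
proof (rule Lim_null_comparison)
  show "(\<lambda>n. C * (LBINT x. \<bar>a n x\<bar>)) \<longlonglongrightarrow> 0" using tendsto_mult_left[OF a(1), of C] by simp
  have i: "integrable lborel (\<lambda>x. C * \<bar>a n x\<bar>)" for n using a(2) by auto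
  have "integrable lborel (f n)" for n
    by (rule integrable_dominated[OF i f])
  then have "(LBINT x. \<bar>f n x\<bar>) \<le> (LBINT x. C * \<bar>a n x\<bar>)" for n
    using f(2) i by (intro integral_mono) auto
  then have "norm (LBINT x. f n x) \<le> C * (LBINT x. \<bar>a n x\<bar>)" for n
    unfolding real_norm_def by (intro order_trans[OF integral_abs_bound]) simp
  then show "\<forall>\<^sub>F n in sequentially. norm (LBINT x. f n x) \<le> C * (LBINT x. \<bar>a n x\<bar>)" by simp
qed

text \<open>If -\<Delta>u = F near the support of \<phi>, then the Laplacian of the positive part of
  w - u is at least \<Delta>w + F on {u < w} and at least 0 elsewhere, in the weak sense. The kernel
  shrinks before \<delta> does: while \<delta> is fixed the slope is continuous, so almost
  everywhere convergence of the mollifications, available along a subsequence, passes through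
  it.\<close>

lemma kato_inequality:
  fixes u w F \<phi> :: "'a::euclidean_space \<Rightarrow> real"
  assumes u: "integrable lborel u" and F: "integrable lborel F"
    and \<phi>: "has_lap \<phi> L\<phi>" "\<And>x. 0 \<le> \<phi> x" "\<And>x. R < norm x \<Longrightarrow> \<phi> x = 0"
    and w: "has_lap w Lw" and k: "mollifier k e" "\<And>n. has_lap (k n) (Lk n)"
    and eq: "\<And>x n. \<phi> x \<noteq> 0 \<Longrightarrow> moll u (Lk n) x = - moll F (k n) x"
  shows "(LBINT x. (if u x < w x then (Lw x + F x) * \<phi> x else 0))
    \<le> (LBINT x. max 0 (w x - u x) * L\<phi> x)"
proof -
  have [measurable]: "u \<in> borel_measurable borel" "F \<in> borel_measurable borel" using u F by auto
  note [measurable] = has_lapD(4,5)[OF \<phi>(1)] has_lapD(4,5)[OF w] has_lapD(4,5)[OF k(2)]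
  obtain r where r: "strict_mono r" "AE x in lborel. (\<lambda>n. moll u (k (r n)) x) \<longlonglongrightarrow> u x"
    using mollifier_AE_subseq[OF k(1) u] by blast
  have Lsupp: "L\<phi> x = 0" if "R < norm x" for x
    by (rule has_lap_eq_0[OF \<phi>(1), of "- cball 0 R"]) (use that \<phi>(3) in auto)
  obtain C where C: "0 \<le> C" "\<And>x. \<bar>L\<phi> x\<bar> \<le> C"
    using loc_bounded_support[OF has_lapD(7)[OF \<phi>(1)] Lsupp] by blast
  obtain E where E: "0 \<le> E" "\<And>x. \<bar>\<phi> x\<bar> \<le> E"
    using loc_bounded_support[OF has_lapD(6)[OF \<phi>(1)] \<phi>(3)] by blast
  define U where "U n = moll u (k (r n))" for n
  define H where "H n = moll F (k (r n))" for n
  have [measurable]: "U n \<in> borel_measurable borel" "H n \<in> borel_measurable borel" for n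
    unfolding U_def H_def by measurable
  have Ui: "integrable lborel (U n)" and Hi: "integrable lborel (H n)" for n
    unfolding U_def H_def using mollifier_L1(1)[OF k(1)] u F by auto
  have UL: "(\<lambda>n. LBINT x. \<bar>U n x - u x\<bar>) \<longlonglongrightarrow> 0" and HL: "(\<lambda>n. LBINT x. \<bar>H n x - F x\<bar>) \<longlonglongrightarrow> 0"
    using LIMSEQ_subseq_LIMSEQ[OF mollifier_L1(2)[OF k(1) u] r(1)] LIMSEQ_subseq_LIMSEQ[OF mollifier_L1(2)[OF k(1) F] r(1)]
    by (auto simp: U_def H_def comp_def)
  have wL: "integrable lborel (\<lambda>x. w x * L\<phi> x)"
    by (rule integrable_loc_bounded[OF _ _ has_lapD(6)[OF w] has_lapD(7)[OF \<phi>(1)] Lsupp]) auto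
  have Lw\<phi>: "integrable lborel (\<lambda>x. Lw x * \<phi> x)"
    by (rule integrable_loc_bounded[OF _ _ has_lapD(7)[OF w] has_lapD(6)[OF \<phi>(1)] \<phi>(3)]) auto
  define P where "P x = (Lw x + F x) * \<phi> x" for x
  have F\<phi>: "integrable lborel P"
    using Lw\<phi> integrable_mult_bounded[OF F, of \<phi> E] E by (simp add: P_def[abs_def] distrib_right)
  have gb: "\<bar>kato_fun \<delta> (w x - t) * L\<phi> x\<bar> \<le> \<bar>w x * L\<phi> x\<bar> + \<bar>t * L\<phi> x\<bar>" if "0 < \<delta>" for \<delta> x t
  proof -
    have "\<bar>kato_fun \<delta> (w x - t)\<bar> \<le> \<bar>w x\<bar> + \<bar>t\<bar>" using kato_fun_abs_le[OF that, of "w x - t"] by linarith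
    from mult_right_mono[OF this, of "\<bar>L\<phi> x\<bar>"] show ?thesis by (simp add: abs_mult distrib_right)
  qed
  have wv: "integrable lborel (\<lambda>x. \<bar>w x * L\<phi> x\<bar> + \<bar>v x * L\<phi> x\<bar>)" if "integrable lborel v" for v
    using wL integrable_mult_bounded[OF that, of L\<phi> C] C by auto
  have gi: "integrable lborel (\<lambda>x. kato_fun \<delta> (w x - v x) * L\<phi> x)"
    if \<delta>: "0 < \<delta>" and v: "integrable lborel v" for \<delta> v
    by (rule integrable_dominated[OF wv[OF v] _ gb[OF \<delta>]]) (use v in measurable)
  have sP: "\<bar>kato_slope \<delta> t * P x\<bar> \<le> \<bar>P x\<bar>" for \<delta> t x
    using kato_slope_bounds[of \<delta> t] by (simp add: abs_mult mult_left_le_one_le)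
  \<comment> \<open>The inequality for u itself, with \<delta> still fixed.\<close>
  have step: "(LBINT x. kato_slope \<delta> (w x - u x) * P x)
    \<le> (LBINT x. kato_fun \<delta> (w x - u x) * L\<phi> x)" if \<delta>: "0 < \<delta>" for \<delta>
  proof -
    have le: "(LBINT x. kato_slope \<delta> (w x - U n x) * ((Lw x + H n x) * \<phi> x))
      \<le> (LBINT x. kato_fun \<delta> (w x - U n x) * L\<phi> x)" for n
      unfolding U_def H_def
      by (rule kato_mollified[OF u \<delta> \<phi> w k(2) mollifierD(4)[OF k(1)]]) (auto simp: eq)
    have "(\<lambda>n. LBINT x. (kato_fun \<delta> (w x - U n x) - kato_fun \<delta> (w x - u x)) * L\<phi> x) \<longlonglongrightarrow> 0"
    proof (rule L1_dominated_limit[where C=C, OF UL])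
      fix n x
      have "\<bar>kato_fun \<delta> (w x - U n x) - kato_fun \<delta> (w x - u x)\<bar> \<le> \<bar>U n x - u x\<bar>"
        using kato_fun_Lipschitz[OF \<delta>, of "w x - U n x" "w x - u x"] by linarith
      then have "\<bar>kato_fun \<delta> (w x - U n x) - kato_fun \<delta> (w x - u x)\<bar> * \<bar>L\<phi> x\<bar> \<le> \<bar>U n x - u x\<bar> * C"
        using C by (intro mult_mono) auto
      then show "\<bar>(kato_fun \<delta> (w x - U n x) - kato_fun \<delta> (w x - u x)) * L\<phi> x\<bar> \<le> C * \<bar>U n x - u x\<bar>"
        by (simp only: abs_mult mult.commute[of C])
    qed (use Ui u in auto)
    then have right: "(\<lambda>n. LBINT x. kato_fun \<delta> (w x - U n x) * L\<phi> x) \<longlonglongrightarrow> (LBINT x. kato_fun \<delta> (w x - u x) * L\<phi> x)"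
      unfolding left_diff_distrib Bochner_Integration.integral_diff[OF gi[OF \<delta> Ui] gi[OF \<delta> u]]
      by (rule LIM_zero_cancel)
    have s1: "\<bar>kato_slope \<delta> s\<bar> \<le> 1" for s using kato_slope_bounds[of \<delta> s] by auto
    have "(\<lambda>n. LBINT x. kato_slope \<delta> (w x - U n x) * P x) \<longlonglongrightarrow>
        (LBINT x. kato_slope \<delta> (w x - u x) * P x)"
    proof (rule integral_dominated_convergence[where w="\<lambda>x. \<bar>P x\<bar>"])
      show "AE x in lborel. (\<lambda>n. kato_slope \<delta> (w x - U n x) * P x) \<longlonglongrightarrow>
          kato_slope \<delta> (w x - u x) * P x"
        using r(2)
      proof eventually_elim
        case (elim x)
        then have "(\<lambda>n. w x - U n x) \<longlonglongrightarrow> w x - u x" unfolding U_def by (intro tendsto_intros)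
        then show ?case
          by (intro tendsto_mult tendsto_const continuous_on_tendsto_compose[OF kato_slope_continuous]) auto
      qed
      show "AE x in lborel. norm (kato_slope \<delta> (w x - U n x) * P x) \<le> \<bar>P x\<bar>" for n
        using sP by simp
    qed (use F\<phi> in auto)
    \<comment> \<open>Replacing the mollified right-hand side by \<open>F\<close> costs at most a
      multiple of their L1 distance.\<close>
    moreover have "(\<lambda>n. LBINT x. kato_slope \<delta> (w x - U n x) * ((H n x - F x) * \<phi> x)) \<longlonglongrightarrow> 0"
    proof (rule L1_dominated_limit[where C=E, OF HL])
      fix n x
      have "\<bar>kato_slope \<delta> (w x - U n x)\<bar> * (\<bar>H n x - F x\<bar> * \<bar>\<phi> x\<bar>) \<le> 1 * (\<bar>H n x - F x\<bar> * E)"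
        using s1 E by (intro mult_mono) auto
      then show "\<bar>kato_slope \<delta> (w x - U n x) * ((H n x - F x) * \<phi> x)\<bar> \<le> E * \<bar>H n x - F x\<bar>"
        by (simp add: abs_mult mult.commute)
    qed (use Hi F in auto)
    ultimately have "(\<lambda>n. (LBINT x. kato_slope \<delta> (w x - U n x) * P x) +
        (LBINT x. kato_slope \<delta> (w x - U n x) * ((H n x - F x) * \<phi> x))) \<longlonglongrightarrow>
        (LBINT x. kato_slope \<delta> (w x - u x) * P x) + 0"
      by (rule tendsto_add)
    moreover have "(LBINT x. kato_slope \<delta> (w x - U n x) * P x) +
        (LBINT x. kato_slope \<delta> (w x - U n x) * ((H n x - F x) * \<phi> x)) =
        (LBINT x. kato_slope \<delta> (w x - U n x) * ((Lw x + H n x) * \<phi> x))" for n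
    proof -
      have "integrable lborel (\<lambda>x. P x * kato_slope \<delta> (w x - U n x))"
        by (rule integrable_mult_bounded[OF F\<phi> _ s1]) measurable
      moreover have "integrable lborel (\<lambda>x. ((H n x - F x) * \<phi> x) * kato_slope \<delta> (w x - U n x))"
        using Hi[of n] F E by (intro integrable_mult_bounded[OF _ _ s1] integrable_mult_bounded[where C=E]) auto
      ultimately show ?thesis
        by (subst Bochner_Integration.integral_add[symmetric]) (auto simp: P_def algebra_simps)
    qed
    ultimately show ?thesis
      using LIMSEQ_le[OF _ right] le by simp
  qed
  have "(\<lambda>n. LBINT x. kato_slope (1 / real (Suc n)) (w x - u x) * P x) \<longlonglongrightarrow>
      (LBINT x. (if 0 < w x - u x then 1 else 0) * P x)"
    by (rule dominated_limit[OF _ _ tendsto_mult[OF kato_slope_limit tendsto_const] sP])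
       (use F\<phi> in auto)
  moreover have "(\<lambda>n. LBINT x. kato_fun (1 / real (Suc n)) (w x - u x) * L\<phi> x) \<longlonglongrightarrow>
      (LBINT x. max 0 (w x - u x) * L\<phi> x)"
    by (rule dominated_limit[OF _ wv[OF u] tendsto_mult[OF kato_fun_limit tendsto_const] gb]) auto
  ultimately have "(LBINT x. (if 0 < w x - u x then 1 else 0) * P x) \<le>
      (LBINT x. max 0 (w x - u x) * L\<phi> x)"
    by (rule LIMSEQ_le) (use step in auto)
  then show ?thesis
    by (simp add: P_def if_distrib[of "\<lambda>c. c * _"] cong: if_cong)
qed

subsection \<open>Smooth bump functions\<close>

text \<open>Dividing by powers of s gives a family whose derivatives are linear combinations of its
  members, so smoothness follows from one derivative formula.\<close>

definition exp_bump :: "nat \<Rightarrow> real \<Rightarrow> real" where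
  "exp_bump m s = (if s \<le> 0 then 0 else exp (- 1 / s) / s ^ m)"

lemma exp_bump_tendsto_0: "(exp_bump m \<longlongrightarrow> 0) (at 0)"
proof -
  have "((\<lambda>s. inverse s ^ m / exp (inverse s :: real)) \<longlongrightarrow> 0) (at_right 0)"
    using filterlim_compose[OF tendsto_power_div_exp_0 filterlim_inverse_at_top_right] .
  moreover have "\<forall>\<^sub>F s in at_right 0. inverse s ^ m / exp (inverse s) = exp_bump m s"
    using eventually_at_right_less[of 0]
    by eventually_elim (simp add: exp_bump_def exp_minus field_simps)
  ultimately have "(exp_bump m \<longlongrightarrow> 0) (at_right 0)"
    by (rule Lim_transform_eventually)
  moreover have "(exp_bump m \<longlongrightarrow> 0) (at_left 0)"
  proof (rule tendsto_eventually)
    have "\<forall>\<^sub>F s in at_left 0. s < (0::real)" by (simp add: eventually_at_filter)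
    then show "\<forall>\<^sub>F s in at_left 0. exp_bump m s = 0"
      by eventually_elim (simp add: exp_bump_def)
  qed
  ultimately show ?thesis by (simp add: filterlim_split_at)
qed

lemma exp_bump_deriv:
  "(exp_bump m has_real_derivative exp_bump (m + 2) s - m * exp_bump (m + 1) s) (at s)"
proof -
  consider "s < 0" | "s = 0" | "0 < s" by linarith
  then show ?thesis
  proof cases
    case 1
    have "((\<lambda>_. 0) has_real_derivative exp_bump (m + 2) s - m * exp_bump (m + 1) s) (at s)"
      using 1 by (simp add: exp_bump_def)
    then show ?thesis
      by (rule has_field_derivative_transform_within_open[where S="{..<0}"]) (use 1 in \<open>auto simp: exp_bump_def\<close>)
  next
    \<comment> \<open>At 0 the difference quotient is the family member with exponent raised by 1,
      which tends to 0.\<close>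
    case 2
    have "\<forall>\<^sub>F s in at 0. exp_bump (Suc m) s = (exp_bump m s - exp_bump m 0) / (s - 0)"
      unfolding eventually_at by (intro exI[of _ 1]) (auto simp: exp_bump_def field_simps)
    from Lim_transform_eventually[OF exp_bump_tendsto_0 this]
    show ?thesis using 2 by (simp add: has_field_derivative_iff) (simp add: exp_bump_def)
  next
    case 3
    have "((\<lambda>s. exp (- inverse s) * inverse s ^ m) has_real_derivative
        exp (- inverse s) * inverse s ^ (m + 2) - m * (exp (- inverse s) * inverse s ^ (m + 1))) (at s)"
    proof -
      have i: "(inverse has_real_derivative - (inverse s ^ Suc (Suc 0))) (at s)"
        using DERIV_inverse[of s UNIV] 3 by simp
      have e: "((\<lambda>s. exp (- inverse s)) has_real_derivative exp (- inverse s) * - (- (inverse s ^ Suc (Suc 0)))) (at s)"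
        by (rule DERIV_chain2[OF DERIV_exp DERIV_minus[OF i]])
      show ?thesis
        by (rule DERIV_cong[OF DERIV_mult[OF e DERIV_power[OF i, of m]]]) (cases m; simp add: algebra_simps)
    qed
    moreover have "exp_bump k t = exp (- inverse t) * inverse t ^ k" if "0 < t" for k t
      using that by (simp add: exp_bump_def divide_inverse power_inverse)
    ultimately have "((\<lambda>s. exp (- inverse s) * inverse s ^ m) has_real_derivative exp_bump (m + 2) s - m * exp_bump (m + 1) s) (at s)"
      using 3 by simp
    then show ?thesis
      by (rule has_field_derivative_transform_within_open[where S="{0<..}"]) (use 3 in \<open>auto simp: exp_bump_def divide_inverse power_inverse\<close>)
  qed
qed

text \<open>Smoothness of the bump function is proved for an algebra closed under partial derivatives.\<close>

inductive bump_algebra :: "real \<Rightarrow> 'a::euclidean_space \<Rightarrow> ('a \<Rightarrow> real) \<Rightarrow> bool" for r c where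
  const: "bump_algebra r c (\<lambda>x. a)"
| coord: "bump_algebra r c (\<lambda>x. x \<bullet> b)"
| bump: "bump_algebra r c (\<lambda>x. exp_bump m (r\<^sup>2 - (norm (x - c))\<^sup>2))"
| add: "bump_algebra r c f \<Longrightarrow> bump_algebra r c g \<Longrightarrow> bump_algebra r c (\<lambda>x. f x + g x)"
| mult: "bump_algebra r c f \<Longrightarrow> bump_algebra r c g \<Longrightarrow> bump_algebra r c (\<lambda>x. f x * g x)"

lemma bump_algebra_diff:
  "bump_algebra r c f \<Longrightarrow> bump_algebra r c g \<Longrightarrow> bump_algebra r c (\<lambda>x. f x - g x)"
  using bump_algebra.add[OF _ bump_algebra.mult[OF bump_algebra.const[of r c "-1"]]] by fastforce

lemma bump_algebra_deriv:
  assumes "bump_algebra r c f"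
  shows "\<exists>D. (\<forall>x. (f has_derivative D x) (at x)) \<and> (\<forall>b. bump_algebra r c (\<lambda>x. D x b))"
  using assms
proof induction
  case (const a)
  show ?case by (intro exI[of _ "\<lambda>x h. 0"]) (auto intro: bump_algebra.const)
next
  case (coord b)
  show ?case
    by (intro exI[of _ "\<lambda>x h. h \<bullet> b"]) (auto intro: bump_algebra.const intro!: derivative_eq_intros)
next
  case (bump m)
  define D where "D x h = (exp_bump (m + 2) (r\<^sup>2 - (norm (x - c))\<^sup>2) - m * exp_bump (m + 1) (r\<^sup>2 - (norm (x - c))\<^sup>2))
    * ((-2) * (x \<bullet> h - c \<bullet> h))" for x h
  have "((\<lambda>x. exp_bump m (r\<^sup>2 - (norm (x - c))\<^sup>2)) has_derivative D x) (at x)" for x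
  proof -
    have "((\<lambda>x. r\<^sup>2 - (norm (x - c))\<^sup>2) has_derivative (\<lambda>h. (-2) * (x \<bullet> h - c \<bullet> h))) (at x)"
      unfolding power2_norm_eq_inner
      by (auto intro!: derivative_eq_intros simp: inner_simps inner_commute)
    from has_derivative_compose[OF this exp_bump_deriv[unfolded has_field_derivative_def]]
    show ?thesis unfolding D_def by simp
  qed
  moreover have "bump_algebra r c (\<lambda>x. D x b)" for b
    unfolding D_def by (intro bump_algebra.intros bump_algebra_diff)
  ultimately show ?case by blast
next
  case (add f g)
  then obtain Df Dg where "\<And>x. (f has_derivative Df x) (at x)" "\<And>b. bump_algebra r c (\<lambda>x. Df x b)"
    "\<And>x. (g has_derivative Dg x) (at x)" "\<And>b. bump_algebra r c (\<lambda>x. Dg x b)" by blast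
  then show ?case
    by (intro exI[of _ "\<lambda>x h. Df x h + Dg x h"]) (auto intro!: derivative_intros bump_algebra.add)
next
  case (mult f g)
  then obtain Df Dg where "\<And>x. (f has_derivative Df x) (at x)" "\<And>b. bump_algebra r c (\<lambda>x. Df x b)"
    "\<And>x. (g has_derivative Dg x) (at x)" "\<And>b. bump_algebra r c (\<lambda>x. Dg x b)" by blast
  with mult.hyps show ?case
    by (intro exI[of _ "\<lambda>x h. f x * Dg x h + Df x h * g x"])
       (auto intro!: derivative_intros bump_algebra.add bump_algebra.mult)
qed

lemma bump_algebra_smooth:
  assumes "bump_algebra r c f"
  shows "smooth f"
proof -
  have "Ck k f" for k
    using assms
  proof (induction k arbitrary: f)
    case 0
    then obtain D where "\<And>x. (f has_derivative D x) (at x)" using bump_algebra_deriv by blast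
    then show ?case
      by (auto intro!: continuous_at_imp_continuous_on dest: has_derivative_continuous)
  next
    case (Suc k)
    then obtain D where D: "\<And>x. (f has_derivative D x) (at x)" "\<And>b. bump_algebra r c (\<lambda>x. D x b)"
      using bump_algebra_deriv by blast
    have "frechet_derivative f (at x) = D x" for x
      using D(1) by (metis frechet_derivative_at)
    then show ?case using D Suc.IH by (auto simp: differentiable_def)
  qed
  then show ?thesis by (simp add: smooth_def)
qed

section \<open>Bumps on balls and the smooth mollifier\<close>

definition ball_bump :: "real \<Rightarrow> 'a::euclidean_space \<Rightarrow> real" where
  "ball_bump r x = exp_bump 0 (r\<^sup>2 - (norm x)\<^sup>2)"

lemma ball_bump_smooth: "smooth (\<lambda>y. a * ball_bump r (y - c))"
  unfolding ball_bump_def by (rule bump_algebra_smooth[of r c]) (intro bump_algebra.intros)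

lemma ball_bump_simps:
  assumes "0 < r"
  shows "0 \<le> ball_bump r x" "norm x < r \<Longrightarrow> 0 < ball_bump r x" "r \<le> norm x \<Longrightarrow> ball_bump r x = 0"
proof -
  show "0 \<le> ball_bump r x" by (simp add: ball_bump_def exp_bump_def)
  show "0 < ball_bump r x" if "norm x < r"
    using power_strict_mono[OF that, of 2] by (simp add: ball_bump_def exp_bump_def)
  show "ball_bump r x = 0" if "r \<le> norm x"
    using power_mono[OF that, of 2] assms by (simp add: ball_bump_def exp_bump_def)
qed

lemma not_AE_notin_ball:
  fixes c :: "'a::euclidean_space"
  assumes "AE x in lborel. x \<notin> ball c r"
  shows "r \<le> 0"
proof (rule ccontr)
  assume "\<not> r \<le> 0"
  moreover have "emeasure lborel (ball c r) = 0"
    using assms AE_iff_null_sets[of "ball c r" lborel] by (auto simp: null_sets_def)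
  ultimately show False
    using emeasure_lborel_ball_finite[of c r] content_ball_pos[of r c] by (simp add: measure_def)
qed

lemma integral_pos_on_ball:
  fixes f :: "'a::euclidean_space \<Rightarrow> real"
  assumes "integrable lborel f" "\<And>x. 0 \<le> f x" "0 < r" "AE x in lborel. x \<in> ball c r \<longrightarrow> 0 < f x"
  shows "0 < (LBINT x. f x)"
proof (rule ccontr)
  assume "\<not> 0 < (LBINT x. f x)"
  then have "(LBINT x. f x) = 0" using Bochner_Integration.integral_nonneg[of lborel f] assms(2) by fastforce
  then have "AE x in lborel. f x = 0"
    using integral_nonneg_eq_0_iff_AE[OF assms(1)] assms(2) by simp
  with assms(4) have "AE x in lborel. x \<notin> ball c r" by eventually_elim auto
  with \<open>0 < r\<close> show False using not_AE_notin_ball by force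
qed

definition std_mollifier :: "nat \<Rightarrow> 'a::euclidean_space \<Rightarrow> real" where
  "std_mollifier n x = inverse (LBINT y. ball_bump (1 / real (Suc n)) (y::'a)) * ball_bump (1 / real (Suc n)) x"

lemma std_mollifier_smooth: "smooth (\<lambda>y. std_mollifier n (y - c))"
  unfolding std_mollifier_def by (rule ball_bump_smooth)

lemma std_mollifier_smooth0: "smooth (std_mollifier n)"
  using std_mollifier_smooth[of n 0] by simp

lemma std_mollifier_eq_0: "1 / real (Suc n) < norm x \<Longrightarrow> std_mollifier n x = 0"
  by (simp add: std_mollifier_def ball_bump_simps del: of_nat_Suc)

lemma std_mollifier: "mollifier (std_mollifier :: nat \<Rightarrow> 'a::euclidean_space \<Rightarrow> real) (\<lambda>n. 1 / real (Suc n))"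
  unfolding mollifier_def
proof (intro conjI allI impI)
  fix n and x :: 'a
  define r where "r = 1 / real (Suc n)"
  have r: "0 < r" by (simp add: r_def)
  have c: "continuous_on UNIV (ball_bump r :: 'a \<Rightarrow> real)"
    using smooth_continuous[OF ball_bump_smooth[of 1 r 0]] by simp
  have i: "integrable lborel (ball_bump r :: 'a \<Rightarrow> real)"
  proof -
    obtain C where "\<And>x. x \<in> cball 0 r \<Longrightarrow> \<bar>ball_bump r (x::'a)\<bar> \<le> C"
      using continuous_bounded_cball[OF c] by blast
    then show ?thesis
      by (rule integrable_bounded_support[OF borel_measurable_continuous_onI[OF c]]) (use r in \<open>auto simp: ball_bump_simps\<close>)
  qed
  have pos: "0 < (LBINT y. ball_bump r (y::'a))"
    by (rule integral_pos_on_ball[OF i, of r 0]) (use r in \<open>auto simp: ball_bump_simps\<close>)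
  show "continuous_on UNIV (std_mollifier n :: 'a \<Rightarrow> real)"
    by (rule smooth_continuous[OF std_mollifier_smooth0])
  show "0 \<le> std_mollifier n x"
    using pos r ball_bump_simps(1)[OF r, of x] by (simp add: std_mollifier_def r_def)
  show "(LBINT x. std_mollifier n (x::'a)) = 1"
    using pos by (simp add: std_mollifier_def r_def)
qed (use LIMSEQ_inverse_real_of_nat in \<open>simp_all add: inverse_eq_divide std_mollifier_eq_0 del: of_nat_Suc\<close>)

subsection \<open>The weak formulation\<close>

lemma test_functionsI:
  assumes "smooth \<phi>" "compact K" "K \<subseteq> \<Omega>" "\<And>x. x \<notin> K \<Longrightarrow> \<phi> x = 0"
  shows "\<phi> \<in> test_functions \<Omega>"
proof -
  have "closure {x. \<phi> x \<noteq> 0} \<subseteq> K"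
    using assms by (intro closure_minimal) (auto intro: compact_imp_closed)
  then show ?thesis
    using assms compact_Int_closed[OF assms(2), of "closure {x. \<phi> x \<noteq> 0}"]
    by (auto simp: test_functions_def Int_absorb1)
qed

lemma frechet_derivative_eq_0:
  fixes f :: "'a::euclidean_space \<Rightarrow> real"
  assumes "open U" "x \<in> U" "\<And>y. y \<in> U \<Longrightarrow> f y = 0"
  shows "frechet_derivative f (at x) b = 0"
proof -
  have "(f has_derivative (\<lambda>h. 0)) (at x)"
    by (rule has_derivative_transform_within_open[of "\<lambda>_. 0" _ _ _ U]) (use assms in auto)
  then show ?thesis by (metis frechet_derivative_at)
qed

lemma test_function_partial:
  assumes "\<phi> \<in> test_functions \<Omega>" "b \<in> Basis"
  shows "(\<lambda>x. frechet_derivative \<phi> (at x) b) \<in> test_functions \<Omega>"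
proof (rule test_functionsI)
  show "frechet_derivative \<phi> (at x) b = 0" if "x \<notin> closure {x. \<phi> x \<noteq> 0}" for x
    by (rule frechet_derivative_eq_0[of "- closure {x. \<phi> x \<noteq> 0}"])
       (use that closure_subset[of "{x. \<phi> x \<noteq> 0}"] in auto)
qed (use assms in \<open>auto simp: test_functions_def smooth_partial\<close>)

lemma L1_loc_mult_integrable:
  fixes f :: "'a::euclidean_space \<Rightarrow> 'b::euclidean_space"
  assumes f: "f \<in> L1_loc \<Omega>" and \<Omega>: "open \<Omega>" and \<psi>: "continuous_on UNIV \<psi>"
    and K: "compact K" "K \<subseteq> \<Omega>" "\<And>x. x \<notin> K \<Longrightarrow> \<psi> x = (0::real)"
  shows "integrable (lebesgue_on \<Omega>) (\<lambda>x. \<psi> x *\<^sub>R f x)"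
proof -
  have sK: "K \<in> sets lebesgue" and s\<Omega>: "\<Omega> \<in> sets lebesgue"
    using K(1) \<Omega> by (auto simp: lmeasurable_compact fmeasurableD)
  obtain R where R: "K \<subseteq> cball 0 R" using compact_imp_bounded[OF K(1)] by (auto simp: bounded_iff subset_iff)
  obtain C where C: "\<And>x. x \<in> cball 0 R \<Longrightarrow> \<bar>\<psi> x\<bar> \<le> C"
    using continuous_bounded_cball[OF \<psi>] by blast
  have "integrable (lebesgue_on K) f" using f K by (auto simp: L1_loc_def)
  then have i: "integrable lebesgue (\<lambda>x. indicator K x *\<^sub>R f x)"
    using sK by (simp add: integrable_restrict_space)
  have "integrable lebesgue (\<lambda>x. \<psi> x *\<^sub>R (indicator K x *\<^sub>R f x))"
  proof (rule Bochner_Integration.integrable_bound[where f="\<lambda>x. C *\<^sub>R (indicator K x *\<^sub>R f x)"])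
    have "\<psi> \<in> borel_measurable borel" using \<psi> by (rule borel_measurable_continuous_onI)
    then have [measurable]: "\<psi> \<in> borel_measurable lebesgue" by (simp add: measurable_completion)
    note [measurable] = borel_measurable_integrable[OF i]
    show "(\<lambda>x. \<psi> x *\<^sub>R (indicator K x *\<^sub>R f x)) \<in> borel_measurable lebesgue" by measurable
    show "AE x in lebesgue. norm (\<psi> x *\<^sub>R (indicator K x *\<^sub>R f x)) \<le> norm (C *\<^sub>R (indicator K x *\<^sub>R f x))"
    proof (rule AE_I2)
      fix x
      show "norm (\<psi> x *\<^sub>R (indicator K x *\<^sub>R f x)) \<le> norm (C *\<^sub>R (indicator K x *\<^sub>R f x))"
      proof (cases "x \<in> K")
        case True
        then have "\<bar>\<psi> x\<bar> \<le> \<bar>C\<bar>" using C[of x] R by auto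
        with True show ?thesis by (auto intro!: mult_right_mono)
      qed simp
    qed
  qed (rule integrable_scaleR_right, rule i)
  moreover have "\<psi> x *\<^sub>R (indicator K x *\<^sub>R f x) = indicator \<Omega> x *\<^sub>R (\<psi> x *\<^sub>R f x)" for x
    using K(2,3) by (auto simp: indicator_def)
  ultimately have "integrable lebesgue (\<lambda>x. indicator \<Omega> x *\<^sub>R (\<psi> x *\<^sub>R f x))" by (simp only:)
  then show ?thesis using s\<Omega> by (subst integrable_restrict_space) auto
qed

lemma test_functionD:
  assumes "\<phi> \<in> test_functions \<Omega>"
  shows "smooth \<phi>" "compact (closure {x. \<phi> x \<noteq> 0})" "closure {x. \<phi> x \<noteq> 0} \<subseteq> \<Omega>"
    "x \<notin> closure {x. \<phi> x \<noteq> 0} \<Longrightarrow> \<phi> x = 0"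
  using assms closure_subset[of "{x. \<phi> x \<noteq> 0}"] by (auto simp: test_functions_def)

text \<open>The definition of the weak gradient is applied to each partial derivative of \<phi>,
  which is again a test function. The component in the same direction is kept, and the sum over
  directions is the Laplacian.\<close>

lemma integral_grad_eq:
  fixes \<phi> :: "'a::euclidean_space \<Rightarrow> real"
  assumes \<Omega>: "open \<Omega>" and wg: "has_weak_gradient \<Omega> u g" and \<phi>: "\<phi> \<in> test_functions \<Omega>"
  shows "integral\<^sup>L (lebesgue_on \<Omega>) (\<lambda>x. g x \<bullet> grad \<phi> x) = - integral\<^sup>L (lebesgue_on \<Omega>) (\<lambda>x. u x * smooth_lap \<phi> x)"
proof -
  define p where "p b x = frechet_derivative \<phi> (at x) b" for b x
  define q where "q c b x = frechet_derivative (p b) (at x) c" for c b x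
  have pt: "p b \<in> test_functions \<Omega>" if "b \<in> Basis" for b
    using test_function_partial[OF \<phi> that] by (simp add: p_def[abs_def])
  have qt: "q c b \<in> test_functions \<Omega>" if "b \<in> Basis" "c \<in> Basis" for c b
    using test_function_partial[OF pt[OF that(1)] that(2)] by (simp add: q_def[abs_def])
  note int = L1_loc_mult_integrable[OF _ \<Omega> smooth_continuous[OF test_functionD(1)] test_functionD(2) test_functionD(3) test_functionD(4)]
  have u: "u \<in> L1_loc \<Omega>" and g: "g \<in> L1_loc \<Omega>" using wg by (auto simp: has_weak_gradient_def)
  have pg: "integrable (lebesgue_on \<Omega>) (\<lambda>x. p b x *\<^sub>R g x)" if "b \<in> Basis" for b
    by (rule int[OF g pt pt pt pt]) (use that in auto)
  have qu: "integrable (lebesgue_on \<Omega>) (\<lambda>x. q c b x * u x)" if "b \<in> Basis" "c \<in> Basis" for c b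
  proof -
    have "integrable (lebesgue_on \<Omega>) (\<lambda>x. q c b x *\<^sub>R u x)"
      by (rule int[OF u qt qt qt qt]) (use that in auto)
    then show ?thesis by simp
  qed
  have ugrad: "u x *\<^sub>R grad (p b) x = (\<Sum>c\<in>Basis. (q c b x * u x) *\<^sub>R c)" for b x
    by (simp add: grad_def q_def scaleR_sum_right mult.commute)
  have iug: "integrable (lebesgue_on \<Omega>) (\<lambda>x. u x *\<^sub>R grad (p b) x)" if "b \<in> Basis" for b
    unfolding ugrad using qu that by (intro Bochner_Integration.integrable_sum integrable_scaleR_left) auto
  have "integral\<^sup>L (lebesgue_on \<Omega>) (\<lambda>x. g x \<bullet> grad \<phi> x) =
      integral\<^sup>L (lebesgue_on \<Omega>) (\<lambda>x. \<Sum>b\<in>Basis. (p b x *\<^sub>R g x) \<bullet> b)"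
    by (simp add: grad_def p_def inner_sum_right)
  also have "\<dots> = (\<Sum>b\<in>Basis. integral\<^sup>L (lebesgue_on \<Omega>) (\<lambda>x. (p b x *\<^sub>R g x) \<bullet> b))"
    using pg by (intro Bochner_Integration.integral_sum integrable_inner_left) auto
  also have "\<dots> = (\<Sum>b\<in>Basis. - integral\<^sup>L (lebesgue_on \<Omega>) (\<lambda>x. u x * q b b x))"
  proof (rule sum.cong[OF refl])
    fix b :: 'a assume b: "b \<in> Basis"
    have "integral\<^sup>L (lebesgue_on \<Omega>) (\<lambda>x. (p b x *\<^sub>R g x) \<bullet> b) = integral\<^sup>L (lebesgue_on \<Omega>) (\<lambda>x. p b x *\<^sub>R g x) \<bullet> b"
      using pg[OF b] by (intro integral_inner_left) auto
    also have "integral\<^sup>L (lebesgue_on \<Omega>) (\<lambda>x. p b x *\<^sub>R g x) = - integral\<^sup>L (lebesgue_on \<Omega>) (\<lambda>x. u x *\<^sub>R grad (p b) x)"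
      using wg pt[OF b] by (auto simp: has_weak_gradient_def)
    also have "(- integral\<^sup>L (lebesgue_on \<Omega>) (\<lambda>x. u x *\<^sub>R grad (p b) x)) \<bullet> b =
        - integral\<^sup>L (lebesgue_on \<Omega>) (\<lambda>x. (u x *\<^sub>R grad (p b) x) \<bullet> b)"
      by (subst integral_inner_left) (use iug[OF b] in auto)
    also have "(\<lambda>x. (u x *\<^sub>R grad (p b) x) \<bullet> b) = (\<lambda>x. u x * q b b x)"
      using b by (simp add: grad_def q_def fun_eq_iff)
    finally show "integral\<^sup>L (lebesgue_on \<Omega>) (\<lambda>x. (p b x *\<^sub>R g x) \<bullet> b) = - integral\<^sup>L (lebesgue_on \<Omega>) (\<lambda>x. u x * q b b x)" .
  qed
  also have "\<dots> = - integral\<^sup>L (lebesgue_on \<Omega>) (\<lambda>x. \<Sum>b\<in>Basis. u x * q b b x)"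
    using qu by (subst Bochner_Integration.integral_sum) (auto simp: sum_negf mult.commute)
  finally show ?thesis
    by (simp add: smooth_lap_def q_def p_def[abs_def] sum_distrib_left)
qed

text \<open>This is -\<Delta>u = F in the distributions on \<open>U\<close>, with both functions
  locally integrable there. The integrals run over the whole space with the Borel measure, so that
  translation and Fubini apply; test functions confine them to \<open>U\<close>.\<close>

definition dist_lap_eq :: "'a::euclidean_space set \<Rightarrow> ('a \<Rightarrow> real) \<Rightarrow> ('a \<Rightarrow> real) \<Rightarrow> bool" where
  "dist_lap_eq U u F \<longleftrightarrow>
     (\<forall>K. compact K \<and> K \<subseteq> U \<longrightarrow> integrable lborel (\<lambda>x. indicator K x * u x) \<and> integrable lborel (\<lambda>x. indicator K x * F x)) \<and>
     (\<forall>\<phi>\<in>test_functions U. (LBINT x. u x * smooth_lap \<phi> x) = - (LBINT x. F x * \<phi> x))"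

text \<open>Second differences commute with translation, and both Laplacians are limits of the same
  sequence; no chain rule for Frechet derivatives is involved.\<close>

lemma smooth_lap_translate:
  assumes "smooth f" "smooth (\<lambda>y. f (y - c))"
  shows "smooth_lap (\<lambda>y. f (y - c)) x = smooth_lap f (x - c)"
proof (rule LIMSEQ_unique)
  show "(\<lambda>n. diff_lap (1 / real (Suc n)) (\<lambda>y. f (y - c)) x) \<longlonglongrightarrow> smooth_lap (\<lambda>y. f (y - c)) x"
    by (rule has_lap_seq[OF smooth_has_lap[OF assms(2)]])
  have "diff_lap t (\<lambda>y. f (y - c)) x = diff_lap t f (x - c)" for t
    by (simp add: diff_lap_def algebra_simps)
  then show "(\<lambda>n. diff_lap (1 / real (Suc n)) (\<lambda>y. f (y - c)) x) \<longlonglongrightarrow> smooth_lap f (x - c)"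
    using has_lap_seq[OF smooth_has_lap[OF assms(1)]] by simp
qed

text \<open>The mollifier moved to x is a test function supported in K. Cutting u and F off outside
  K, which makes them integrable, therefore does not change the pairing.\<close>

lemma dist_lap_eq_moll:
  fixes x :: "'a::euclidean_space"
  assumes eq: "dist_lap_eq U u F" and K: "compact K" "K \<subseteq> U" and x: "cball x r \<subseteq> K"
    and n: "1 / real (Suc n) \<le> r"
  shows "moll (\<lambda>y. indicator K y * u y) (smooth_lap (std_mollifier n)) x = - moll (\<lambda>y. indicator K y * F y) (std_mollifier n) x"
proof -
  define \<phi> :: "'a \<Rightarrow> real" where "\<phi> y = std_mollifier n (y - x)" for y
  have \<phi>0: "\<phi> y = 0" if "y \<notin> cball x (1 / real (Suc n))" for y
    using that by (simp add: \<phi>_def std_mollifier_eq_0 dist_norm norm_minus_commute)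
  have cK: "cball x (1 / real (Suc n)) \<subseteq> K" using x n by (meson order_trans subset_cball)
  have "\<phi> \<in> test_functions U"
    by (rule test_functionsI[of _ "cball x (1 / real (Suc n))"])
       (use cK K \<phi>0 std_mollifier_smooth in \<open>auto simp: \<phi>_def[abs_def]\<close>)
  then have *: "(LBINT y. u y * smooth_lap \<phi> y) = - (LBINT y. F y * \<phi> y)"
    using eq by (auto simp: dist_lap_eq_def)
  have \<phi>K: "\<phi> y = 0" if "y \<notin> K" for y using \<phi>0 cK that by blast
  have sm: "smooth \<phi>" unfolding \<phi>_def[abs_def] by (rule std_mollifier_smooth)
  have LK: "smooth_lap \<phi> y = 0" if "y \<notin> K" for y
    by (rule has_lap_eq_0[OF smooth_has_lap[OF sm], of "- K"]) (use that \<phi>K compact_imp_closed[OF K(1)] in auto)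
  have Leq: "smooth_lap \<phi> y = smooth_lap (std_mollifier n) (y - x)" for y
    unfolding \<phi>_def[abs_def] by (rule smooth_lap_translate[OF std_mollifier_smooth0 std_mollifier_smooth])
  have "moll (\<lambda>y. indicator K y * u y) (smooth_lap (std_mollifier n)) x = (LBINT y. u y * smooth_lap \<phi> y)"
    unfolding moll_def
    by (rule Bochner_Integration.integral_cong) (use LK Leq in \<open>auto simp: indicator_def\<close>)
  moreover have "moll (\<lambda>y. indicator K y * F y) (std_mollifier n) x = (LBINT y. F y * \<phi> y)"
    unfolding moll_def
    by (rule Bochner_Integration.integral_cong) (use \<phi>K in \<open>auto simp: indicator_def \<phi>_def\<close>)
  ultimately show ?thesis using * by simp
qed

text \<open>Local form of Kato's inequality: around the support of \<phi> there is a margin r inside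
  K, so sufficiently fine mollifications of the functions cut off at K satisfy the mollified
  equation on that support.\<close>

lemma dist_lap_eq_kato:
  fixes u w F \<phi> :: "'a::euclidean_space \<Rightarrow> real"
  assumes eq: "dist_lap_eq U u F" and K: "compact K" "K \<subseteq> U" and r: "0 < r"
    and \<phi>: "has_lap \<phi> L\<phi>" "\<And>x. 0 \<le> \<phi> x" "\<And>x. \<phi> x \<noteq> 0 \<Longrightarrow> cball x r \<subseteq> K"
    and w: "has_lap w Lw"
  shows "(LBINT x. (if u x < w x then (Lw x + F x) * \<phi> x else 0))
    \<le> (LBINT x. max 0 (w x - u x) * L\<phi> x)"
proof -
  define u' where "u' y = indicator K y * u y" for y
  define F' where "F' y = indicator K y * F y" for y
  have i: "integrable lborel u'" "integrable lborel F'"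
    using eq K by (auto simp: dist_lap_eq_def u'_def[abs_def] F'_def[abs_def])
  \<comment> \<open>Skipping the first kernels keeps all radii below the margin.\<close>
  obtain n0 where n0: "1 / real (Suc n0) < r"
    using r by (metis inverse_eq_divide reals_Archimedean)
  have nr: "1 / real (Suc (n + n0)) \<le> r" for n
  proof -
    have "1 / real (Suc (n + n0)) \<le> 1 / real (Suc n0)" by (intro divide_left_mono) auto
    then show ?thesis using n0 by linarith
  qed
  obtain R where R: "K \<subseteq> cball 0 R" using compact_imp_bounded[OF K(1)] by (auto simp: bounded_iff subset_iff)
  have \<phi>K: "x \<in> K" if "\<phi> x \<noteq> 0" for x using \<phi>(3)[OF that] r by auto
  have \<phi>R: "\<phi> x = 0" if "R < norm x" for x using \<phi>K[of x] R that by force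
  have LK: "L\<phi> x = 0" if "x \<notin> K" for x
  proof (rule has_lap_eq_0[OF \<phi>(1), of "ball x r"])
    fix y assume "y \<in> ball x r"
    then have "x \<in> cball y r" by (simp add: dist_commute)
    then show "\<phi> y = 0" using \<phi>(3)[of y] that by blast
  qed (use r in auto)
  have "(LBINT x. (if u' x < w x then (Lw x + F' x) * \<phi> x else 0))
      \<le> (LBINT x. max 0 (w x - u' x) * L\<phi> x)"
  proof (rule kato_inequality[OF i \<phi>(1,2) \<phi>R w, where k="\<lambda>n. std_mollifier (n + n0)"
      and e="\<lambda>n. 1 / real (Suc (n + n0))" and Lk="\<lambda>n. smooth_lap (std_mollifier (n + n0))"])
    show "mollifier (\<lambda>n. std_mollifier (n + n0) :: 'a \<Rightarrow> real) (\<lambda>n. 1 / real (Suc (n + n0)))"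
      unfolding mollifier_def
      using mollifierD[OF std_mollifier] LIMSEQ_ignore_initial_segment[OF mollifierD(1)[OF std_mollifier], of n0]
      by (auto simp del: of_nat_Suc of_nat_add)
    show "has_lap (std_mollifier (n + n0)) (smooth_lap (std_mollifier (n + n0) :: 'a \<Rightarrow> real))" for n
      by (rule smooth_has_lap[OF std_mollifier_smooth0])
    show "moll u' (smooth_lap (std_mollifier (n + n0))) x = - moll F' (std_mollifier (n + n0)) x" if "\<phi> x \<noteq> 0" for x n
      unfolding u'_def[abs_def] F'_def[abs_def]
      by (rule dist_lap_eq_moll[OF eq K \<phi>(3)[OF that] nr])
  qed
  moreover have "(if u' x < w x then (Lw x + F' x) * \<phi> x else 0) = (if u x < w x then (Lw x + F x) * \<phi> x else 0)" for x
    using \<phi>K[of x] by (cases "x \<in> K") (auto simp: u'_def F'_def)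
  moreover have "max 0 (w x - u' x) * L\<phi> x = max 0 (w x - u x) * L\<phi> x" for x
    using LK[of x] by (cases "x \<in> K") (auto simp: u'_def)
  ultimately show ?thesis by simp
qed

subsection \<open>Radial functions\<close>

lemma C2_with_const: "C2_with (\<lambda>_. a) (\<lambda>_. 0) (\<lambda>_. 0)"
  by (auto simp: C2_with_def)

lemma C2_with_diff:
  "C2_with f f' f'' \<Longrightarrow> C2_with g g' g'' \<Longrightarrow> C2_with (\<lambda>s. f s - g s) (\<lambda>s. f' s - g' s) (\<lambda>s. f'' s - g'' s)"
  by (auto simp: C2_with_def intro!: DERIV_diff continuous_intros)

lemma C2_with_mult:
  assumes "C2_with f f' f''" "C2_with g g' g''"
  shows "C2_with (\<lambda>s. f s * g s) (\<lambda>s. f' s * g s + f s * g' s) (\<lambda>s. f'' s * g s + 2 * f' s * g' s + f s * g'' s)"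
proof -
  have d: "\<And>s. (f has_real_derivative f' s) (at s)" "\<And>s. (f' has_real_derivative f'' s) (at s)"
    "\<And>s. (g has_real_derivative g' s) (at s)" "\<And>s. (g' has_real_derivative g'' s) (at s)"
    and c: "continuous_on UNIV f''" "continuous_on UNIV g''"
    using assms by (auto simp: C2_with_def)
  have c': "continuous_on UNIV f" "continuous_on UNIV f'" "continuous_on UNIV g" "continuous_on UNIV g'"
    using d DERIV_continuous_on by blast+
  show ?thesis
    unfolding C2_with_def
    by (intro conjI allI continuous_intros c c') (auto intro!: derivative_eq_intros d)
qed

text \<open>Away from a the function agrees locally with one branch. At a the two one-sided
  derivatives exist and coincide, as both equal f' a.\<close>

lemma DERIV_glue:
  fixes f g h f' :: "real \<Rightarrow> real"
  assumes "\<And>s. s \<le> a \<Longrightarrow> f s = g s" "\<And>s. a \<le> s \<Longrightarrow> f s = h s"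
    and g: "\<And>s. s \<le> a \<Longrightarrow> (g has_real_derivative f' s) (at s)"
    and h: "\<And>s. a \<le> s \<Longrightarrow> (h has_real_derivative f' s) (at s)"
  shows "(f has_real_derivative f' s) (at s)"
proof -
  consider "s < a" | "a < s" | "s = a" by linarith
  then show ?thesis
  proof cases
    case 1
    then show ?thesis
      by (intro has_field_derivative_transform_within_open[OF g[of s], of "{..<a}"]) (use assms in auto)
  next
    case 2
    then show ?thesis
      by (intro has_field_derivative_transform_within_open[OF h[of s], of "{a<..}"]) (use assms in auto)
  next
    case 3
    have "(f has_real_derivative f' a) (at a within {..a})"
      by (rule has_field_derivative_transform_within[OF has_field_derivative_at_within[OF g[of a]], of 1])
         (use assms in auto)
    moreover have "(f has_real_derivative f' a) (at a within {a..})"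
      by (rule has_field_derivative_transform_within[OF has_field_derivative_at_within[OF h[of a]], of 1])
         (use assms in auto)
    ultimately have "(f has_real_derivative f' a) (at a within {..a} \<union> {a..})"
      unfolding has_field_derivative_iff by (simp add: Lim_within_Un)
    moreover have "{..a} \<union> {a..} = UNIV" by auto
    ultimately show ?thesis using 3 by simp
  qed
qed

text \<open>The cube of the positive part is C2 across 0, whereas its square is only C1.\<close>

definition pos_cube :: "real \<Rightarrow> real" where "pos_cube s = (max 0 s) ^ 3"

lemma C2_with_pos_cube:
  "C2_with (\<lambda>s. pos_cube (s - a)) (\<lambda>s. 3 * (max 0 (s - a))\<^sup>2) (\<lambda>s. 6 * max 0 (s - a))"
  unfolding C2_with_def
proof (intro conjI allI)
  show "((\<lambda>s. pos_cube (s - a)) has_real_derivative 3 * (max 0 (s - a))\<^sup>2) (at s)" for s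
    by (rule DERIV_glue[where a=a and g="\<lambda>_. 0" and h="\<lambda>s. (s - a) ^ 3"])
       (auto simp: pos_cube_def max_def intro!: derivative_eq_intros)
  show "((\<lambda>s. 3 * (max 0 (s - a))\<^sup>2) has_real_derivative 6 * max 0 (s - a)) (at s)" for s
    by (rule DERIV_glue[where a=a and g="\<lambda>_. 0" and h="\<lambda>s. 3 * (s - a)\<^sup>2"])
       (auto simp: max_def intro!: derivative_eq_intros)
qed (intro continuous_intros)

text \<open>A \<open>C\<^sup>2\<close> extension of \<open>s powr m\<close> below \<open>a\<close>, by the second Taylor polynomial at \<open>a\<close>.\<close>

definition taylor_powr :: "real \<Rightarrow> real \<Rightarrow> real \<Rightarrow> real" where
  "taylor_powr m a s = a powr m + m * a powr (m - 1) * (s - a) + m * (m - 1) * a powr (m - 2) * (s - a)\<^sup>2 / 2"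

definition powr_ext :: "real \<Rightarrow> real \<Rightarrow> real \<Rightarrow> real" where
  "powr_ext m a s = (if s \<le> a then taylor_powr m a s else s powr m)"

definition powr_ext_deriv :: "real \<Rightarrow> real \<Rightarrow> real \<Rightarrow> real" where
  "powr_ext_deriv m a s = (if s \<le> a then m * a powr (m - 1) + m * (m - 1) * a powr (m - 2) * (s - a)
     else m * s powr (m - 1))"

lemma powr_ext_eq: "a \<le> s \<Longrightarrow> powr_ext m a s = s powr m"
  by (auto simp: powr_ext_def taylor_powr_def)

lemma powr_ext_deriv_eq: "a \<le> s \<Longrightarrow> powr_ext_deriv m a s = m * s powr (m - 1)"
  by (auto simp: powr_ext_deriv_def)

lemma C2_with_powr_ext:
  assumes a: "0 < a"
  shows "C2_with (powr_ext m a) (powr_ext_deriv m a) (\<lambda>s. m * (m - 1) * (max a s) powr (m - 2))"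
  unfolding C2_with_def
proof (intro conjI allI)
  show "(powr_ext m a has_real_derivative powr_ext_deriv m a s) (at s)" for s
  proof (rule DERIV_glue[where a=a and g="taylor_powr m a" and h="\<lambda>s. s powr m"])
    show "(taylor_powr m a has_real_derivative powr_ext_deriv m a s) (at s)" if "s \<le> a" for s
      unfolding taylor_powr_def[abs_def] powr_ext_deriv_def using that
      by (auto intro!: derivative_eq_intros)
    show "((\<lambda>s. s powr m) has_real_derivative powr_ext_deriv m a s) (at s)" if "a \<le> s" for s
      using that a has_real_derivative_powr[of s m] by (simp add: powr_ext_deriv_eq)
  qed (auto simp: powr_ext_eq, auto simp: powr_ext_def)
  show "(powr_ext_deriv m a has_real_derivative m * (m - 1) * (max a s) powr (m - 2)) (at s)" for s
  proof (rule DERIV_glue[where a=a and h="\<lambda>s. m * s powr (m - 1)"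
        and g="\<lambda>s. m * a powr (m - 1) + m * (m - 1) * a powr (m - 2) * (s - a)"])
    show "((\<lambda>s. m * a powr (m - 1) + m * (m - 1) * a powr (m - 2) * (s - a)) has_real_derivative
        m * (m - 1) * (max a s) powr (m - 2)) (at s)" if "s \<le> a" for s
      using that by (auto intro!: derivative_eq_intros simp: max_def)
    show "((\<lambda>s. m * s powr (m - 1)) has_real_derivative m * (m - 1) * (max a s) powr (m - 2)) (at s)" if "a \<le> s" for s
      using that a DERIV_cmult[OF has_real_derivative_powr[of s "m - 1"], of m] by (simp add: max_def mult.assoc)
  qed (auto simp: powr_ext_deriv_eq, auto simp: powr_ext_deriv_def)
  have "max a s \<noteq> 0" for s using a by auto
  then show "continuous_on UNIV (\<lambda>s. m * (m - 1) * (max a s) powr (m - 2))"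
    by (intro continuous_intros) auto
qed

text \<open>Differentiating a second order Taylor polynomial with respect to its centre telescopes
  to the third derivative at the centre times (s - x)^2 / 2. For negative exponents the third
  derivative of the power is negative.\<close>

lemma taylor_powr_antimono:
  assumes "0 < a" "a \<le> b" "m < 0"
  shows "taylor_powr m b s \<le> taylor_powr m a s"
proof (rule DERIV_nonpos_imp_nonincreasing[OF assms(2)])
  fix x assume x: "a \<le> x" "x \<le> b"
  then have "0 < x" using assms by linarith
  have "((\<lambda>x. taylor_powr m x s) has_real_derivative m * (m - 1) * (m - 2) * x powr (m - 3) * (s - x)\<^sup>2 / 2) (at x)"
    unfolding taylor_powr_def
    by (rule derivative_eq_intros refl \<open>0 < x\<close> | simp)+ (simp add: field_simps power2_eq_square)
  moreover have "m * (m - 1) * (m - 2) * x powr (m - 3) * (s - x)\<^sup>2 / 2 \<le> 0"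
  proof -
    have "m * (m - 1) * (m - 2) \<le> 0" using assms(3) by (intro mult_nonneg_nonpos mult_nonpos_nonpos) auto
    then show ?thesis by (simp add: mult_nonpos_nonneg)
  qed
  ultimately show "\<exists>y. ((\<lambda>x. taylor_powr m x s) has_real_derivative y) (at x) \<and> y \<le> 0" by blast
qed

lemma powr_ext_antimono:
  assumes "0 < a" "a \<le> b" "m < 0"
  shows "powr_ext m b s \<le> powr_ext m a s"
proof -
  \<comment> \<open>Expanding at s itself returns the value at s, so a single formula with a moving
    centre covers both branches.\<close>
  have "powr_ext m c s = taylor_powr m (max c s) s" for c
    by (auto simp: powr_ext_def max_def taylor_powr_def)
  then show ?thesis
    using taylor_powr_antimono[of "max a s" "max b s" m s] assms by (simp add: max.coboundedI1)
qed

text \<open>Up to a negative constant, this is the Laplacian of the fundamental solution after its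
  singularity inside |y|^2 \<le> a has been replaced by the Taylor extension. The power of a is the
  scaling that makes the total mass independent of a.\<close>

definition cone_kernel :: "real \<Rightarrow> 'a::euclidean_space \<Rightarrow> real" where
  "cone_kernel a y = a powr (- 1 - DIM('a) / 2) * max 0 (a - (norm y)\<^sup>2)"

text \<open>The exponent \<open>1 - N/2\<close> makes \<open>s powr m\<close> at \<open>s = |x|\<^sup>2\<close> the fundamental solution, so the
  Laplacian of the difference of two extensions is a difference of two kernels.\<close>

lemma has_lap_green:
  fixes x0 :: "'a::euclidean_space"
  assumes a: "0 < a" and b: "0 < b" and m: "m = 1 - real DIM('a) / 2"
  shows "has_lap (\<lambda>x. powr_ext m a ((norm (x - x0))\<^sup>2) - powr_ext m b ((norm (x - x0))\<^sup>2))
    (\<lambda>x. m * (m - 1) * (4 + 2 * real DIM('a)) * (cone_kernel b (x - x0) - cone_kernel a (x - x0)))"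
proof -
  \<comment> \<open>Beyond c the two terms cancel because 2 m = 2 - N, which is harmonicity. Below c
    the expression is affine in s and vanishes at c, hence a multiple of c - s.\<close>
  have lap1: "4 * s * (m * (m - 1) * (max c s) powr (m - 2)) + 2 * real DIM('a) * powr_ext_deriv m c s =
      - (m * (m - 1) * (4 + 2 * real DIM('a)) * (c powr (- 1 - real DIM('a) / 2) * max 0 (c - s)))"
    if c: "0 < c" for c s
  proof (cases "s \<le> c")
    case True
    have p: "c powr (m - 1) = c powr (m - 2) * c"
      using c powr_add[of c "m - 2" 1] by simp
    have e: "- 1 - real DIM('a) / 2 = m - 2" "real DIM('a) = 2 - 2 * m" using m by auto
    show ?thesis
      using True unfolding e(1) p powr_ext_deriv_def unfolding e(2) by (simp add: max_def algebra_simps)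
  next
    case False
    then have "0 < s" using c by linarith
    then have p: "s powr (m - 1) = s powr (m - 2) * s"
      using powr_add[of s "m - 2" 1] by simp
    have e: "real DIM('a) = 2 - 2 * m" using m by auto
    show ?thesis
      using False unfolding e p powr_ext_deriv_def by (simp add: max_def algebra_simps p)
  qed
  have "has_lap (\<lambda>x. powr_ext m a ((norm (x - x0))\<^sup>2) - powr_ext m b ((norm (x - x0))\<^sup>2))
    (\<lambda>x. 4 * (norm (x - x0))\<^sup>2 * (m * (m - 1) * (max a ((norm (x - x0))\<^sup>2)) powr (m - 2) - m * (m - 1) * (max b ((norm (x - x0))\<^sup>2)) powr (m - 2)) +
       2 * real DIM('a) * (powr_ext_deriv m a ((norm (x - x0))\<^sup>2) - powr_ext_deriv m b ((norm (x - x0))\<^sup>2)))"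
    by (rule has_lap_radial[OF C2_with_diff[OF C2_with_powr_ext[OF a] C2_with_powr_ext[OF b]]])
  moreover have "4 * s * (m * (m - 1) * (max a s) powr (m - 2) - m * (m - 1) * (max b s) powr (m - 2)) +
       2 * real DIM('a) * (powr_ext_deriv m a s - powr_ext_deriv m b s) =
    m * (m - 1) * (4 + 2 * real DIM('a)) * (b powr (- 1 - real DIM('a) / 2) * max 0 (b - s) - a powr (- 1 - real DIM('a) / 2) * max 0 (a - s))" for s
    using lap1[OF a, of s] lap1[OF b, of s] by (simp add: algebra_simps)
  ultimately show ?thesis by (simp add: cone_kernel_def)
qed

subsection \<open>Positivity on an annulus\<close>

lemma moll_continuous:
  fixes f k :: "'a::euclidean_space \<Rightarrow> real"
  assumes f: "integrable lborel f" and k: "continuous_on UNIV k" "\<And>x. \<bar>k x\<bar> \<le> C"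
  shows "continuous_on UNIV (moll f k)"
proof (rule continuous_at_imp_continuous_on, rule ballI)
  fix x
  have [measurable]: "k \<in> borel_measurable borel" "f \<in> borel_measurable borel"
    using k f by (auto intro: borel_measurable_continuous_onI)
  show "continuous (at x) (moll f k)"
    unfolding continuous_at_sequentially comp_def moll_def
  proof (intro allI impI)
    fix X :: "nat \<Rightarrow> 'a" assume X: "X \<longlonglongrightarrow> x"
    show "(\<lambda>n. LBINT y. f y * k (y - X n)) \<longlonglongrightarrow> (LBINT y. f y * k (y - x))"
    proof (rule dominated_limit)
      show "(\<lambda>n. f y * k (y - X n)) \<longlonglongrightarrow> f y * k (y - x)" for y
        by (intro tendsto_mult tendsto_const continuous_on_tendsto_compose[OF k(1)] tendsto_diff X) auto
      show "\<bar>f y * k (y - X n)\<bar> \<le> \<bar>f y\<bar> * C" for n y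
        using k(2) by (auto simp: abs_mult intro!: mult_left_mono)
    qed (use f in auto)
  qed
qed

lemma cone_kernel_simps:
  fixes y :: "'a::euclidean_space"
  assumes "0 < r"
  shows "0 \<le> cone_kernel (r\<^sup>2) y" "norm y < r \<Longrightarrow> 0 < cone_kernel (r\<^sup>2) y" "r \<le> norm y \<Longrightarrow> cone_kernel (r\<^sup>2) y = 0"
proof -
  show "0 \<le> cone_kernel (r\<^sup>2) y" by (simp add: cone_kernel_def)
  show "0 < cone_kernel (r\<^sup>2) y" if "norm y < r"
    using power_strict_mono[OF that, of 2] assms by (simp add: cone_kernel_def)
  show "cone_kernel (r\<^sup>2) y = 0" if "r \<le> norm y"
    using power_mono[OF that, of 2] assms by (simp add: cone_kernel_def)
qed

lemma cone_kernel_abs_le: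
  fixes y :: "'a::euclidean_space"
  assumes "0 < r"
  shows "\<bar>cone_kernel (r\<^sup>2) y\<bar> \<le> (r\<^sup>2) powr (- 1 - DIM('a) / 2) * r\<^sup>2"
proof -
  have "cone_kernel (r\<^sup>2) y \<le> (r\<^sup>2) powr (- 1 - DIM('a) / 2) * r\<^sup>2"
    unfolding cone_kernel_def by (intro mult_left_mono) auto
  then show ?thesis using cone_kernel_simps(1)[OF assms, of y] by simp
qed

lemma cone_kernel_continuous: "continuous_on UNIV (cone_kernel a)"
  unfolding cone_kernel_def[abs_def] by (intro continuous_intros)

lemma cone_kernel_measurable [measurable]: "cone_kernel a \<in> borel_measurable borel"
  by (rule borel_measurable_continuous_onI[OF cone_kernel_continuous])

lemma cone_kernel_integrable: "0 < r \<Longrightarrow> integrable lborel (cone_kernel (r\<^sup>2) :: 'a::euclidean_space \<Rightarrow> real)"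
  by (rule integrable_bounded_support[where R=r, OF _ cone_kernel_abs_le]) (auto simp: cone_kernel_simps)

lemma green_eq_0:
  assumes "0 < \<epsilon>" "\<epsilon> < \<rho>" "\<rho> \<le> norm (x - x0)"
  shows "powr_ext m (\<epsilon>\<^sup>2) ((norm (x - x0))\<^sup>2) - powr_ext m (\<rho>\<^sup>2) ((norm (x - x0))\<^sup>2) = 0"
  using power_mono[OF assms(3), of 2] power_mono[of \<epsilon> \<rho> 2] assms by (simp add: powr_ext_eq)

text \<open>The difference of the kernels is a nonzero multiple of the Laplacian of a function with
  bounded support, so its integral vanishes. Equality of the masses follows without computing either
  of them.\<close>

lemma cone_kernel_integral_eq:
  assumes dim: "3 \<le> DIM('a::euclidean_space)" and r: "0 < \<epsilon>" "\<epsilon> < \<rho>"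
  shows "(LBINT x. cone_kernel (\<rho>\<^sup>2) (x - x0 :: 'a) - cone_kernel (\<epsilon>\<^sup>2) (x - x0)) = 0"
    "(LBINT x. cone_kernel (\<epsilon>\<^sup>2) (x::'a)) = (LBINT x. cone_kernel (\<rho>\<^sup>2) (x::'a))"
proof -
  define m where "m = 1 - real DIM('a) / 2"
  have z: "(LBINT x. cone_kernel (\<rho>\<^sup>2) (x - x0 :: 'a) - cone_kernel (\<epsilon>\<^sup>2) (x - x0)) = 0" for x0 :: 'a
  proof -
    have "(LBINT x. m * (m - 1) * (4 + 2 * real DIM('a)) * (cone_kernel (\<rho>\<^sup>2) (x - x0 :: 'a) - cone_kernel (\<epsilon>\<^sup>2) (x - x0))) = 0"
    proof (rule integral_lap_eq_0[OF has_lap_green[OF _ _ m_def]])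
      fix x :: 'a assume "\<rho> + norm x0 < norm x"
      then show "powr_ext m (\<epsilon>\<^sup>2) ((norm (x - x0))\<^sup>2) - powr_ext m (\<rho>\<^sup>2) ((norm (x - x0))\<^sup>2) = 0"
        using norm_triangle_sub[of x x0] by (intro green_eq_0 r) auto
    qed (use r in auto)
    moreover have "m * (m - 1) * (4 + 2 * real DIM('a)) \<noteq> 0"
      using dim by (auto simp: m_def)
    ultimately show ?thesis by simp
  qed
  show "(LBINT x. cone_kernel (\<rho>\<^sup>2) (x - x0 :: 'a) - cone_kernel (\<epsilon>\<^sup>2) (x - x0)) = 0" by (rule z)
  show "(LBINT x. cone_kernel (\<epsilon>\<^sup>2) (x::'a)) = (LBINT x. cone_kernel (\<rho>\<^sup>2) (x::'a))"
    using z[of 0] cone_kernel_integrable[where 'a='a, of \<rho>] cone_kernel_integrable[where 'a='a, of \<epsilon>] r by simp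
qed

section \<open>Superharmonicity of the truncation of u at height 1\<close>

lemma truncation_integrable:
  fixes u :: "'a::euclidean_space \<Rightarrow> real"
  assumes eq: "dist_lap_eq U u F" and K: "compact K" "K \<subseteq> U" and u: "\<And>x. 0 \<le> u x"
  shows "integrable lborel (\<lambda>x. indicator K x * min 1 (u x))"
proof (rule integrable_dominated)
  show i: "integrable lborel (\<lambda>x. indicator K x * u x)" using eq K by (auto simp: dist_lap_eq_def)
  have [measurable]: "K \<in> sets borel" using K(1) by (rule borel_compact)
  \<comment> \<open>Measurability is known only for the cut-off product, so the truncation is
    expressed through it.\<close>
  have "(\<lambda>x. indicator K x * min 1 (u x)) = (\<lambda>x. min (indicator K x) (indicator K x * u x))"
    by (auto simp: indicator_def fun_eq_iff)
  with i show "(\<lambda>x. indicator K x * min 1 (u x)) \<in> borel_measurable borel" by auto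
  show "\<bar>indicator K x * min 1 (u x)\<bar> \<le> indicator K x * u x" for x
    using u[of x] by (auto simp: indicator_def)
qed

text \<open>Kato's inequality with w = 1 is tested with the difference of the two Taylor extensions,
  which is nonnegative, has bounded support, and has the difference of the kernels as Laplacian. The
  positive part of 1 - u is 1 - min 1 u; the contribution of the constant drops out because the
  kernels have equal mass. What remains says that averages of a superharmonic function grow as the
  radius shrinks.\<close>

lemma truncation_mean_value:
  fixes u F :: "'a::euclidean_space \<Rightarrow> real"
  assumes dim: "3 \<le> DIM('a)" and eq: "dist_lap_eq U u F" and K: "compact K" "K \<subseteq> U"
    and r: "0 < \<epsilon>" "\<epsilon> < \<rho>" "\<rho> < \<rho>'" "cball x0 \<rho>' \<subseteq> K"
    and u: "\<And>x. 0 \<le> u x" and F: "\<And>x. x \<in> K \<Longrightarrow> u x < 1 \<Longrightarrow> 0 \<le> F x"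
  shows "moll (\<lambda>y. indicator K y * min 1 (u y)) (cone_kernel (\<rho>\<^sup>2)) x0 \<le> moll (\<lambda>y. indicator K y * min 1 (u y)) (cone_kernel (\<epsilon>\<^sup>2)) x0"
proof -
  define m where "m = 1 - real DIM('a) / 2"
  define \<kappa> where "\<kappa> = m * (m - 1) * (4 + 2 * real DIM('a))"
  have m: "m < 0" using dim by (simp add: m_def)
  have mm: "0 < m * (m - 1)" using m by (intro mult_neg_neg) auto
  have \<kappa>: "0 < \<kappa>" unfolding \<kappa>_def by (rule mult_pos_pos[OF mm]) simp
  define \<phi> where "\<phi> x = powr_ext m (\<epsilon>\<^sup>2) ((norm (x - x0))\<^sup>2) - powr_ext m (\<rho>\<^sup>2) ((norm (x - x0))\<^sup>2)" for x
  define D where "D x = cone_kernel (\<rho>\<^sup>2) (x - x0) - cone_kernel (\<epsilon>\<^sup>2) (x - x0)" for x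
  define v where "v y = indicator K y * min 1 (u y)" for y
  have \<phi>: "has_lap \<phi> (\<lambda>x. \<kappa> * D x)"
    unfolding \<phi>_def[abs_def] \<kappa>_def D_def by (rule has_lap_green[OF _ _ m_def]) (use r in auto)
  have \<phi>nn: "0 \<le> \<phi> x" for x
    unfolding \<phi>_def using powr_ext_antimono[of "\<epsilon>\<^sup>2" "\<rho>\<^sup>2" m] power_mono[of \<epsilon> \<rho> 2] r m by auto
  have one: "has_lap (\<lambda>x::'a. 1) (\<lambda>x. 0)"
    using has_lap_radial[OF C2_with_const[of 1], where ?x0.0="0::'a"] by simp
  have "(LBINT x. (if u x < 1 then (0 + F x) * \<phi> x else 0)) \<le> (LBINT x. max 0 (1 - u x) * (\<kappa> * D x))"
  proof (rule dist_lap_eq_kato[OF eq K _ \<phi> \<phi>nn _ one])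
    show "0 < \<rho>' - \<rho>" using r by simp
    show "cball x (\<rho>' - \<rho>) \<subseteq> K" if "\<phi> x \<noteq> 0" for x
    proof -
      have "norm (x - x0) < \<rho>" using that green_eq_0[OF r(1,2), of x x0 m] unfolding \<phi>_def by linarith
      then have "cball x (\<rho>' - \<rho>) \<subseteq> cball x0 \<rho>'"
        by (simp add: cball_subset_cball_iff dist_norm)
      then show ?thesis using r(4) by blast
    qed
  qed
  moreover have "0 \<le> (LBINT x. (if u x < 1 then (0 + F x) * \<phi> x else 0))"
  proof (rule Bochner_Integration.integral_nonneg)
    fix x
    show "0 \<le> (if u x < 1 then (0 + F x) * \<phi> x else 0)"
    proof (cases "x \<in> K")
      case True
      then show ?thesis using F \<phi>nn by auto
    next
      case False
      then have "\<rho> \<le> norm (x - x0)" using r(3,4) by (force simp: dist_norm norm_minus_commute)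
      then have "\<phi> x = 0" using green_eq_0[OF r(1,2)] by (simp add: \<phi>_def)
      then show ?thesis by simp
    qed
  qed
  ultimately have "0 \<le> (LBINT x. max 0 (1 - u x) * (\<kappa> * D x))" by linarith
  also have "\<dots> = \<kappa> * (LBINT x. max 0 (1 - u x) * D x)"
    by (subst integral_mult_right_zero[symmetric]) (simp add: mult.left_commute)
  finally have pos: "0 \<le> (LBINT x. max 0 (1 - u x) * D x)"
    using \<kappa> by (simp add: zero_le_mult_iff)
  have vi: "integrable lborel v"
    unfolding v_def[abs_def] by (rule truncation_integrable[OF eq K u])
  have vD1: "integrable lborel (\<lambda>x. v x * cone_kernel (r\<^sup>2) (x - x0))" if "0 < r" for r
    by (rule integrable_moll_integrand[OF vi _ cone_kernel_abs_le[OF that]]) measurable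
  have ki: "integrable lborel (\<lambda>x. cone_kernel (r\<^sup>2) (x - x0))" if "0 < r" for r
    using integrable_lborel_translate[OF cone_kernel_integrable[OF that], of "- x0"] by simp
  have "max 0 (1 - u x) * D x = D x - (v x * cone_kernel (\<rho>\<^sup>2) (x - x0) - v x * cone_kernel (\<epsilon>\<^sup>2) (x - x0))" for x
  proof (cases "x \<in> K")
    case True
    then show ?thesis by (simp add: v_def D_def algebra_simps max_def min_def)
  next
    case False
    then have "\<rho> \<le> norm (x - x0)" using r(3,4) by (force simp: dist_norm norm_minus_commute)
    then show ?thesis using r by (simp add: D_def cone_kernel_simps)
  qed
  then have "(LBINT x. max 0 (1 - u x) * D x) =
      (LBINT x. D x) - (moll v (cone_kernel (\<rho>\<^sup>2)) x0 - moll v (cone_kernel (\<epsilon>\<^sup>2)) x0)"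
    unfolding moll_def using vD1 ki r by (simp add: D_def)
  moreover have "(LBINT x. D x) = 0"
    unfolding D_def by (rule cone_kernel_integral_eq(1)[OF dim r(1,2)])
  ultimately show ?thesis using pos by (simp add: v_def[abs_def])
qed

text \<open>The average of min 1 u at one fixed scale is continuous and positive, hence bounded
  below on the compact set A. Averages at smaller scales are at least as large, and along a
  subsequence they converge to min 1 u almost everywhere. The mean value inequality thus takes the
  place of a Harnack inequality.\<close>

lemma positive_lower_bound:
  fixes u F :: "'a::euclidean_space \<Rightarrow> real"
  assumes dim: "3 \<le> DIM('a)" and eq: "dist_lap_eq U u F" and K: "compact K" "K \<subseteq> U"
    and A: "compact A" and \<rho>: "0 < \<rho>'" "\<And>x. x \<in> A \<Longrightarrow> cball x \<rho>' \<subseteq> K"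
    and u: "\<And>x. 0 \<le> u x" "AE x in lborel. x \<in> K \<longrightarrow> 0 < u x" and F: "\<And>x. x \<in> K \<Longrightarrow> u x < 1 \<Longrightarrow> 0 \<le> F x"
  obtains \<delta> where "0 < \<delta>" "AE x in lborel. x \<in> A \<longrightarrow> \<delta> \<le> u x"
proof -
  define \<rho> where "\<rho> = \<rho>' / 2"
  have \<rho>2: "0 < \<rho>" "\<rho> < \<rho>'" using \<rho> by (auto simp: \<rho>_def)
  define v where "v y = indicator K y * min 1 (u y)" for y
  have vi: "integrable lborel v"
    unfolding v_def[abs_def] by (rule truncation_integrable[OF eq K u(1)])
  define I where "I = (LBINT x. cone_kernel (\<rho>\<^sup>2) (x::'a))"
  have I: "0 < I" unfolding I_def
    by (rule integral_pos_on_ball[OF cone_kernel_integrable[OF \<rho>2(1)], where r=\<rho> and c=0])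
       (use \<rho>2 in \<open>auto simp: cone_kernel_simps\<close>)
  define Q where "Q = moll v (cone_kernel (\<rho>\<^sup>2))"
  have Qc: "continuous_on UNIV Q"
    unfolding Q_def by (rule moll_continuous[OF vi cone_kernel_continuous cone_kernel_abs_le[OF \<rho>2(1)]])
  have Qp: "0 < Q x" if x: "x \<in> A" for x
    unfolding Q_def moll_def
  proof (rule integral_pos_on_ball[where r=\<rho> and c=x])
    show "integrable lborel (\<lambda>y. v y * cone_kernel (\<rho>\<^sup>2) (y - x))"
      by (rule integrable_moll_integrand[OF vi _ cone_kernel_abs_le[OF \<rho>2(1)]]) measurable
    show "0 \<le> v y * cone_kernel (\<rho>\<^sup>2) (y - x)" for y
      using u(1)[of y] \<rho>2 by (auto simp: v_def cone_kernel_simps intro!: mult_nonneg_nonneg)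
    show "AE y in lborel. y \<in> ball x \<rho> \<longrightarrow> 0 < v y * cone_kernel (\<rho>\<^sup>2) (y - x)"
      using u(2)
    proof eventually_elim
      case (elim y)
      show ?case
      proof
        assume y: "y \<in> ball x \<rho>"
        then have "y \<in> K" using \<rho>(2)[OF x] \<rho>2 by auto
        then show "0 < v y * cone_kernel (\<rho>\<^sup>2) (y - x)"
          using elim y \<rho>2 by (auto simp: v_def dist_norm norm_minus_commute intro!: mult_pos_pos cone_kernel_simps(2))
      qed
    qed
  qed (use \<rho>2 in simp)
  \<comment> \<open>The denominator n + 2 keeps the scale strictly below \<rho>; the same
    \<open>I\<close> normalises every kernel because the masses agree.\<close>
  define k where "k n y = cone_kernel ((\<rho> / real (n + 2))\<^sup>2) y / I" for n and y :: 'a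
  have e: "0 < \<rho> / real (n + 2)" "\<rho> / real (n + 2) < \<rho>" for n
    using \<rho>2 mult_strict_left_mono[of 1 "real (n + 2)" \<rho>] by (auto simp: divide_less_eq)
  have km: "mollifier k (\<lambda>n. \<rho> / real (n + 2))"
    unfolding mollifier_def
  proof (intro conjI allI impI)
    show "(\<lambda>n. \<rho> / real (n + 2)) \<longlonglongrightarrow> 0" using tendsto_mult[OF tendsto_const[of \<rho>] LIMSEQ_ignore_initial_segment[OF LIMSEQ_inverse_real_of_nat, of 1]]
      by (simp add: divide_inverse)
    show "continuous_on UNIV (k n)" for n
      unfolding k_def[abs_def] using I by (intro continuous_intros cone_kernel_continuous) auto
    show "0 \<le> k n x" for n x
      unfolding k_def using I by (intro divide_nonneg_pos cone_kernel_simps e)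
    show "k n x = 0" if "\<rho> / real (n + 2) < norm x" for n x
      unfolding k_def using cone_kernel_simps(3)[OF e(1) less_imp_le[OF that]] by simp
    show "(LBINT x. k n x) = 1" for n
      unfolding k_def using cone_kernel_integral_eq(2)[where 'a='a, OF dim e] I by (simp add: I_def)
  qed
  obtain s where s: "AE x in lborel. (\<lambda>n. moll v (k (s n)) x) \<longlonglongrightarrow> v x"
    using mollifier_AE_subseq[OF km vi] by blast
  have low: "Q x / I \<le> moll v (k n) x" if x: "x \<in> A" for x n
  proof -
    have "Q x \<le> moll v (cone_kernel ((\<rho> / real (n + 2))\<^sup>2)) x"
      unfolding Q_def v_def[abs_def]
      by (rule truncation_mean_value[OF dim eq K e \<rho>2(2) \<rho>(2)[OF x] u(1) F])
    moreover have "moll v (k n) x = moll v (cone_kernel ((\<rho> / real (n + 2))\<^sup>2)) x / I"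
      by (simp add: moll_def k_def)
    ultimately show ?thesis using I by (simp add: divide_right_mono)
  qed
  have "\<exists>\<delta>>0. \<forall>x\<in>A. \<delta> \<le> Q x"
  proof (cases "A = {}")
    case False
    obtain z where "z \<in> A" "\<forall>x\<in>A. Q z \<le> Q x"
      using continuous_attains_inf[OF A False continuous_on_subset[OF Qc]] by auto
    then show ?thesis using Qp by blast
  qed (auto intro: exI[of _ 1])
  then obtain \<delta> where \<delta>: "0 < \<delta>" "\<And>x. x \<in> A \<Longrightarrow> \<delta> \<le> Q x" by blast
  show thesis
  proof (rule that[of "\<delta> / I"])
    show "0 < \<delta> / I" using \<delta> I by simp
    show "AE x in lborel. x \<in> A \<longrightarrow> \<delta> / I \<le> u x"
      using s
    proof eventually_elim
      case (elim x)
      show ?case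
      proof
        assume x: "x \<in> A"
        have "Q x / I \<le> v x"
          by (rule LIMSEQ_le_const[OF elim]) (use low[OF x] in auto)
        moreover have "\<delta> / I \<le> Q x / I" using \<delta>(2)[OF x] I by (simp add: divide_right_mono)
        moreover have "v x \<le> u x" using u(1)[of x] by (auto simp: v_def indicator_def)
        ultimately show "\<delta> / I \<le> u x" by linarith
      qed
    qed
  qed
qed

subsection \<open>Comparison near the origin\<close>

lemma C2_with_compose:
  assumes "C2_with f f' f''" "C2_with g g' g''"
  shows "C2_with (\<lambda>s. f (g s)) (\<lambda>s. f' (g s) * g' s) (\<lambda>s. f'' (g s) * (g' s)\<^sup>2 + f' (g s) * g'' s)"
proof -
  have d: "\<And>s. (f has_real_derivative f' s) (at s)" "\<And>s. (f' has_real_derivative f'' s) (at s)"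
    "\<And>s. (g has_real_derivative g' s) (at s)" "\<And>s. (g' has_real_derivative g'' s) (at s)"
    and c: "continuous_on UNIV f''" "continuous_on UNIV g''"
    using assms by (auto simp: C2_with_def)
  have c': "continuous_on UNIV f'" "continuous_on UNIV g" "continuous_on UNIV g'"
    using d DERIV_continuous_on by blast+
  have "((\<lambda>s. f' (g s) * g' s) has_real_derivative f'' (g s) * (g' s)\<^sup>2 + f' (g s) * g'' s) (at s)" for s
    using DERIV_mult[OF DERIV_chain2[OF d(2) d(3)] d(4), of s]
    by (rule DERIV_cong) (simp add: power2_eq_square)
  moreover have "continuous_on UNIV (\<lambda>s. f'' (g s) * (g' s)\<^sup>2 + f' (g s) * g'' s)"
    by (intro continuous_intros c' c continuous_on_compose2[OF c(1) c'(2)] continuous_on_compose2[OF c'(1) c'(2)]) auto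
  ultimately show ?thesis
    unfolding C2_with_def using DERIV_chain2[OF d(1) d(3)] by blast
qed

text \<open>This is s^b (1 - a/s)^3 multiplied out. It vanishes to third order at s = a and is close
  to s^b for s much larger than a. In expanded form the Hardy operator acts on each pure power by a
  scalar.\<close>

definition cut_powr :: "real \<Rightarrow> real \<Rightarrow> real \<Rightarrow> real" where
  "cut_powr b a s = s powr b - 3 * a * s powr (b - 1) + 3 * a\<^sup>2 * s powr (b - 2) - a ^ 3 * s powr (b - 3)"

definition cut_powr_deriv :: "real \<Rightarrow> real \<Rightarrow> real \<Rightarrow> real" where
  "cut_powr_deriv b a s = b * s powr (b - 1) - 3 * a * (b - 1) * s powr (b - 2)
     + 3 * a\<^sup>2 * (b - 2) * s powr (b - 3) - a ^ 3 * (b - 3) * s powr (b - 4)"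

definition cut_powr_deriv2 :: "real \<Rightarrow> real \<Rightarrow> real \<Rightarrow> real" where
  "cut_powr_deriv2 b a s = b * (b - 1) * s powr (b - 2) - 3 * a * (b - 1) * (b - 2) * s powr (b - 3)
     + 3 * a\<^sup>2 * (b - 2) * (b - 3) * s powr (b - 4) - a ^ 3 * (b - 3) * (b - 4) * s powr (b - 5)"

lemma powr_shift:
  fixes s :: real
  assumes "0 < s"
  shows "s powr (b + 1) = s powr b * s"
  using assms by (simp add: powr_add)

lemma cut_powr_eq:
  assumes "0 < s"
  shows "cut_powr b a s = (s - a) ^ 3 * s powr (b - 3)"
  using powr_shift[OF assms, of "b - 3"] powr_shift[OF assms, of "b - 2"] powr_shift[OF assms, of "b - 1"]
  by (simp add: cut_powr_def eval_nat_numeral algebra_simps)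

lemma cut_powr_has_deriv:
  assumes "0 < s"
  shows "(cut_powr b a has_real_derivative cut_powr_deriv b a s) (at s)"
    "(cut_powr_deriv b a has_real_derivative cut_powr_deriv2 b a s) (at s)"
  unfolding cut_powr_def[abs_def] cut_powr_deriv_def[abs_def] cut_powr_deriv2_def
  by (rule DERIV_cong, (rule DERIV_add DERIV_diff DERIV_cmult has_real_derivative_powr[OF assms])+,
      simp add: algebra_simps)+

text \<open>The singular power is replaced by its C2 extension below a, where the factor (s - a)^3
  is cut to 0, and a second cut-off runs from A to B. Between A and B only the sign is recorded: in
  the comparison the positive part of w - u vanishes there.\<close>

lemma radial_test_function:
  assumes a: "0 < a" "a < A" "A < B"
  obtains \<Phi> \<Phi>' \<Phi>'' where "C2_with \<Phi> \<Phi>' \<Phi>''" "\<And>s. 0 \<le> \<Phi> s"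
    "\<And>s. s \<le> a \<Longrightarrow> \<Phi> s = 0 \<and> \<Phi>' s = 0 \<and> \<Phi>'' s = 0" "\<And>s. B \<le> s \<Longrightarrow> \<Phi> s = 0"
    "\<And>s. a < s \<Longrightarrow> s < A \<Longrightarrow> \<Phi> s = cut_powr b a s \<and> \<Phi>' s = cut_powr_deriv b a s \<and> \<Phi>'' s = cut_powr_deriv2 b a s"
proof -
  \<comment> \<open>Normalised so that the inner expression in \<xi> reaches 0 exactly at s =
    B.\<close>
  define k where "k = 1 / (B - A) ^ 3"
  define \<xi> where "\<xi> s = pos_cube (1 - k * pos_cube (s - A))" for s
  have "\<exists>\<xi>' \<xi>''. C2_with \<xi> \<xi>' \<xi>''"
    using C2_with_compose[OF C2_with_pos_cube[of 0] C2_with_diff[OF C2_with_const[of 1] C2_with_mult[OF C2_with_const[of k] C2_with_pos_cube[of A]]]]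
    unfolding \<xi>_def[abs_def] by auto
  then obtain \<xi>' \<xi>'' where \<xi>: "C2_with \<xi> \<xi>' \<xi>''" by blast
  have \<xi>1: "\<xi> s = 1" if "s \<le> A" for s using that by (simp add: \<xi>_def pos_cube_def)
  have \<xi>0: "\<xi> s = 0" if "B \<le> s" for s
  proof -
    have "(B - A) ^ 3 \<le> (s - A) ^ 3" using that a by (intro power_mono) auto
    then have "1 \<le> k * pos_cube (s - A)" using that a by (simp add: k_def pos_cube_def)
    then show ?thesis by (simp add: \<xi>_def pos_cube_def)
  qed
  have \<xi>nn: "0 \<le> \<xi> s" for s by (simp add: \<xi>_def pos_cube_def)
  define \<Phi> where "\<Phi> s = pos_cube (s - a) * (powr_ext (b - 3) a s * \<xi> s)" for s
  obtain g g' g'' where g: "C2_with g g' g''" "g = (\<lambda>s. powr_ext (b - 3) a s * \<xi> s)"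
    using C2_with_mult[OF C2_with_powr_ext[OF a(1), of "b - 3"] \<xi>] by blast
  define \<Phi>' where "\<Phi>' s = 3 * (max 0 (s - a))\<^sup>2 * g s + pos_cube (s - a) * g' s" for s
  define \<Phi>'' where "\<Phi>'' s = 6 * max 0 (s - a) * g s + 2 * (3 * (max 0 (s - a))\<^sup>2) * g' s + pos_cube (s - a) * g'' s" for s
  have C: "C2_with \<Phi> \<Phi>' \<Phi>''"
    using C2_with_mult[OF C2_with_pos_cube[of a] g(1)] unfolding \<Phi>_def[abs_def] \<Phi>'_def[abs_def] \<Phi>''_def[abs_def] g(2) .
  have eq: "\<Phi> s = cut_powr b a s" if "a < s" "s < A" for s
    using that a by (simp add: \<Phi>_def \<xi>1 powr_ext_eq cut_powr_eq pos_cube_def)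
  have eq': "\<Phi>' s = cut_powr_deriv b a s" if "a < s" "s < A" for s
  proof (rule DERIV_unique)
    show "(\<Phi> has_real_derivative \<Phi>' s) (at s)" using C by (auto simp: C2_with_def)
    show "(\<Phi> has_real_derivative cut_powr_deriv b a s) (at s)"
      by (rule has_field_derivative_transform_within_open[where S="{a<..<A}", OF cut_powr_has_deriv(1)])
         (use that a eq in auto)
  qed
  have eq'': "\<Phi>'' s = cut_powr_deriv2 b a s" if "a < s" "s < A" for s
  proof (rule DERIV_unique)
    show "(\<Phi>' has_real_derivative \<Phi>'' s) (at s)" using C by (auto simp: C2_with_def)
    show "(\<Phi>' has_real_derivative cut_powr_deriv2 b a s) (at s)"
      by (rule has_field_derivative_transform_within_open[where S="{a<..<A}", OF cut_powr_has_deriv(2)])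
         (use that a eq' in auto)
  qed
  show thesis
  proof (rule that[OF C])
    show "0 \<le> \<Phi> s" for s
    proof (cases "s \<le> a")
      case False
      then have "0 \<le> powr_ext (b - 3) a s" by (simp add: powr_ext_eq)
      then show ?thesis using \<xi>nn[of s] by (simp add: \<Phi>_def pos_cube_def)
    qed (simp add: \<Phi>_def pos_cube_def)
    show "\<Phi> s = 0 \<and> \<Phi>' s = 0 \<and> \<Phi>'' s = 0" if "s \<le> a" for s
      using that by (simp add: \<Phi>_def \<Phi>'_def \<Phi>''_def pos_cube_def)
    show "\<Phi> s = 0" if "B \<le> s" for s using \<xi>0[OF that] by (simp add: \<Phi>_def)
  qed (use eq eq' eq'' in blast)
qed

text \<open>Up to the factor \<open>s powr (m - 1)\<close>, this is the action of \<open>\<Delta> + \<mu> / |x|\<^sup>2\<close> on \<open>s powr m\<close>, \<open>s = |x|\<^sup>2\<close>.\<close>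

definition hardy_symbol :: "real \<Rightarrow> real \<Rightarrow> real \<Rightarrow> real" where
  "hardy_symbol N \<mu> m = 2 * m * (2 * m + N - 2) + \<mu>"

text \<open>Each of the four powers contributes its Hardy symbol, with the binomial coefficients 1,
  3, 3, 1. The leading one is -\<kappa>; the others carry a/s, (a/s)^2 and (a/s)^3, all at most a/s
  because a < s.\<close>

lemma cut_powr_hardy:
  assumes s: "0 < a" "a < s" and b: "hardy_symbol N \<mu> b = - \<kappa>"
  shows "4 * s * cut_powr_deriv2 b a s + 2 * N * cut_powr_deriv b a s + \<mu> * cut_powr b a s / s
    \<le> s powr (b - 1) * (- \<kappa> + (3 * \<bar>hardy_symbol N \<mu> (b - 1)\<bar> + 3 * \<bar>hardy_symbol N \<mu> (b - 2)\<bar> + \<bar>hardy_symbol N \<mu> (b - 3)\<bar>) * a / s)"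
proof -
  have s0: "0 < s" using s by linarith
  \<comment> \<open>The lowest power that occurs; in terms of it all others are polynomial in s, and
    the identity becomes plain algebra.\<close>
  define Z where "Z = s powr (b - 5)"
  have Z: "0 < Z" using s0 by (simp add: Z_def)
  have p: "s powr (b - 4) = Z * s" "s powr (b - 3) = Z * s * s" "s powr (b - 2) = Z * s * s * s"
    "s powr (b - 1) = Z * s * s * s * s" "s powr b = Z * s * s * s * s * s"
    using powr_shift[OF s0, of "b - 5"] powr_shift[OF s0, of "b - 4"] powr_shift[OF s0, of "b - 3"]
      powr_shift[OF s0, of "b - 2"] powr_shift[OF s0, of "b - 1"] by (simp_all add: Z_def)
  define h1 h2 h3 where "h1 = hardy_symbol N \<mu> (b - 1)" and "h2 = hardy_symbol N \<mu> (b - 2)" and "h3 = hardy_symbol N \<mu> (b - 3)"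
  have q: "\<mu> * cut_powr b a s / s = \<mu> * (Z * s * s * s * s - 3 * a * (Z * s * s * s) + 3 * a\<^sup>2 * (Z * s * s) - a ^ 3 * (Z * s))"
    unfolding cut_powr_def p using s0 by (simp add: field_simps eval_nat_numeral)
  have rows: "4 * s * (A0 - A1 + A2 - A3) + 2 * N * (B0 - B1 + B2 - B3) + \<mu> * (D0 - D1 + D2 - D3) =
      (4 * s * A0 + 2 * N * B0 + \<mu> * D0) - (4 * s * A1 + 2 * N * B1 + \<mu> * D1)
      + (4 * s * A2 + 2 * N * B2 + \<mu> * D2) - (4 * s * A3 + 2 * N * B3 + \<mu> * D3)"
    for A0 A1 A2 A3 B0 B1 B2 B3 D0 D1 D2 D3 :: real
    by (simp add: algebra_simps)
  have r0: "4 * s * (b * (b - 1) * (Z * s * s * s)) + 2 * N * (b * (Z * s * s * s * s)) + \<mu> * (Z * s * s * s * s) =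
      Z * s * (s ^ 3 * hardy_symbol N \<mu> b)"
    by (simp add: hardy_symbol_def algebra_simps power3_eq_cube)
  have r1: "4 * s * (3 * a * (b - 1) * (b - 2) * (Z * s * s)) + 2 * N * (3 * a * (b - 1) * (Z * s * s * s)) + \<mu> * (3 * a * (Z * s * s * s)) =
      Z * s * (3 * a * s\<^sup>2 * h1)"
    by (simp add: h1_def hardy_symbol_def algebra_simps power2_eq_square)
  have r2: "4 * s * (3 * a\<^sup>2 * (b - 2) * (b - 3) * (Z * s)) + 2 * N * (3 * a\<^sup>2 * (b - 2) * (Z * s * s)) + \<mu> * (3 * a\<^sup>2 * (Z * s * s)) =
      Z * s * (3 * a\<^sup>2 * s * h2)"
    by (simp add: h2_def hardy_symbol_def algebra_simps)
  have r3: "4 * s * (a ^ 3 * (b - 3) * (b - 4) * Z) + 2 * N * (a ^ 3 * (b - 3) * (Z * s)) + \<mu> * (a ^ 3 * (Z * s)) =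
      Z * s * (a ^ 3 * h3)"
    by (simp add: h3_def hardy_symbol_def algebra_simps)
  have e: "4 * s * cut_powr_deriv2 b a s + 2 * N * cut_powr_deriv b a s + \<mu> * cut_powr b a s / s =
    Z * s * (s ^ 3 * hardy_symbol N \<mu> b - 3 * a * s\<^sup>2 * h1 + 3 * a\<^sup>2 * s * h2 - a ^ 3 * h3)"
    unfolding q cut_powr_deriv_def cut_powr_deriv2_def p Z_def[symmetric] rows r0 r1 r2 r3
    by (simp only: right_diff_distrib distrib_left)
  have t1: "- (3 * a * s\<^sup>2 * h1) \<le> a * s\<^sup>2 * (3 * \<bar>h1\<bar>)"
  proof -
    have "0 \<le> 3 * a * s\<^sup>2" using s by simp
    from mult_left_mono[OF abs_ge_minus_self[of h1] this] show ?thesis by (simp only: mult_ac mult_minus_right)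
  qed
  have t2: "3 * a\<^sup>2 * s * h2 \<le> a * s\<^sup>2 * (3 * \<bar>h2\<bar>)"
  proof -
    have "a\<^sup>2 * s \<le> a * s\<^sup>2" using s s0 by (simp add: power2_eq_square)
    then have "a\<^sup>2 * s * \<bar>h2\<bar> \<le> a * s\<^sup>2 * \<bar>h2\<bar>" by (intro mult_right_mono) auto
    moreover have "a\<^sup>2 * s * h2 \<le> a\<^sup>2 * s * \<bar>h2\<bar>" using s0 by (intro mult_left_mono) auto
    ultimately show ?thesis by simp
  qed
  have t3: "- (a ^ 3 * h3) \<le> a * s\<^sup>2 * \<bar>h3\<bar>"
  proof -
    have "a\<^sup>2 \<le> s\<^sup>2" using s by (intro power_mono) auto
    then have "a ^ 3 \<le> a * s\<^sup>2" using s by (simp add: eval_nat_numeral)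
    then have "a ^ 3 * \<bar>h3\<bar> \<le> a * s\<^sup>2 * \<bar>h3\<bar>" by (intro mult_right_mono) auto
    moreover have "a ^ 3 * (- h3) \<le> a ^ 3 * \<bar>h3\<bar>" using s by (intro mult_left_mono) auto
    ultimately show ?thesis by linarith
  qed
  have "Z * s * (s ^ 3 * hardy_symbol N \<mu> b - 3 * a * s\<^sup>2 * h1 + 3 * a\<^sup>2 * s * h2 - a ^ 3 * h3)
    \<le> Z * s * (s ^ 3 * (- \<kappa>) + a * s\<^sup>2 * (3 * \<bar>h1\<bar> + 3 * \<bar>h2\<bar> + \<bar>h3\<bar>))"
  proof (rule mult_left_mono)
    have "a * s\<^sup>2 * (3 * \<bar>h1\<bar> + 3 * \<bar>h2\<bar> + \<bar>h3\<bar>) = a * s\<^sup>2 * (3 * \<bar>h1\<bar>) + a * s\<^sup>2 * (3 * \<bar>h2\<bar>) + a * s\<^sup>2 * \<bar>h3\<bar>"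
      by (simp only: distrib_left)
    then show "s ^ 3 * hardy_symbol N \<mu> b - 3 * a * s\<^sup>2 * h1 + 3 * a\<^sup>2 * s * h2 - a ^ 3 * h3
      \<le> s ^ 3 * (- \<kappa>) + a * s\<^sup>2 * (3 * \<bar>h1\<bar> + 3 * \<bar>h2\<bar> + \<bar>h3\<bar>)"
      using t1 t2 t3 unfolding b by linarith
  qed (use Z s0 in simp)
  also have "\<dots> = s powr (b - 1) * (- \<kappa> + (3 * \<bar>h1\<bar> + 3 * \<bar>h2\<bar> + \<bar>h3\<bar>) * a / s)"
    unfolding p using s0 by (simp add: field_simps eval_nat_numeral)
  finally show ?thesis unfolding e h1_def h2_def h3_def .
qed

section \<open>The comparison argument on the punctured ball\<close>

lemma compact_annulus: "compact {x::'a::euclidean_space. a \<le> norm x \<and> norm x \<le> b}"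
proof -
  have "{x::'a. a \<le> norm x \<and> norm x \<le> b} = cball 0 b - ball 0 a" by auto
  then show ?thesis by (simp add: compact_diff)
qed

text \<open>By \<alpha> q = \<alpha> + 2, the bound on c says exactly that w = c |x|^(-\<alpha>)
  satisfies -\<Delta>w - \<mu> w / |x|^2 \<le> - w^q. On the annulus between R1 and R2 the function
  w is at most c R1^(-\<alpha>), hence at most u. The outer cut-off therefore costs nothing, and
  only the cut-off at radius d around the origin leaves an error, which vanishes with d.\<close>

lemma comparison_near_0:
  fixes u :: "'a::euclidean_space \<Rightarrow> real" and N \<mu> p q \<alpha> c :: real
  assumes N: "N = real DIM('a)" and dim: "3 \<le> DIM('a)"
    and um [measurable]: "u \<in> borel_measurable borel" and u: "\<And>x. 0 \<le> u x"
    and F: "F = (\<lambda>x. \<mu> * u x / (norm x)\<^sup>2 + u x powr p - u x powr q)"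
    and eq: "dist_lap_eq (\<Omega> - {0}) u F"
    and R: "0 < R1" "R1 < R2" "R2 < R0" "cball 0 R0 \<subseteq> \<Omega>"
    and ann: "AE x in lborel. R1 \<le> norm x \<and> norm x \<le> R2 \<longrightarrow> c * R1 powr - \<alpha> \<le> u x"
    and \<mu>: "0 < \<mu>" "\<mu> < ((N - 2) / 2)\<^sup>2" and \<alpha>: "0 < \<alpha>" "\<alpha> < (N - 2) / 2"
    and q: "1 < q" "\<alpha> * q = \<alpha> + 2"
    and c: "0 < c" "c powr (q - 1) \<le> \<mu> - \<alpha> * (N - 2 - \<alpha>)"
  shows "AE x in lborel. x \<in> ball 0 R1 - {0} \<longrightarrow> c * norm x powr - \<alpha> \<le> u x"
proof -
  have [measurable]: "F \<in> borel_measurable borel" unfolding F by measurable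
  \<comment> \<open>In terms of s = |x|^2 this is the power |x|^(-(N - 2)/2), whose Hardy symbol is
    minimal, namely -k.\<close>
  define b where "b = - (N - 2) / 4"
  define k where "k = ((N - 2) / 2)\<^sup>2 - \<mu>"
  have k: "0 < k" using \<mu> by (simp add: k_def)
  have hb: "hardy_symbol N \<mu> b = - k"
    by (simp add: hardy_symbol_def b_def k_def power2_eq_square field_simps)
  define C where "C = 3 * \<bar>hardy_symbol N \<mu> (b - 1)\<bar> + 3 * \<bar>hardy_symbol N \<mu> (b - 2)\<bar> + \<bar>hardy_symbol N \<mu> (b - 3)\<bar>"
  have C: "0 \<le> C" by (simp add: C_def)
  \<comment> \<open>Large enough that the cut-off error C a / s is at most k / 2 where |x| \<ge> B d
    and a = d^2.\<close>
  define B where "B = 2 + 2 * C / k"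
  have B: "1 < B" "C / B\<^sup>2 \<le> k / 2"
  proof -
    have "0 \<le> C / k" using C k by simp
    then show "1 < B" by (simp add: B_def)
    then have "B \<le> B\<^sup>2" by (simp add: power2_eq_square)
    moreover have "C \<le> k / 2 * B" using k C by (simp add: B_def field_simps)
    ultimately have "C \<le> k / 2 * B\<^sup>2" using k by (meson mult_left_mono order_trans less_imp_le half_gt_zero)
    then show "C / B\<^sup>2 \<le> k / 2" using \<open>1 < B\<close> by (simp add: divide_le_eq)
  qed
  define e where "e = b - 1 - \<alpha> / 2"
  have bneg: "b < 0" using dim by (simp add: b_def N)
  have eneg: "e < 0" "- \<alpha> / 2 < 0" "b - 1 < 0" using \<alpha> bneg by (auto simp: e_def)
  define s where "s x = (norm x)\<^sup>2" for x :: 'a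
  have [measurable]: "s \<in> borel_measurable borel" unfolding s_def[abs_def] by measurable
  define z where "z x = max 0 (c * s x powr (- \<alpha> / 2) - u x)" for x
  have [measurable]: "z \<in> borel_measurable borel" unfolding z_def[abs_def] by measurable
  have znn: "0 \<le> z x" for x by (simp add: z_def)
  have zle: "z x \<le> c * s x powr (- \<alpha> / 2)" for x using u[of x] c by (simp add: z_def)
  have zb: "z x * s x powr (b - 1) \<le> c * (r\<^sup>2) powr e" if r: "0 < r" "r \<le> norm x" for r x
  proof -
    have sx: "0 < s x" "r\<^sup>2 \<le> s x" using r power_mono[OF r(2), of 2] by (auto simp: s_def)
    then have "z x * s x powr (b - 1) \<le> c * s x powr (- \<alpha> / 2) * s x powr (b - 1)"
      using zle[of x] by (intro mult_right_mono) auto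
    also have "\<dots> = c * s x powr e" by (simp add: powr_add[symmetric] e_def algebra_simps)
    also have "\<dots> \<le> c * (r\<^sup>2) powr e"
      using sx r c eneg by (intro mult_left_mono powr_mono2') auto
    finally show ?thesis .
  qed
  \<comment> \<open>The positive part of w - u, times the Hardy weight |x|^(-2) and the test power,
    on an annulus with inner radius r. The aim is that its integral vanishes for every r >
    0.\<close>
  define J where "J r x = indicator {x. r \<le> norm x \<and> norm x < R1} x * (z x * s x powr (b - 1))" for r x
  have bi: "integrable lborel (J r)"
    if "0 < r" for r
  proof (rule integrable_bounded_support[where R=R1 and C="c * (r\<^sup>2) powr e"])
    show "\<bar>J r x\<bar> \<le> c * (r\<^sup>2) powr e" for x
      using zb[OF that, of x] znn[of x] c by (auto simp: J_def indicator_def)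
    show "J r \<in> borel_measurable borel" unfolding J_def[abs_def] by measurable
  qed (auto simp: J_def indicator_def)
  \<comment> \<open>Volume of the ball of radius B d times the largest error in the shell d < |x| <
    B d.\<close>
  define D where "D d = unit_ball_vol N * (B * d) ^ DIM('a) * (C * c * (d\<^sup>2) powr e)" for d
  have main: "k / 2 * (LBINT x. J (B * d) x) \<le> D d"
    if d: "0 < d" "d < R1" for d
  proof -
    define a where "a = d\<^sup>2"
    have a: "0 < a" "a < R1\<^sup>2" "R1\<^sup>2 < R2\<^sup>2"
      using d R by (auto simp: a_def intro!: power_strict_mono)
    obtain \<Phi> \<Phi>' \<Phi>'' where \<Phi>: "C2_with \<Phi> \<Phi>' \<Phi>''" "\<And>s. 0 \<le> \<Phi> s"
      "\<And>s. s \<le> a \<Longrightarrow> \<Phi> s = 0 \<and> \<Phi>' s = 0 \<and> \<Phi>'' s = 0" "\<And>s. R2\<^sup>2 \<le> s \<Longrightarrow> \<Phi> s = 0"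
      "\<And>s. a < s \<Longrightarrow> s < R1\<^sup>2 \<Longrightarrow> \<Phi> s = cut_powr b a s \<and> \<Phi>' s = cut_powr_deriv b a s \<and> \<Phi>'' s = cut_powr_deriv2 b a s"
      using radial_test_function[OF a, of b] by blast
    define \<phi> where "\<phi> x = \<Phi> (s x)" for x
    define L where "L x = 4 * s x * \<Phi>'' (s x) + 2 * N * \<Phi>' (s x)" for x
    have \<phi>: "has_lap \<phi> L"
      using has_lap_radial[OF \<Phi>(1), where ?x0.0="0::'a"] by (simp add: \<phi>_def[abs_def] L_def[abs_def] s_def N)
    \<comment> \<open>The power is altered only for |x| \<le> d, where the test function and its
      Laplacian vanish.\<close>
    define w where "w x = c * powr_ext (- \<alpha> / 2) a (s x)" for x
    define Lw where "Lw x = 4 * s x * (c * (- \<alpha> / 2 * (- \<alpha> / 2 - 1) * (max a (s x)) powr (- \<alpha> / 2 - 2)))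
        + 2 * N * (c * powr_ext_deriv (- \<alpha> / 2) a (s x))" for x
    have w: "has_lap w Lw"
      using has_lap_radial[OF C2_with_mult[OF C2_with_const[of c] C2_with_powr_ext[OF a(1), of "- \<alpha> / 2"]], where ?x0.0="0::'a"]
      by (simp add: w_def[abs_def] Lw_def[abs_def] s_def N)
    have sa: "a < s x \<longleftrightarrow> d < norm x" for x
      using d power_less_imp_less_base[of d 2 "norm x"] power_strict_mono[of d "norm x" 2] by (auto simp: a_def s_def)
    have sR: "s x < r\<^sup>2 \<longleftrightarrow> norm x < r" if "0 < r" for x r
      using that power_less_imp_less_base[of "norm x" 2 r] power_strict_mono[of "norm x" r 2] by (auto simp: s_def)
    define K where "K = {x::'a. d / 2 \<le> norm x \<and> norm x \<le> R0}"
    have Kc: "compact K" unfolding K_def by (rule compact_annulus)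
    have KU: "K \<subseteq> \<Omega> - {0}" using R(4) d by (auto simp: K_def subset_iff)
    \<comment> \<open>The margin Kato's inequality needs: d / 2 towards the origin, R0 - R2 towards
      the outside.\<close>
    define r where "r = min (d / 2) (R0 - R2)"
    have r: "0 < r" "r \<le> d / 2" "r \<le> R0 - R2" using d R by (auto simp: r_def min_def)
    have \<phi>nz: "d < norm x \<and> norm x < R2" if "\<phi> x \<noteq> 0" for x
      using that \<Phi>(3)[of "s x"] \<Phi>(4)[of "s x"] sa[of x] sR[of R2 x] R by (auto simp: \<phi>_def not_le[symmetric])
    have \<phi>K: "cball x r \<subseteq> K" if "\<phi> x \<noteq> 0" for x
    proof
      fix y assume "y \<in> cball x r"
      then have "norm (x - y) \<le> r" by (simp add: dist_norm)
      then show "y \<in> K"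
        using \<phi>nz[OF that] r norm_triangle_ineq3[of x y] by (simp add: K_def abs_le_iff)
    qed
    have \<phi>R: "\<phi> x = 0" if "R2 < norm x" for x using \<phi>nz[of x] that by force
    have LR: "L x = 0" if "R2 < norm x" for x
      by (rule has_lap_eq_0[OF \<phi>, of "- cball 0 R2"]) (use that \<phi>R in auto)
    have kato: "(LBINT x. (if u x < w x then (Lw x + F x) * \<phi> x else 0)) \<le> (LBINT x. max 0 (w x - u x) * L x)"
      by (rule dist_lap_eq_kato[OF eq Kc KU r(1) \<phi> _ \<phi>K w]) (simp add: \<phi>_def \<Phi>(2))
    note [measurable] = has_lapD(4,5)[OF \<phi>] has_lapD(4,5)[OF w]
    have i1: "integrable lborel (\<lambda>x. max 0 (w x - u x) * L x)"
    proof (rule integrable_loc_bounded[OF _ _ _ has_lapD(7)[OF \<phi>] LR])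
      show "loc_bounded (\<lambda>x. max 0 (w x - u x))"
      proof (rule loc_bounded_mono[OF has_lapD(6)[OF w]])
        show "\<bar>max 0 (w x - u x)\<bar> \<le> \<bar>w x\<bar>" for x using u[of x] by auto
      qed
    qed auto
    define T where "T x = (if u x < w x then (Lw x + F x) * \<phi> x else 0)" for x
    have i2: "integrable lborel T"
    proof -
      obtain E where E: "0 \<le> E" "\<And>x. \<bar>\<phi> x\<bar> \<le> E"
        using loc_bounded_support[OF has_lapD(6)[OF \<phi>] \<phi>R] by blast
      have "integrable lborel (\<lambda>x. indicator K x * F x)"
        using eq Kc KU by (auto simp: dist_lap_eq_def)
      moreover have "integrable lborel (\<lambda>x. Lw x * \<phi> x)"
        by (rule integrable_loc_bounded[OF _ _ has_lapD(7)[OF w] has_lapD(6)[OF \<phi>] \<phi>R]) auto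
      ultimately have "integrable lborel (\<lambda>x. \<bar>Lw x * \<phi> x\<bar> + \<bar>indicator K x * F x\<bar> * E)" by auto
      moreover have "T \<in> borel_measurable borel" unfolding T_def[abs_def] by measurable
      ultimately show ?thesis
      proof (rule integrable_dominated)
        fix x
        have "\<bar>F x * \<phi> x\<bar> \<le> \<bar>indicator K x * F x\<bar> * E"
        proof (cases "\<phi> x = 0")
          case False
          then have "x \<in> K" using \<phi>K[of x] r by auto
          then show ?thesis using E(2)[of x] by (simp add: abs_mult mult_left_mono)
        qed (use E in simp)
        moreover have "\<bar>(Lw x + F x) * \<phi> x\<bar> \<le> \<bar>Lw x * \<phi> x\<bar> + \<bar>F x * \<phi> x\<bar>"
          unfolding distrib_right by (rule abs_triangle_ineq)
        ultimately show "\<bar>T x\<bar> \<le> \<bar>Lw x * \<phi> x\<bar> + \<bar>indicator K x * F x\<bar> * E"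
          by (auto simp: T_def)
      qed
    qed
    define G1 where "G1 = J (B * d)"
    define G2 where "G2 x = indicator (ball 0 (B * d)) x * (C * c * a powr e)" for x :: 'a
    have G2i: "integrable lborel G2"
      unfolding G2_def[abs_def]
      by (intro integrable_mult_left integrable_real_indicator) (auto simp: emeasure_lborel_ball_finite[simplified])
    have Bd: "d < B * d" using B d by simp
    have zs: "z x * s x powr (b - 1) \<le> c * a powr e" if "d < norm x" for x
      using zb[OF d(1), of x] that by (simp add: a_def)
    have G1i: "integrable lborel G1"
      unfolding G1_def using bi[of "B * d"] B d by simp
    \<comment> \<open>On {u < w} the lower bound -\<mu> z / s for \<Delta>w + F is moved onto the
      test function, where it completes the Hardy operator. On {u \<ge> w} both sides
      vanish.\<close>
    have inner: "max 0 (w x - u x) * L x - T x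
        \<le> z x * s x powr (b - 1) * (- k + C * a / s x)"
      if x: "d < norm x" "norm x < R1" for x
    proof -
      have sx: "a < s x" "s x < R1\<^sup>2" "0 < s x" using x sa[of x] sR[of R1 x] R a by auto
      define W where "W = c * s x powr (- \<alpha> / 2)"
      have wW: "w x = W" using sx by (simp add: w_def W_def powr_ext_eq)
      have W: "0 < W" using sx c by (simp add: W_def)
      have zx: "max 0 (w x - u x) = z x" by (simp add: wW z_def W_def)
      have LwW: "Lw x = - (\<alpha> * (N - 2 - \<alpha>)) * W / s x"
      proof -
        have ee: "- \<alpha> / 2 - 2 + 1 = - \<alpha> / 2 - 1" "- \<alpha> / 2 - 1 + 1 = - \<alpha> / 2" by simp_all
        have p1: "s x powr (- \<alpha> / 2 - 1) = s x powr (- \<alpha> / 2 - 2) * s x"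
          using powr_shift[OF sx(3), of "- \<alpha> / 2 - 2"] unfolding ee .
        have p2: "s x powr (- \<alpha> / 2) = s x powr (- \<alpha> / 2 - 2) * s x * s x"
          using powr_shift[OF sx(3), of "- \<alpha> / 2 - 1"] unfolding ee p1 .
        have m: "max a (s x) = s x" using sx by simp
        have pd: "powr_ext_deriv (- \<alpha> / 2) a (s x) = - \<alpha> / 2 * (s x powr (- \<alpha> / 2 - 2) * s x)"
          using sx by (simp only: powr_ext_deriv_eq less_imp_le p1)
        define Y where "Y = s x powr (- \<alpha> / 2 - 2)"
        show ?thesis
          unfolding Lw_def W_def p2 m pd Y_def[symmetric] using sx by (simp add: field_simps)
      qed
      \<comment> \<open>Here u^q is at most w^q, the bound on c converts w^q into a multiple of w /
        |x|^2, and u^p is dropped as nonnegative. The remainder is linear in w - u.\<close>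
      have key: "- (\<mu> * z x / s x) \<le> Lw x + F x" if "u x < w x"
      proof -
        have "u x powr q \<le> W powr q" using that u[of x] q wW by (intro powr_mono2) auto
        also have "W powr q = c powr (q - 1) * (W / s x)"
        proof -
          have "c powr q = c powr (q - 1) * c" using powr_shift[OF c(1), of "q - 1"] by simp
          moreover have "s x powr (- \<alpha> / 2 * q) = s x powr (- \<alpha> / 2) / s x"
          proof -
            have ex: "- \<alpha> / 2 * q + 1 = - \<alpha> / 2" using q(2) by (simp add: field_simps)
            have "s x powr (- \<alpha> / 2) = s x powr (- \<alpha> / 2 * q) * s x"
              using powr_shift[OF sx(3), of "- \<alpha> / 2 * q"] unfolding ex .
            then show ?thesis using sx by simp
          qed
          ultimately show ?thesis
            using c sx by (simp add: W_def powr_mult powr_powr)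
        qed
        also have "\<dots> \<le> (\<mu> - \<alpha> * (N - 2 - \<alpha>)) * (W / s x)"
          using c(2) W sx by (intro mult_right_mono) auto
        finally have uq: "u x powr q \<le> (\<mu> - \<alpha> * (N - 2 - \<alpha>)) * (W / s x)" .
        have "Lw x + F x \<ge> - (\<alpha> * (N - 2 - \<alpha>)) * W / s x + (\<mu> * u x / s x - (\<mu> - \<alpha> * (N - 2 - \<alpha>)) * (W / s x))"
        proof -
          have "0 \<le> u x powr p" by simp
          moreover have "Lw x + F x = - (\<alpha> * (N - 2 - \<alpha>)) * W / s x + (\<mu> * u x / s x + u x powr p - u x powr q)"
            by (simp add: LwW F s_def[symmetric])
          ultimately show ?thesis using uq by linarith
        qed
        moreover have "- (\<alpha> * (N - 2 - \<alpha>)) * W / s x + (\<mu> * u x / s x - (\<mu> - \<alpha> * (N - 2 - \<alpha>)) * (W / s x)) = - (\<mu> * z x / s x)"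
          using that sx unfolding zx[symmetric] wW by (simp add: field_simps)
        ultimately show ?thesis by linarith
      qed
      have "max 0 (w x - u x) * L x - T x \<le> z x * (L x + \<mu> * \<phi> x / s x)"
      proof (cases "u x < w x")
        case True
        have "- (\<mu> * z x / s x) * \<phi> x \<le> (Lw x + F x) * \<phi> x"
          using key[OF True] \<Phi>(2) by (intro mult_right_mono) (auto simp: \<phi>_def)
        then show ?thesis using True zx by (simp add: T_def algebra_simps)
      next
        case False
        then show ?thesis using zx[symmetric] by (simp add: T_def)
      qed
      also have "L x + \<mu> * \<phi> x / s x \<le> s x powr (b - 1) * (- k + C * a / s x)"
        using cut_powr_hardy[OF a(1) sx(1) hb] \<Phi>(5)[OF sx(1,2)] by (simp add: L_def \<phi>_def C_def)
      then have "z x * (L x + \<mu> * \<phi> x / s x) \<le> z x * (s x powr (b - 1) * (- k + C * a / s x))"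
        using znn by (rule mult_left_mono)
      finally show ?thesis by (simp add: mult.assoc)
    qed
    \<comment> \<open>Five regions: the removed core, the shell where the error is only bounded, the
      part where half of the gap k survives, the annulus where w \<le> u almost everywhere, and the
      exterior of the support.\<close>
    have pt: "AE x in lborel. max 0 (w x - u x) * L x - T x
        \<le> G2 x - k / 2 * G1 x"
      using ann
    proof eventually_elim
      case (elim x)
      have G2nn: "0 \<le> G2 x" using C c by (simp add: G2_def)
      consider "norm x \<le> d" | "d < norm x" "norm x < R1" "norm x < B * d"
        | "d < norm x" "norm x < R1" "B * d \<le> norm x" | "R1 \<le> norm x" "norm x \<le> R2" | "R2 < norm x"
        by linarith
      then show ?case
      proof cases
        case 1
        then have "s x \<le> a" using sa[of x] by auto
        then have "\<phi> x = 0" "L x = 0" using \<Phi>(3) by (auto simp: \<phi>_def L_def)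
        moreover have "G1 x = 0" using 1 Bd by (simp add: G1_def J_def)
        ultimately show ?thesis using G2nn by (simp add: T_def)
      next
        case 2
        have sx: "a < s x" "0 < s x" using 2 sa[of x] a by auto
        have "- k + C * a / s x \<le> C"
        proof -
          have "C * (a / s x) \<le> C * 1" using C sx a by (intro mult_left_mono) auto
          then show ?thesis using k by simp
        qed
        then have "z x * s x powr (b - 1) * (- k + C * a / s x) \<le> z x * s x powr (b - 1) * C"
          using znn[of x] by (intro mult_left_mono) auto
        also have "\<dots> \<le> c * a powr e * C" using zs[OF 2(1)] C by (intro mult_right_mono) auto
        also have "\<dots> = G2 x - k / 2 * G1 x" using 2 by (simp add: G1_def J_def G2_def)
        finally show ?thesis using inner[OF 2(1,2)] by linarith
      next
        case 3
        have sx: "a < s x" "0 < s x" using 3 sa[of x] a by auto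
        have "B\<^sup>2 * a \<le> s x"
          using 3(3) B d power_mono[of "B * d" "norm x" 2] by (simp add: s_def a_def power_mult_distrib)
        then have "a / s x \<le> 1 / B\<^sup>2" using sx B by (simp add: divide_simps mult.commute split: if_splits)
        then have "C * (a / s x) \<le> C * (1 / B\<^sup>2)" using C by (rule mult_left_mono)
        then have "- k + C * a / s x \<le> - k / 2"
          using B(2) unfolding times_divide_eq_right mult_1_right by linarith
        then have "z x * s x powr (b - 1) * (- k + C * a / s x) \<le> z x * s x powr (b - 1) * (- k / 2)"
          using znn[of x] by (intro mult_left_mono) auto
        also have "\<dots> = G2 x - k / 2 * G1 x" using 3 by (simp add: G1_def J_def G2_def)
        finally show ?thesis using inner[OF 3(1,2)] by linarith
      next
        case 4
        have "0 < norm x" using 4 R by linarith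
        have "a < s x" using 4 d sa[of x] by auto
        then have "w x = c * s x powr (- \<alpha> / 2)" by (simp add: w_def powr_ext_eq)
        also have "s x powr (- \<alpha> / 2) \<le> (R1\<^sup>2) powr (- \<alpha> / 2)"
          using 4 R \<alpha> by (intro powr_mono2') (auto simp: s_def intro!: power_mono)
        also have "(R1\<^sup>2) powr (- \<alpha> / 2) = R1 powr - \<alpha>"
          using R by (simp add: powr_powr flip: powr_numeral)
        finally have "w x \<le> c * R1 powr - \<alpha>" using c by simp
        then have "w x \<le> u x" using elim 4 by linarith
        then show ?thesis using G2nn 4 by (simp add: G1_def J_def T_def)
      next
        case 5
        then show ?thesis using \<phi>R LR G2nn R by (simp add: G1_def J_def T_def)
      qed
    qed
    have "0 \<le> (LBINT x. max 0 (w x - u x) * L x - T x)"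
      using kato i1 i2 by (simp add: T_def[abs_def])
    also have "\<dots> \<le> (LBINT x. G2 x - k / 2 * G1 x)"
      using i1 i2 G1i G2i pt by (intro integral_mono_AE) auto
    also have "\<dots> = (LBINT x. G2 x) - k / 2 * (LBINT x. G1 x)"
      using G1i G2i by simp
    finally have "k / 2 * (LBINT x. G1 x) \<le> (LBINT x. G2 x)" by simp
    also have "(LBINT x. G2 x) = D d"
      using B d by (simp add: G2_def[abs_def] D_def content_ball a_def N)
    finally show ?thesis unfolding G1_def .
  qed
  have D0: "(D \<longlongrightarrow> 0) (at_right 0)"
  proof -
    \<comment> \<open>The power of d in \<open>D d\<close> is N + 2 e = (N - 2) / 2 - \<alpha>,
      which is positive.\<close>
    define \<gamma> where "\<gamma> = (N - 2) / 2 - \<alpha>"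
    have "((\<lambda>d. unit_ball_vol N * B ^ DIM('a) * C * c * d powr \<gamma>) \<longlongrightarrow> unit_ball_vol N * B ^ DIM('a) * C * c * 0) (at_right 0)"
    proof (intro tendsto_mult tendsto_const)
      show "((\<lambda>d. d powr \<gamma>) \<longlongrightarrow> 0) (at_right 0)"
        using \<alpha> by (intro tendsto_zero_powrI[OF tendsto_ident_at tendsto_const]) (auto simp: \<gamma>_def eventually_at_filter)
    qed
    moreover have "\<forall>\<^sub>F d in at_right 0. unit_ball_vol N * B ^ DIM('a) * C * c * d powr \<gamma> = D d"
      using eventually_at_right_less[of 0]
    proof eventually_elim
      case (elim d)
      have "(d\<^sup>2) powr e = d powr (2 * e)" using elim by (simp add: powr_powr flip: powr_numeral)
      moreover have "d ^ DIM('a) = d powr N" using elim by (simp add: N powr_realpow)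
      moreover have "\<gamma> = N + 2 * e" by (simp add: \<gamma>_def e_def b_def field_simps)
      ultimately show ?case by (simp add: D_def power_mult_distrib powr_add)
    qed
    ultimately show ?thesis by (simp add: tendsto_cong)
  qed
  \<comment> \<open>For B d \<le> r1 the integral over the fixed annulus is dominated by the one
    starting at B d, hence by a multiple of \<open>D d\<close>.\<close>
  have zero: "AE x in lborel. r1 \<le> norm x \<and> norm x < R1 \<longrightarrow> z x = 0" if r1: "0 < r1" for r1
  proof -
    define f where "f = J r1"
    have fi: "integrable lborel f" unfolding f_def by (rule bi[OF r1])
    have fnn: "0 \<le> f x" for x using znn[of x] by (simp add: f_def J_def)
    have "(LBINT x. f x) \<le> 0"
    proof (rule tendsto_lowerbound)
      show "((\<lambda>d. 2 / k * D d) \<longlongrightarrow> 0) (at_right 0)"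
        using tendsto_mult_left[OF D0, of "2 / k"] by simp
      have "\<forall>\<^sub>F d in at_right 0. d \<in> {0<..<min R1 (r1 / B)}"
        using R r1 B by (intro eventually_at_right_real) auto
      then show "\<forall>\<^sub>F d in at_right 0. (LBINT x. f x) \<le> 2 / k * D d"
      proof eventually_elim
        case (elim d)
        then have d: "0 < d" "d < R1" "B * d \<le> r1" using B by (auto simp: field_simps)
        have "(LBINT x. f x) \<le> (LBINT x. J (B * d) x)"
        proof (rule integral_mono[OF fi bi])
          show "0 < B * d" using B d by simp
          show "f x \<le> J (B * d) x" for x
            using znn[of x] d by (auto simp: f_def J_def indicator_def)
        qed
        also have "\<dots> \<le> 2 / k * D d" using main[OF d(1,2)] k by (simp add: field_simps)
        finally show ?case .
      qed
    qed simp
    then have "(LBINT x. f x) = 0"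
      using Bochner_Integration.integral_nonneg[of lborel f] fnn by fastforce
    then have "AE x in lborel. f x = 0"
      using integral_nonneg_eq_0_iff_AE[OF fi] fnn by simp
    then show ?thesis
    proof eventually_elim
      case (elim x)
      show ?case
      proof
        assume x: "r1 \<le> norm x \<and> norm x < R1"
        then have "0 < s x" using r1 by (auto simp: s_def)
        then show "z x = 0" using elim x by (simp add: f_def J_def)
      qed
    qed
  qed
  \<comment> \<open>Countably many inner radii exhaust the punctured ball, so the exceptional null
    sets can be united.\<close>
  then have "AE x in lborel. \<forall>n. 1 / real (Suc n) \<le> norm x \<and> norm x < R1 \<longrightarrow> z x = 0"
    unfolding AE_all_countable by simp
  then show ?thesis
  proof eventually_elim
    case (elim x)
    show ?case
    proof
      assume x: "x \<in> ball 0 R1 - {0}"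
      then obtain n where "1 / real (Suc n) < norm x"
        by (metis DiffE inverse_eq_divide insertI1 reals_Archimedean zero_less_norm_iff)
      then have "z x = 0" using elim x by (meson DiffE mem_ball_0 less_imp_le)
      moreover have "s x powr (- \<alpha> / 2) = norm x powr - \<alpha>"
        using x by (simp add: s_def powr_powr flip: powr_numeral)
      ultimately show "c * norm x powr - \<alpha> \<le> u x" by (simp add: z_def max_def split: if_splits)
    qed
  qed
qed

subsection \<open>Weak solutions\<close>

lemma powr_le_one_plus:
  fixes t :: real
  assumes "0 \<le> t" "0 \<le> r" "r \<le> r'"
  shows "t powr r \<le> 1 + t powr r'"
proof (cases "t \<le> 1")
  case True
  then have "t powr r \<le> 1" using assms powr_mono2[of r t 1] by simp
  moreover have "0 \<le> t powr r'" by simp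
  ultimately show ?thesis by linarith
next
  case False
  then have "t powr r \<le> t powr r'" using assms by (intro powr_mono) auto
  then show ?thesis by simp
qed

lemma integral_lebesgue_on_eq:
  fixes f h :: "'a::euclidean_space \<Rightarrow> real"
  assumes \<Omega>: "open \<Omega>" and f: "f \<in> borel_measurable (lebesgue_on \<Omega>)" and h: "h \<in> borel_measurable borel"
    and eq: "AE x in lborel. x \<in> \<Omega> \<longrightarrow> f x = h x" and supp: "\<And>x. x \<notin> \<Omega> \<Longrightarrow> h x = 0"
  shows "integral\<^sup>L (lebesgue_on \<Omega>) f = (LBINT x. h x)"
proof -
  have s\<Omega>: "\<Omega> \<in> sets lebesgue" using \<Omega> by auto
  have "integral\<^sup>L (lebesgue_on \<Omega>) f = (\<integral>x. indicator \<Omega> x *\<^sub>R f x \<partial>lebesgue)"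
    using s\<Omega> by (simp add: integral_restrict_space)
  also have "\<dots> = (\<integral>x. h x \<partial>lebesgue)"
  proof (rule integral_cong_AE)
    show "(\<lambda>x. indicator \<Omega> x *\<^sub>R f x) \<in> borel_measurable lebesgue"
      using f s\<Omega> by (subst (asm) borel_measurable_restrict_space_iff) auto
    show "h \<in> borel_measurable lebesgue" using h by (simp add: measurable_completion)
    show "AE x in lebesgue. indicator \<Omega> x *\<^sub>R f x = h x"
      using AE_completion[OF eq] by eventually_elim (use supp in \<open>auto simp: indicator_def\<close>)
  qed
  also have "\<dots> = (LBINT x. h x)" using h by (simp add: integral_completion)
  finally show ?thesis .
qed

lemma integrable_lborel_of_lebesgue_on:
  fixes f h :: "'a::euclidean_space \<Rightarrow> real"
  assumes K: "K \<in> sets borel" and f: "integrable (lebesgue_on K) f" and h: "h \<in> borel_measurable borel"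
    and eq: "AE x in lborel. x \<in> K \<longrightarrow> f x = h x"
  shows "integrable lborel (\<lambda>x. indicator K x * h x)"
proof -
  have i: "integrable lebesgue (\<lambda>x. indicator K x *\<^sub>R f x)"
    using f K by (subst (asm) integrable_restrict_space) auto
  have ae: "AE x in lebesgue. indicator K x *\<^sub>R f x = indicator K x * h x"
    using AE_completion[OF eq] by eventually_elim (auto simp: indicator_def)
  have [measurable]: "(\<lambda>x. indicator K x * h x) \<in> borel_measurable borel"
    using K h by measurable
  have "(\<lambda>x. indicator K x * h x) \<in> borel_measurable lebesgue"
    by (rule measurable_completion) simp
  then have "integrable lebesgue (\<lambda>x. indicator K x * h x)"
    by (rule integrable_cong_AE_imp[OF i _ ae])
  then show ?thesis by (simp add: integrable_completion)
qed

lemma integrable_mult_compact: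
  fixes f \<psi> :: "'a::euclidean_space \<Rightarrow> real"
  assumes f: "integrable lborel (\<lambda>x. indicator K x * f x)" and \<psi>: "continuous_on UNIV \<psi>"
    and K: "compact K" "\<And>x. x \<notin> K \<Longrightarrow> \<psi> x = 0"
  shows "integrable lborel (\<lambda>x. f x * \<psi> x)"
proof -
  obtain R where R: "K \<subseteq> cball 0 R" using compact_imp_bounded[OF K(1)] by (auto simp: bounded_iff subset_iff)
  obtain C where C: "0 \<le> C" "\<And>x. x \<in> cball 0 R \<Longrightarrow> \<bar>\<psi> x\<bar> \<le> C"
    using continuous_bounded_cball[OF \<psi>] by blast
  have C': "\<bar>\<psi> x\<bar> \<le> C" for x using C R K(2)[of x] by (cases "x \<in> K") auto
  have "\<psi> \<in> borel_measurable borel" using \<psi> by (rule borel_measurable_continuous_onI)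
  then have "integrable lborel (\<lambda>x. (indicator K x * f x) * \<psi> x)"
    by (intro integrable_mult_bounded[OF f _ C'])
  moreover have "(indicator K x * f x) * \<psi> x = f x * \<psi> x" for x
    using K(2)[of x] by (auto simp: indicator_def)
  ultimately show ?thesis by simp
qed

text \<open>The analysis takes place with Borel functions on the whole space, so u is replaced by a
  Borel representative v that is nonnegative everywhere. Test functions supported away from 0 see a
  bounded potential, and the powers are locally integrable because t^r \<le> 1 + t^(q + 1) and u
  lies in the space with exponent q + 1.\<close>

lemma weak_solution_dist_lap_eq:
  fixes u :: "'a::euclidean_space \<Rightarrow> real"
  assumes \<Omega>: "open \<Omega>" and u2: "u \<in> Lp 2 \<Omega>" and uq: "u \<in> Lp (q + 1) \<Omega>" and pq: "0 \<le> p" "p \<le> q"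
    and pos: "AE x in lebesgue_on \<Omega>. 0 < u x" and sol: "weak_solution \<Omega> \<mu> p q u"
  obtains v where "v \<in> borel_measurable borel" "\<And>x. 0 \<le> v x"
    "AE x in lborel. x \<in> \<Omega> \<longrightarrow> u x = v x \<and> 0 < v x"
    "dist_lap_eq (\<Omega> - {0}) v (\<lambda>x. \<mu> * v x / (norm x)\<^sup>2 + v x powr p - v x powr q)"
proof -
  have s\<Omega>: "\<Omega> \<in> sets lebesgue" and b\<Omega>: "\<Omega> \<in> sets borel" using \<Omega> by auto
  have um: "u \<in> borel_measurable (lebesgue_on \<Omega>)" using u2 by (simp add: Lp_def)
  then have "(\<lambda>x. indicator \<Omega> x *\<^sub>R u x) \<in> borel_measurable lebesgue"
    using s\<Omega> by (subst (asm) borel_measurable_restrict_space_iff) auto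
  then obtain v0 where v0: "v0 \<in> borel_measurable lborel" "AE x in lborel. indicator \<Omega> x *\<^sub>R u x = v0 x"
    using completion_ex_borel_measurable_real by blast
  have pos': "AE x in lborel. x \<in> \<Omega> \<longrightarrow> 0 < u x"
    using pos s\<Omega> by (subst (asm) AE_restrict_space_iff) (auto simp: AE_completion_iff)
  \<comment> \<open>Taking the positive part changes v0 on \<open>\<Omega>\<close> only in a null
    set, since u > 0 almost everywhere there.\<close>
  define v where "v x = max 0 (v0 x)" for x
  have vm [measurable]: "v \<in> borel_measurable borel" using v0 unfolding v_def[abs_def] by simp
  have vnn: "0 \<le> v x" for x by (simp add: v_def)
  have uv: "AE x in lborel. x \<in> \<Omega> \<longrightarrow> u x = v x \<and> 0 < v x"
    using v0(2) pos' by eventually_elim (auto simp: v_def)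
  obtain g where g: "has_weak_gradient \<Omega> u g"
    and weak: "\<And>\<phi>. \<phi> \<in> test_functions \<Omega> \<Longrightarrow>
      integral\<^sup>L (lebesgue_on \<Omega>) (\<lambda>x. g x \<bullet> grad \<phi> x) - \<mu> * integral\<^sup>L (lebesgue_on \<Omega>) (\<lambda>x. u x * \<phi> x / (norm x)\<^sup>2)
        = integral\<^sup>L (lebesgue_on \<Omega>) (\<lambda>x. (u x powr p - u x powr q) * \<phi> x)"
    using sol unfolding weak_solution_def by blast
  have vK: "integrable lborel (\<lambda>x. indicator K x * v x)" if K: "compact K" "K \<subseteq> \<Omega>" for K
  proof (rule integrable_lborel_of_lebesgue_on[of K u])
    show "integrable (lebesgue_on K) u" using g K by (auto simp: has_weak_gradient_def L1_loc_def)
    show "AE x in lborel. x \<in> K \<longrightarrow> u x = v x" using uv by eventually_elim (use K in auto)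
  qed (use K in \<open>auto intro: borel_compact\<close>)
  have vq: "integrable lborel (\<lambda>x. indicator \<Omega> x * v x powr (q + 1))"
  proof (rule integrable_lborel_of_lebesgue_on[OF b\<Omega>])
    show "integrable (lebesgue_on \<Omega>) (\<lambda>x. norm (u x) powr (q + 1))" using uq by (simp add: Lp_def)
    show "AE x in lborel. x \<in> \<Omega> \<longrightarrow> norm (u x) powr (q + 1) = v x powr (q + 1)" using uv by eventually_elim auto
  qed measurable
  have i1: "integrable lborel (\<lambda>x. indicator K x * (v x / (norm x)\<^sup>2))" if K: "compact K" "K \<subseteq> \<Omega> - {0}" for K
  proof -
    have [measurable]: "K \<in> sets borel" using K by (auto intro: borel_compact)
    obtain d where d: "0 < d" "\<And>x. x \<in> K \<Longrightarrow> d \<le> norm x"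
    proof -
      have "open (- K)" "0 \<in> - K" using K compact_imp_closed by auto
      then obtain d where "0 < d" "ball 0 d \<subseteq> - K" by (meson openE)
      then show thesis by (intro that[of d]) (auto simp: subset_iff not_less[symmetric])
    qed
    show ?thesis
    proof (rule integrable_dominated)
      show "integrable lborel (\<lambda>x. indicator K x * v x * (1 / d\<^sup>2))"
        using vK[of K] K by (intro integrable_mult_left) auto
      show "\<bar>indicator K x * (v x / (norm x)\<^sup>2)\<bar> \<le> indicator K x * v x * (1 / d\<^sup>2)" for x
      proof (cases "x \<in> K")
        case True
        then have "d\<^sup>2 \<le> (norm x)\<^sup>2" "0 < norm x" using d(1) d(2)[OF True] by (auto intro: power_mono)
        then have "v x / (norm x)\<^sup>2 \<le> v x / d\<^sup>2" using d(1) vnn[of x] by (intro divide_left_mono) auto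
        then show ?thesis using True vnn[of x] by simp
      qed simp
    qed measurable
  qed
  have i2: "integrable lborel (\<lambda>x. indicator K x * v x powr r)" if K: "compact K" "K \<subseteq> \<Omega> - {0}" and r: "0 \<le> r" "r \<le> q" for K r
  proof -
    have [measurable]: "K \<in> sets borel" using K by (auto intro: borel_compact)
    show ?thesis
    proof (rule integrable_dominated)
      have "integrable lborel (indicator K :: 'a \<Rightarrow> real)"
        using emeasure_compact_finite[OF K(1)] by (intro integrable_real_indicator) auto
      then show "integrable lborel (\<lambda>x. indicator K x + indicator \<Omega> x * v x powr (q + 1))"
        using vq by simp
      show "\<bar>indicator K x * v x powr r\<bar> \<le> indicator K x + indicator \<Omega> x * v x powr (q + 1)" for x
        using powr_le_one_plus[OF vnn[of x] r(1), of "q + 1"] r K(2) by (auto simp: indicator_def)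
    qed measurable
  qed
  have i3: "integrable lborel (\<lambda>x. indicator K x * (v x powr p - v x powr q))" if K: "compact K" "K \<subseteq> \<Omega> - {0}" for K
    using i2[OF K, of p] i2[OF K, of q] pq by (simp add: right_diff_distrib)
  have "dist_lap_eq (\<Omega> - {0}) v (\<lambda>x. \<mu> * v x / (norm x)\<^sup>2 + v x powr p - v x powr q)"
    unfolding dist_lap_eq_def
  proof (intro conjI allI impI ballI)
    fix K assume K: "compact K \<and> K \<subseteq> \<Omega> - {0}"
    then show "integrable lborel (\<lambda>x. indicator K x * v x)" using vK[of K] by auto
    have "integrable lborel (\<lambda>x. \<mu> * (indicator K x * (v x / (norm x)\<^sup>2)) + indicator K x * (v x powr p - v x powr q))"
      by (intro Bochner_Integration.integrable_add integrable_mult_right i1 i3) (use K in auto)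
    then show "integrable lborel (\<lambda>x. indicator K x * (\<mu> * v x / (norm x)\<^sup>2 + v x powr p - v x powr q))"
      by (simp add: algebra_simps)
  next
    fix \<phi> assume \<phi>: "\<phi> \<in> test_functions (\<Omega> - {0})"
    then have \<phi>\<Omega>: "\<phi> \<in> test_functions \<Omega>" by (auto simp: test_functions_def)
    define K where "K = closure {x. \<phi> x \<noteq> 0}"
    note \<phi>K = test_functionD[OF \<phi>, folded K_def]
    have lap: "has_lap \<phi> (smooth_lap \<phi>)" by (rule smooth_has_lap[OF \<phi>K(1)])
    have "closed K" by (simp add: K_def)
    then have LK: "smooth_lap \<phi> x = 0" if "x \<notin> K" for x
      by (intro has_lap_eq_0[OF lap, of "- K"]) (use that \<phi>K(4) in auto)
    note [measurable] = has_lapD(4,5)[OF lap]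
    have lm: "h \<in> borel_measurable (lebesgue_on \<Omega>)" if "h \<in> borel_measurable borel" for h :: "'a \<Rightarrow> real"
      using that by (intro measurable_restrict_space1 measurable_completion) simp
    have [measurable]: "\<phi> \<in> borel_measurable (lebesgue_on \<Omega>)" "smooth_lap \<phi> \<in> borel_measurable (lebesgue_on \<Omega>)"
      "u \<in> borel_measurable (lebesgue_on \<Omega>)" "(\<lambda>x. (norm x)\<^sup>2) \<in> borel_measurable (lebesgue_on \<Omega>)"
      using um has_lapD(4,5)[OF lap] by (auto intro!: lm)
    have e1: "integral\<^sup>L (lebesgue_on \<Omega>) (\<lambda>x. u x * smooth_lap \<phi> x) = (LBINT x. v x * smooth_lap \<phi> x)"
    proof (rule integral_lebesgue_on_eq[OF \<Omega>])
      show "AE x in lborel. x \<in> \<Omega> \<longrightarrow> u x * smooth_lap \<phi> x = v x * smooth_lap \<phi> x" using uv by eventually_elim auto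
      show "v x * smooth_lap \<phi> x = 0" if "x \<notin> \<Omega>" for x using that LK[of x] \<phi>K(3) by auto
    qed measurable
    have e2: "integral\<^sup>L (lebesgue_on \<Omega>) (\<lambda>x. u x * \<phi> x / (norm x)\<^sup>2) = (LBINT x. v x / (norm x)\<^sup>2 * \<phi> x)"
    proof (rule integral_lebesgue_on_eq[OF \<Omega>])
      show "AE x in lborel. x \<in> \<Omega> \<longrightarrow> u x * \<phi> x / (norm x)\<^sup>2 = v x / (norm x)\<^sup>2 * \<phi> x" using uv by eventually_elim auto
      show "v x / (norm x)\<^sup>2 * \<phi> x = 0" if "x \<notin> \<Omega>" for x using that \<phi>K(3) \<phi>K(4)[of x] by auto
    qed measurable
    have e3: "integral\<^sup>L (lebesgue_on \<Omega>) (\<lambda>x. (u x powr p - u x powr q) * \<phi> x) = (LBINT x. (v x powr p - v x powr q) * \<phi> x)"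
    proof (rule integral_lebesgue_on_eq[OF \<Omega>])
      show "AE x in lborel. x \<in> \<Omega> \<longrightarrow> (u x powr p - u x powr q) * \<phi> x = (v x powr p - v x powr q) * \<phi> x" using uv by eventually_elim auto
      show "(v x powr p - v x powr q) * \<phi> x = 0" if "x \<notin> \<Omega>" for x using that \<phi>K(3) \<phi>K(4)[of x] by auto
    qed measurable
    have j: "integrable lborel (\<lambda>x. v x / (norm x)\<^sup>2 * \<phi> x)" "integrable lborel (\<lambda>x. (v x powr p - v x powr q) * \<phi> x)"
      by (rule integrable_mult_compact[OF i1[OF \<phi>K(2,3)] has_lapD(1)[OF lap] \<phi>K(2,4)]
          integrable_mult_compact[OF i3[OF \<phi>K(2,3)] has_lapD(1)[OF lap] \<phi>K(2,4)], assumption)+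
    have "(LBINT x. (\<mu> * v x / (norm x)\<^sup>2 + v x powr p - v x powr q) * \<phi> x) =
        (LBINT x. \<mu> * (v x / (norm x)\<^sup>2 * \<phi> x) + (v x powr p - v x powr q) * \<phi> x)"
      by (rule Bochner_Integration.integral_cong) (auto simp: algebra_simps)
    also have "\<dots> = \<mu> * (LBINT x. v x / (norm x)\<^sup>2 * \<phi> x) + (LBINT x. (v x powr p - v x powr q) * \<phi> x)"
      by (subst Bochner_Integration.integral_add[OF integrable_mult_right[OF j(1)] j(2)])
         (simp only: integral_mult_right_zero)
    also have "\<dots> = - (LBINT x. v x * smooth_lap \<phi> x)"
      using weak[OF \<phi>\<Omega>] unfolding integral_grad_eq[OF \<Omega> g \<phi>\<Omega>] e1 e2 e3 by linarith
    finally show "(LBINT x. v x * smooth_lap \<phi> x) = - (LBINT x. (\<mu> * v x / (norm x)\<^sup>2 + v x powr p - v x powr q) * \<phi> x)"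
      by simp
  qed
  then show thesis using that vm vnn uv by blast
qed

section \<open>From almost every point to points of continuity\<close>

lemma AE_ge_imp_ge_continuous:
  fixes v w :: "'a::euclidean_space \<Rightarrow> real"
  assumes ae: "AE y in lborel. y \<in> U \<longrightarrow> w y \<le> v y" and U: "open U" "x \<in> U"
    and v: "isCont v x" and w: "isCont w x"
  shows "w x \<le> v x"
proof (rule ccontr)
  assume "\<not> w x \<le> v x"
  then have "v x - w x < 0" by simp
  moreover have "((\<lambda>y. v y - w y) \<longlongrightarrow> v x - w x) (nhds x)"
    using v w by (intro tendsto_diff) (simp_all add: continuous_within tendsto_at_iff_tendsto_nhds)
  ultimately have "\<forall>\<^sub>F y in nhds x. v y - w y < 0" by (rule order_tendstoD(2)[rotated])
  then obtain S where S: "open S" "x \<in> S" "\<And>y. y \<in> S \<Longrightarrow> v y - w y < 0"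
    unfolding eventually_nhds by blast
  then obtain r where r: "0 < r" "ball x r \<subseteq> S \<inter> U" using U by (meson open_Int IntI openE)
  have "AE y in lborel. y \<notin> ball x r"
    using ae by eventually_elim (use r S(3) in force)
  with \<open>0 < r\<close> show False using not_AE_notin_ball by force
qed

text \<open>As u stands for an equivalence class, the pointwise bound is expressed in two ways:
  almost everywhere on the punctured ball, and at every continuity point of every representative.
  For a representative that is continuous on the punctured ball, the latter means every
  point.\<close>

theorem theorem1p6:
  fixes \<Omega> :: "(real ^ 'n) set" and u :: "real ^ 'n \<Rightarrow> real"
    and N mubar \<mu> \<nu> p q twostar :: real
  assumes "N = real CARD('n)" and "CARD('n) \<ge> 3"
    and "mubar = ((N - 2) / 2)\<^sup>2"
    and "0 < \<mu>" and "\<mu> < mubar"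
    and "\<nu> = sqrt mubar - sqrt (mubar - \<mu>)"
    and "twostar = 2 * N / (N - 2)"
    and "p \<ge> twostar - 1"
    and "q > max p ((2 + \<nu>) / \<nu>)"
    and "smooth_domain \<Omega>" and "0 \<in> \<Omega>"
    and "u \<in> H01 \<Omega>" and "u \<in> Lp (q + 1) \<Omega>"
    and "AE x in lebesgue_on \<Omega>. u x > 0"
    and "weak_solution \<Omega> \<mu> p q u"
  shows "\<exists>C>0. \<exists>R>0. ball 0 R \<subseteq> \<Omega> \<and>
           (AE x in lebesgue_on (ball 0 R - {0}). u x \<ge> C * norm x powr (- (2 / (q - 1)))) \<and>
           (\<forall>v. (AE x in lebesgue_on \<Omega>. v x = u x) \<longrightarrow>
              (\<forall>x \<in> ball 0 R - {0}. isCont v x \<longrightarrow> v x \<ge> C * norm x powr (- (2 / (q - 1)))))"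
proof -
  have N: "N = real DIM(real ^ 'n)" "3 \<le> DIM(real ^ 'n)" "3 \<le> N" using assms(1,2) by auto
  define h where "h = (N - 2) / 2"
  have h: "0 < h" "mubar = h\<^sup>2" using N assms(3) by (auto simp: h_def)
  \<comment> \<open>With h = (N - 2) / 2, the numbers h - d = \<nu> and h + d are the roots of t (N
    - 2 - t) = \<mu>.\<close>
  define d where "d = sqrt (mubar - \<mu>)"
  have d: "0 < d" "d\<^sup>2 = h\<^sup>2 - \<mu>" using assms(5) h by (auto simp: d_def)
  have \<nu>: "\<nu> = h - d" using assms(6) h by (simp add: d_def)
  have "d\<^sup>2 < h\<^sup>2" using d assms(4) by simp
  then have dh: "d < h" using h power_less_imp_less_base[of d 2 h] by simp
  have "0 < \<nu>" using dh \<nu> by simp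
  have p: "1 < p"
  proof -
    have "2 < 2 * N / (N - 2)" using N(3) by (simp add: less_divide_eq)
    then show ?thesis using assms(7,8) by linarith
  qed
  have pq: "p < q" "(2 + \<nu>) / \<nu> < q" using assms(9) by auto
  define \<alpha> where "\<alpha> = 2 / (q - 1)"
  have q1: "1 < q" using p pq by linarith
  have \<alpha>: "0 < \<alpha>" "\<alpha> < \<nu>" "\<alpha> * q = \<alpha> + 2"
  proof -
    show "0 < \<alpha>" using q1 by (simp add: \<alpha>_def)
    have "2 + \<nu> < q * \<nu>" using pq(2) \<open>0 < \<nu>\<close> by (simp add: divide_less_eq)
    then show "\<alpha> < \<nu>" using q1 by (simp add: \<alpha>_def divide_less_eq algebra_simps)
    show "\<alpha> * q = \<alpha> + 2" using q1 by (simp add: \<alpha>_def field_simps)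
  qed
  \<comment> \<open>The room left for c^(q - 1). It equals (h - \<alpha>)^2 - d^2, which is positive
    because \<alpha> < \<nu> = h - d.\<close>
  define m where "m = \<mu> - \<alpha> * (N - 2 - \<alpha>)"
  have m: "0 < m"
  proof -
    have "m = (h - \<alpha>)\<^sup>2 - d\<^sup>2" unfolding d(2) m_def h_def by (simp add: power2_eq_square field_simps)
    moreover have "d\<^sup>2 < (h - \<alpha>)\<^sup>2" using \<alpha> \<nu> d by (intro power_strict_mono) auto
    ultimately show ?thesis by simp
  qed
  have \<Omega>: "open \<Omega>" using assms(10) by (simp add: smooth_domain_def)
  have u2: "u \<in> Lp 2 \<Omega>" using assms(12) by (simp add: H01_def)
  define F where "F v = (\<lambda>x. \<mu> * v x / (norm x)\<^sup>2 + v x powr p - v x powr q)" for v :: "real ^ 'n \<Rightarrow> real"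
  obtain v where v: "v \<in> borel_measurable borel" "\<And>x. 0 \<le> v x"
    "AE x in lborel. x \<in> \<Omega> \<longrightarrow> u x = v x \<and> 0 < v x" "dist_lap_eq (\<Omega> - {0}) v (F v)"
    using weak_solution_dist_lap_eq[OF \<Omega> u2 assms(13) _ _ assms(14,15)] p pq unfolding F_def by auto
  obtain r where r: "0 < r" "cball 0 r \<subseteq> \<Omega>" using \<Omega> assms(11) open_contains_cball by blast
  \<comment> \<open>The bound by the square root of \<mu> gives \<mu> / |x|^2 \<ge> 1 throughout the
    punctured ball of radius R0, hence v^q \<le> v \<le> \<mu> v / |x|^2 wherever v < 1.\<close>
  define R0 where "R0 = min r (sqrt \<mu>)"
  have R0: "0 < R0" "R0 \<le> r" "R0\<^sup>2 \<le> \<mu>"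
  proof -
    show "0 < R0" "R0 \<le> r" using r assms(4) by (auto simp: R0_def)
    then have "R0\<^sup>2 \<le> (sqrt \<mu>)\<^sup>2" by (intro power_mono) (auto simp: R0_def)
    then show "R0\<^sup>2 \<le> \<mu>" using assms(4) by simp
  qed
  have R0\<Omega>: "cball 0 R0 \<subseteq> \<Omega>" using r R0 by (meson order_trans subset_cball)
  \<comment> \<open>The radii R0/2 and 3 R0/4 keep the annulus \<open>A\<close> at distance R0/4
    from both boundary spheres of \<open>K\<close>.\<close>
  define R1 where "R1 = R0 / 2"
  define R2 where "R2 = 3 * R0 / 4"
  define A where "A = {x :: real ^ 'n. R1 \<le> norm x \<and> norm x \<le> R2}"
  define K where "K = {x :: real ^ 'n. R0 / 4 \<le> norm x \<and> norm x \<le> R0}"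
  have KU: "K \<subseteq> \<Omega> - {0}" using R0 R0\<Omega> by (auto simp: K_def subset_iff)
  have AK: "cball x (R0 / 4) \<subseteq> K" if "x \<in> A" for x
  proof
    fix y assume "y \<in> cball x (R0 / 4)"
    then have "norm (x - y) \<le> R0 / 4" by (simp add: dist_norm)
    then show "y \<in> K"
      using that norm_triangle_ineq3[of x y] by (simp add: A_def K_def R1_def R2_def abs_le_iff)
  qed
  have Fpos: "0 \<le> F v x" if x: "x \<in> K" and v1: "v x < 1" for x
  proof -
    have nx: "0 < (norm x)\<^sup>2" "(norm x)\<^sup>2 \<le> \<mu>"
    proof -
      have "0 < norm x" using x R0 by (auto simp: K_def)
      then show "0 < (norm x)\<^sup>2" by simp
      have "(norm x)\<^sup>2 \<le> R0\<^sup>2" using x by (intro power_mono) (auto simp: K_def)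
      then show "(norm x)\<^sup>2 \<le> \<mu>" using R0(3) by linarith
    qed
    have "v x powr q \<le> v x powr 1" using v1 v(2)[of x] q1 by (intro powr_mono') auto
    also have "v x powr 1 = v x" using v(2)[of x] by simp
    also have "v x \<le> \<mu> * v x / (norm x)\<^sup>2"
      using nx v(2)[of x] mult_right_mono[of "(norm x)\<^sup>2" \<mu> "v x"] by (simp add: le_divide_eq mult.commute)
    finally have "v x powr q \<le> \<mu> * v x / (norm x)\<^sup>2" .
    moreover have "0 \<le> v x powr p" by simp
    ultimately show ?thesis unfolding F_def by linarith
  qed
  obtain \<delta> where \<delta>: "0 < \<delta>" "AE x in lborel. x \<in> A \<longrightarrow> \<delta> \<le> v x"
  proof (rule positive_lower_bound[OF N(2) v(4) _ KU _ _ AK v(2) _ Fpos])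
    show "compact K" "compact A" unfolding K_def A_def by (rule compact_annulus)+
    show "AE x in lborel. x \<in> K \<longrightarrow> 0 < v x" using v(3) by eventually_elim (use KU in auto)
  qed (use R0 that in auto)
  \<comment> \<open>The first bound puts w below \<delta>, hence below u, on the annulus; the second
    is the subsolution condition.\<close>
  define c where "c = min (\<delta> / R1 powr - \<alpha>) (m powr (1 / (q - 1)))"
  have R1: "0 < R1" using R0 by (simp add: R1_def)
  have c: "0 < c" "c * R1 powr - \<alpha> \<le> \<delta>" "c powr (q - 1) \<le> m"
  proof -
    show "0 < c" using \<delta> R1 m by (simp add: c_def)
    have "c \<le> \<delta> / R1 powr - \<alpha>" by (simp add: c_def)
    then show "c * R1 powr - \<alpha> \<le> \<delta>" using R1 by (simp add: le_divide_eq)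
    have "c powr (q - 1) \<le> (m powr (1 / (q - 1))) powr (q - 1)"
      using \<open>0 < c\<close> q1 by (intro powr_mono2) (auto simp: c_def)
    then show "c powr (q - 1) \<le> m" using q1 m by (simp add: powr_powr)
  qed
  have below: "AE x in lborel. x \<in> ball 0 R1 - {0} \<longrightarrow> c * norm x powr - \<alpha> \<le> v x"
  proof (rule comparison_near_0[OF N(1,2) v(1,2) F_def[of v] v(4), where ?R2.0=R2 and ?R0.0=R0])
    show "AE x in lborel. R1 \<le> norm x \<and> norm x \<le> R2 \<longrightarrow> c * R1 powr - \<alpha> \<le> v x"
      using \<delta>(2) by eventually_elim (use c(2) in \<open>auto simp: A_def\<close>)
    show "\<alpha> < (N - 2) / 2" using \<alpha>(2) \<nu> d(1) unfolding h_def by linarith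
  qed (use R0 R0\<Omega> R1 assms(3,4,5) \<alpha> q1 c in \<open>auto simp: R1_def R2_def m_def\<close>)
  have R1\<Omega>: "ball 0 R1 \<subseteq> \<Omega>" using R0\<Omega> R0 by (auto simp: R1_def subset_iff)
  have ub: "AE x in lborel. x \<in> ball 0 R1 - {0} \<longrightarrow> c * norm x powr - \<alpha> \<le> u x"
    using below v(3) by eventually_elim (use R1\<Omega> in auto)
  show ?thesis
  proof (rule exI[of _ c], rule conjI, rule c(1), rule exI[of _ R1], intro conjI allI impI ballI)
    have sB: "ball 0 R1 - {0} \<in> sets (lebesgue :: (real ^ 'n) measure)" by (simp add: sets.Diff)
    show "AE x in lebesgue_on (ball 0 R1 - {0}). c * norm x powr (- (2 / (q - 1))) \<le> u x"
      using ub sB by (subst AE_restrict_space_iff) (auto simp: AE_completion_iff \<alpha>_def)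
    fix f x assume f: "AE x in lebesgue_on \<Omega>. f x = u x" and x: "x \<in> ball 0 R1 - {0}" and cont: "isCont f x"
    have "\<Omega> \<in> sets lebesgue" using \<Omega> by auto
    then have "AE x in lborel. x \<in> \<Omega> \<longrightarrow> f x = u x"
      using f by (subst (asm) AE_restrict_space_iff) (auto simp: AE_completion_iff)
    with ub have ae: "AE y in lborel. y \<in> ball 0 R1 - {0} \<longrightarrow> c * norm y powr - \<alpha> \<le> f y"
      by eventually_elim (use R1\<Omega> in auto)
    have "c * norm x powr - \<alpha> \<le> f x"
      by (rule AE_ge_imp_ge_continuous[OF ae _ x cont]) (use x in \<open>auto intro!: continuous_intros open_Diff\<close>)
    then show "c * norm x powr (- (2 / (q - 1))) \<le> f x" by (simp add: \<alpha>_def)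
  qed (rule R1 R1\<Omega>)+
qed

end
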